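(* Every $(x,u)$-flat system $\dot x=f(x,u)$ can be exactly feedback linearized with respect to every $(x,u)$-flat output $y=\varphi(x,u)$ by a quasi-static feedback of the state $x$. More precisely, let $y=\varphi(x,u)$ be an $(x,u)$-flat output with minimal multi-index $R$ and flat parameterization $x=F_x(\varphi_{[0,R-1]})$, $u=F_u(\varphi_{[0,R]})$. Then there exists a multi-index $\kappa=(\kappa^1,\dots,\kappa^m)\le R$ with $|\kappa|=n$ for which the differentials $\mathrm{d}x,\mathrm{d}\varphi_{[\kappa]},\mathrm{d}\varphi_{[\kappa+1]},\dots,\mathrm{d}\varphi_{[R-1]}$ are linearly independent, and, with the local diffeomorphism $\Psi$ expressing $\varphi_{[0,R]}=\Psi(x,v_{[0,R-\kappa]})$ for $v_{[0,R-\kappa]}=\varphi_{[\kappa,R]}$, the feedback $$u=F_u\circ\Psi(x,v_{[0,R-\kappa]})$$ is a quasi-static feedback of the state $x$ such that the input-output behavior of the closed-loop system is given by $y_{[\kappa]}=v$.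
   Context: Setting. $\mathcal X$ is an $n$-dimensional smooth manifold with local coordinates $x=(x^1,\dots,x^n)$, and $\dot x=f(x,u)$ is a smooth control system with $m$ inputs $u=(u^1,\dots,u^m)$. On the manifold $\mathcal X\times\mathcal U_{[0,l_u]}$ with coordinates $(x,u,u_{[1]},\dots,u_{[l_u]})$, where $u_{[\alpha]}$ denotes the $\alpha$-th time derivative of $u$ and $l_u$ is a sufficiently large finite integer, consider the vector field $$f_u=\sum_{i=1}^n f^i(x,u)\,\partial_{x^i}+\sum_{j=1}^m\sum_{\alpha=0}^{l_u-1}u^j_{[\alpha+1]}\,\partial_{u^j_{[\alpha]}}.$$ The Lie derivative $\mathrm L_{f_u}h$ is the time derivative of a function $h$ along trajectories, and $h_{[\alpha]}$ denotes the $\alpha$-th time derivative of $h$. All results are generically local (they hold locally on open dense subsets), and all Jacobian matrices and codistributions considered are assumed to have locally constant rank. Linear independence of differentials is over smooth functions. Multi-index notation. A multi-index $A=(a^1,\dots,a^m)$ consists of nonnegative integers; $|A|=\sum_j a^j$; addition, subtraction, and $A\le B$ are meant componentwise, and $A\pm c$ for an integer $c$ adds/subtracts $c$ in every component; $h_{[A]}=(h^1_{[a^1]},\dots,h^m_{[a^m]})$; $h_{[A,B]}$ is the collection of all $h^j_{[\beta]}$ with $a^j\le\beta\le b^j$ (empty for those $j$ with $a^j>b^j$); $h_{[0,B]}$ is the collection of all $h^j_{[\beta]}$ with $0\le\beta\le b^j$. The list $\mathrm{d}\varphi_{[\kappa]},\mathrm{d}\varphi_{[\kappa+1]},\dots,\mathrm{d}\varphi_{[R-1]}$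 means all $\mathrm{d}\varphi^j_{[\beta]}$ with $\kappa^j\le\beta\le r^j-1$, $j=1,\dots,m$. Flatness. The system is flat if there exist an $m$-tuple of smooth functions $y^j=\varphi^j(x,u,u_{[1]},\dots,u_{[q]})$, $j=1,\dots,m$, and smooth functions $F_x,F_u$ such that locally $x=F_x(\varphi_{[0,R-1]})$ and $u=F_u(\varphi_{[0,R]})$ for some multi-index $R=(r^1,\dots,r^m)$, where $\varphi_{[\alpha]}=\mathrm L_{f_u}^\alpha\varphi$. The $m$-tuple is called a flat output. There is a unique minimal such multi-index with unique corresponding $F_x$, $F_u$; $R$ always denotes this minimal one. A flat output of the form $y=\varphi(x,u)$ (possibly depending on $u$, but not on time derivatives of $u$) is called an $(x,u)$-flat output, and a system possessing one is called $(x,u)$-flat. The map $\Psi$ is the local inverse of the map $\varphi_{[0,R]}\mapsto(F_x(\varphi_{[0,R-1]}),\varphi_{[\kappa,R]})$, with $v_{[0,R-\kappa]}:=\varphi_{[\kappa,R]}$, i.e. $v^j_{[\lambda]}=\varphi^j_{[\kappa^j+\lambda]}$ for $0\le\lambda\le r^j-\kappa^j$. Quasi-static feedback of the state $x$. Given an invertible transformation of the form $u=\alpha(x,v,v_{[1]},\dots)$, $u_{[k]}=\alpha_k(x,v,v_{[1]},\dots)$, with inverse $v=\hat\alpha(x,u,u_{[1]},\dots)$, $v_{[k]}=\hat\alpha_k(x,u,u_{[1]},\dots)$, $k\ge1$, such that the differentials $\mathrm{d}x,\mathrm{d}v,\mathrm{d}v_{[1]},\dots$ are linearly independent, $u=\alpha(x,v,v_{[1]},\dots)$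 is called a quasi-static feedback of the state $x$. The closed-loop system, obtained by inserting the feedback into $\dot x=f(x,u)$, has the input-output behavior $y_{[\kappa]}=v$ if, with $y$ and its time derivatives evaluated along trajectories of the closed-loop system, the $\kappa^j$-th time derivative of $y^j$ equals $v^j$ for $j=1,\dots,m$. *)

theory Defs
  imports "HOL-Analysis.Analysis"
begin

section \<open>Smooth functions of finitely many among possibly infinitely many coordinates\<close>

text \<open>
  Points of a coordinate space are functions from coordinate names to reals, with the product
  topology.  This lets the order of the occurring time derivatives vary inside a statement.
  All functions considered depend on finitely many coordinates only.
\<close>

definition depends_on :: "'c set \<Rightarrow> ('c \<Rightarrow> real) set \<Rightarrow> (('c \<Rightarrow> real) \<Rightarrow> 'b) \<Rightarrow> bool" where
  "depends_on C S h \<longleftrightarrow> (\<forall>z\<in>S. \<forall>z'\<in>S. (\<forall>c\<in>C. z c = z' c) \<longrightarrow> h z = h z')"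

definition partial :: "'c \<Rightarrow> (('c \<Rightarrow> real) \<Rightarrow> real) \<Rightarrow> ('c \<Rightarrow> real) \<Rightarrow> real" where
  "partial c h z = deriv (\<lambda>t. h (z(c := t))) (z c)"

primrec Ck_on :: "nat \<Rightarrow> ('c \<Rightarrow> real) set \<Rightarrow> (('c \<Rightarrow> real) \<Rightarrow> real) \<Rightarrow> bool" where
  "Ck_on 0 S h \<longleftrightarrow> continuous_on S h"
| "Ck_on (Suc k) S h \<longleftrightarrow> continuous_on S h \<and>
     (\<forall>c. (\<forall>z\<in>S. (\<lambda>t. h (z(c := t))) field_differentiable at (z c)) \<and> Ck_on k S (partial c h))"

definition smooth_on :: "('c \<Rightarrow> real) set \<Rightarrow> (('c \<Rightarrow> real) \<Rightarrow> real) \<Rightarrow> bool" where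
  "smooth_on S h \<longleftrightarrow> (\<exists>C. finite C \<and> depends_on C S h) \<and> (\<forall>k. Ck_on k S h)"

text \<open>
  The differential of \<open>h\<close> at \<open>z\<close> is the family of its partial derivatives.  The first
  conjunct is linear independence over the ring of smooth functions on \<open>W\<close>.  The second one adds
  what the standing constant rank assumption turns it into, namely independence of the covectors at
  each point of \<open>W\<close>.
\<close>

definition independent_differentials ::
  "('c \<Rightarrow> real) set \<Rightarrow> 'i set \<Rightarrow> ('i \<Rightarrow> ('c \<Rightarrow> real) \<Rightarrow> real) \<Rightarrow> bool" where
  "independent_differentials W I h \<longleftrightarrow>
     (\<forall>J g. finite J \<and> J \<subseteq> I \<and> (\<forall>i\<in>J. smooth_on W (g i)) \<and>
        (\<forall>z\<in>W. \<forall>c. (\<Sum>i\<in>J. g i z * partial c (h i) z) = 0)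
        \<longrightarrow> (\<forall>i\<in>J. \<forall>z\<in>W. g i z = 0)) \<and>
     (\<forall>z\<in>W. \<forall>J a. finite J \<and> J \<subseteq> I \<and> (\<forall>c. (\<Sum>i\<in>J. a i * partial c (h i) z) = 0)
        \<longrightarrow> (\<forall>i\<in>J. a i = 0))"


section \<open>Control systems and time derivatives\<close>

text \<open>
  \<open>Xc i\<close> names the state coordinate $x^i$ and \<open>Uc j k\<close> the $k$-th time derivative of the
  $j$-th input.  The same coordinates serve for $(x,u,u_{[1]},\dots)$ and for
  $(x,v,v_{[1]},\dots)$.
\<close>

datatype ('n, 'm) coord = Xc 'n | Uc 'm nat

type_synonym ('n, 'm) jet = "('n, 'm) coord \<Rightarrow> real"

definition state :: "('n::finite, 'm) jet \<Rightarrow> real ^ 'n" where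
  "state z = (\<chi> i. z (Xc i))"

definition inp :: "('n, 'm::finite) jet \<Rightarrow> real ^ 'm" where
  "inp z = (\<chi> j. z (Uc j 0))"

text \<open>
  The derivation along $\sum_i g^i \partial_{x^i} + \sum_j \sum_\alpha
  u^j_{[\alpha+1]} \partial_{u^j_{[\alpha]}}$, where \<open>g\<close> may depend on derivatives of the input.
  The sum over $\alpha$ is not truncated at some large $l_u$; on a function of order below
  $l_u$ this makes no difference, see \<open>lie_truncate\<close>.
\<close>

definition lie :: "(('n::finite, 'm::finite) jet \<Rightarrow> real ^ 'n) \<Rightarrow>
    (('n, 'm) jet \<Rightarrow> real) \<Rightarrow> ('n, 'm) jet \<Rightarrow> real" where
  "lie g h z = (\<Sum>i\<in>UNIV. g z $ i * partial (Xc i) h z)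
     + (\<Sum>j\<in>UNIV. \<Sum>\<alpha>. z (Uc j (Suc \<alpha>)) * partial (Uc j \<alpha>) h z)"

lemma lie_truncate:
  fixes g :: "('n::finite, 'm::finite) jet \<Rightarrow> real ^ 'n"
  assumes "open S" "z \<in> S"
    and dep: "depends_on (range Xc \<union> {Uc j \<alpha> | j \<alpha>. \<alpha> < l}) S h"
  shows "lie g h z = (\<Sum>i\<in>UNIV. g z $ i * partial (Xc i) h z)
     + (\<Sum>j\<in>UNIV. \<Sum>\<alpha><l. z (Uc j (Suc \<alpha>)) * partial (Uc j \<alpha>) h z)"
proof -
  have zero: "partial (Uc j \<alpha>) h z = 0" if "\<alpha> \<ge> l" for j :: 'm and \<alpha>
  proof -
    let ?p = "\<lambda>t. z(Uc j \<alpha> := t)"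
    have "continuous_on UNIV ?p"
    proof (rule continuous_on_coordinatewise_then_product)
      show "continuous_on UNIV (\<lambda>t. ?p t c)" for c
        by (cases "c = Uc j \<alpha>") (auto intro: continuous_on_id)
    qed
    then have op: "open (?p -` S)"
      using \<open>open S\<close> by (simp add: continuous_on_open_vimage)
    have mem: "z (Uc j \<alpha>) \<in> ?p -` S" using \<open>z \<in> S\<close> by simp
    have const: "h (?p t) = h z" if "t \<in> ?p -` S" for t
      
    proof -
      have "\<forall>c\<in>range Xc \<union> {Uc j \<alpha> | j \<alpha>. \<alpha> < l}. ?p t c = z c"
        using \<open>\<alpha> \<ge> l\<close> by auto
      moreover have "?p t \<in> S" using that by simp
      ultimately show ?thesis using dep \<open>z \<in> S\<close> unfolding depends_on_def by blast
    qed
    have "((\<lambda>_. h z) has_field_derivative 0) (at (z (Uc j \<alpha>)))"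
      by (rule DERIV_const)
    then have "((\<lambda>t. h (?p t)) has_field_derivative 0) (at (z (Uc j \<alpha>)))"
      by (rule has_field_derivative_transform_within_open[OF _ op mem]) (simp only: const)
    then show ?thesis unfolding partial_def by (rule DERIV_imp_deriv)
  qed
  have "(\<Sum>\<alpha>. z (Uc j (Suc \<alpha>)) * partial (Uc j \<alpha>) h z)
      = (\<Sum>\<alpha><l. z (Uc j (Suc \<alpha>)) * partial (Uc j \<alpha>) h z)" for j :: 'm
    by (rule suminf_finite) (simp_all add: zero)
  then show ?thesis unfolding lie_def by simp
qed

definition open_loop :: "(real ^ 'n \<Rightarrow> real ^ 'm \<Rightarrow> real ^ 'n) \<Rightarrow>
    ('n::finite, 'm::finite) jet \<Rightarrow> real ^ 'n" where
  "open_loop f z = f (state z) (inp z)"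

definition closed_loop :: "(real ^ 'n \<Rightarrow> real ^ 'm \<Rightarrow> real ^ 'n) \<Rightarrow>
    (('n, 'm) jet \<Rightarrow> real ^ 'm) \<Rightarrow> ('n::finite, 'm::finite) jet \<Rightarrow> real ^ 'n" where
  "closed_loop f a w = f (state w) (a w)"

definition smooth_system ::
  "(real ^ 'n \<Rightarrow> real ^ 'm \<Rightarrow> real ^ 'n) \<Rightarrow> ('n::finite, 'm::finite) jet set \<Rightarrow> bool" where
  "smooth_system f W \<longleftrightarrow> open W \<and> (\<forall>i. smooth_on W (\<lambda>z. open_loop f z $ i))"


section \<open>Flat outputs\<close>

text \<open>
  A jet of the output is a function on pairs \<open>(j, \<beta>)\<close>, standing for $\varphi^j_{[\beta]}$.
\<close>

definition output_jet :: "(real ^ 'n \<Rightarrow> real ^ 'm \<Rightarrow> real ^ 'n) \<Rightarrow>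
    (('n::finite, 'm::finite) jet \<Rightarrow> real ^ 'm) \<Rightarrow> ('n, 'm) jet \<Rightarrow> 'm \<times> nat \<Rightarrow> real" where
  "output_jet f \<phi> z = (\<lambda>(j, \<beta>). (lie (open_loop f) ^^ \<beta>) (\<lambda>z. \<phi> z $ j) z)"

text \<open>
  \<open>W\<close> is the domain of validity, \<open>Y\<close> an open domain of \<open>Fx\<close> and \<open>Fu\<close>.  The condition
  \<open>\<beta> < R j\<close> is the index range of $\varphi_{[0,R-1]}$, empty for $r^j = 0$.
\<close>

definition flat_parameterization ::
  "(real ^ 'n \<Rightarrow> real ^ 'm \<Rightarrow> real ^ 'n) \<Rightarrow> (('n::finite, 'm::finite) jet \<Rightarrow> real ^ 'm) \<Rightarrow>
   ('n, 'm) jet set \<Rightarrow> ('m \<times> nat \<Rightarrow> real) set \<Rightarrow> ('m \<Rightarrow> nat) \<Rightarrow>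
   (('m \<times> nat \<Rightarrow> real) \<Rightarrow> real ^ 'n) \<Rightarrow> (('m \<times> nat \<Rightarrow> real) \<Rightarrow> real ^ 'm) \<Rightarrow> bool" where
  "flat_parameterization f \<phi> W Y R Fx Fu \<longleftrightarrow>
     (\<forall>j. smooth_on W (\<lambda>z. \<phi> z $ j)) \<and>
     open Y \<and> (\<forall>i. smooth_on Y (\<lambda>y. Fx y $ i)) \<and> (\<forall>j. smooth_on Y (\<lambda>y. Fu y $ j)) \<and>
     depends_on {(j, \<beta>). \<beta> < R j} Y Fx \<and> depends_on {(j, \<beta>). \<beta> \<le> R j} Y Fu \<and>
     (\<forall>z\<in>W. output_jet f \<phi> z \<in> Y \<and>
        state z = Fx (output_jet f \<phi> z) \<and> inp z = Fu (output_jet f \<phi> z))"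

definition minimal_flat_parameterization ::
  "(real ^ 'n \<Rightarrow> real ^ 'm \<Rightarrow> real ^ 'n) \<Rightarrow> (('n::finite, 'm::finite) jet \<Rightarrow> real ^ 'm) \<Rightarrow>
   ('n, 'm) jet set \<Rightarrow> ('m \<times> nat \<Rightarrow> real) set \<Rightarrow> ('m \<Rightarrow> nat) \<Rightarrow>
   (('m \<times> nat \<Rightarrow> real) \<Rightarrow> real ^ 'n) \<Rightarrow> (('m \<times> nat \<Rightarrow> real) \<Rightarrow> real ^ 'm) \<Rightarrow> bool" where
  "minimal_flat_parameterization f \<phi> W Y R Fx Fu \<longleftrightarrow>
     flat_parameterization f \<phi> W Y R Fx Fu \<and>
     \<not> (\<exists>Y' R' Fx' Fu'. R' < R \<and> flat_parameterization f \<phi> W Y' R' Fx' Fu')"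

definition xu_output :: "(real ^ 'n \<Rightarrow> real ^ 'm \<Rightarrow> real ^ 'm) \<Rightarrow>
    ('n::finite, 'm::finite) jet \<Rightarrow> real ^ 'm" where
  "xu_output \<phi> z = \<phi> (state z) (inp z)"


section \<open>Quasi-static feedback and closed-loop behavior\<close>

text \<open>
  The map $\varphi_{[0,R]} \mapsto (F_x(\varphi_{[0,R-1]}), \varphi_{[\kappa,R]})$, extended to
  orders above \<open>R\<close> by the same rule $v^j_{[l]} = \varphi^j_{[\kappa^j+l]}$.
\<close>

definition state_v_jet :: "(('m \<times> nat \<Rightarrow> real) \<Rightarrow> real ^ 'n) \<Rightarrow> ('m \<Rightarrow> nat) \<Rightarrow>
    ('m \<times> nat \<Rightarrow> real) \<Rightarrow> ('n::finite, 'm) jet" where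
  "state_v_jet Fx \<kappa> y = (\<lambda>c. case c of Xc i \<Rightarrow> Fx y $ i | Uc j l \<Rightarrow> y (j, \<kappa> j + l))"

text \<open>
  Above order \<open>R\<close> the two maps merely rename coordinates.  By the last conjunct the components of
  \<open>\<Psi>\<close> up to order \<open>R\<close> are functions of $(x, v_{[0,R-\kappa]})$, so they invert the
  untruncated and the truncated map alike.
\<close>

definition is_Psi :: "(('m \<times> nat \<Rightarrow> real) \<Rightarrow> real ^ 'n) \<Rightarrow> ('m \<Rightarrow> nat) \<Rightarrow> ('m \<Rightarrow> nat) \<Rightarrow>
    ('m \<times> nat \<Rightarrow> real) set \<Rightarrow> ('n::finite, 'm) jet set \<Rightarrow>
    (('n, 'm) jet \<Rightarrow> 'm \<times> nat \<Rightarrow> real) \<Rightarrow> bool" where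
  "is_Psi Fx R \<kappa> Y V \<Psi> \<longleftrightarrow> open Y \<and> open V \<and>
     (\<forall>y\<in>Y. state_v_jet Fx \<kappa> y \<in> V \<and> \<Psi> (state_v_jet Fx \<kappa> y) = y) \<and>
     (\<forall>w\<in>V. \<Psi> w \<in> Y \<and> state_v_jet Fx \<kappa> (\<Psi> w) = w) \<and>
     (\<forall>c. smooth_on Y (\<lambda>y. state_v_jet Fx \<kappa> y c)) \<and>
     (\<forall>p. smooth_on V (\<lambda>w. \<Psi> w p)) \<and>
     (\<forall>j \<beta>. \<beta> \<le> R j \<longrightarrow>
        depends_on (range Xc \<union> {Uc j' l | j' l. \<kappa> j' + l \<le> R j'}) V (\<lambda>w. \<Psi> w (j, \<beta>)))"

text \<open>
  Extension of a change of the input, keeping the state, to the derivatives of the input.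
\<close>

definition prolong :: "(('n::finite, 'm::finite) jet \<Rightarrow> real ^ 'n) \<Rightarrow>
    (('n, 'm) jet \<Rightarrow> real ^ 'm) \<Rightarrow> ('n, 'm) jet \<Rightarrow> ('n, 'm) jet" where
  "prolong g a w =
     (\<lambda>c. case c of Xc i \<Rightarrow> w (Xc i) | Uc j k \<Rightarrow> (lie g ^^ k) (\<lambda>w. a w $ j) w)"

text \<open>
  \<open>a\<close> is $u = \alpha(x,v,v_{[1]},\dots)$ on \<open>V\<close> and \<open>b\<close> its inverse
  $v = \hat\alpha(x,u,u_{[1]},\dots)$ on \<open>W\<close>.  As $u_{[k]}$ and $v_{[k]}$ denote time
  derivatives, $\alpha_k$ and $\hat\alpha_k$ are the derivatives of $\alpha$ along the closed loop and
  of $\hat\alpha$ along the original system.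
\<close>

definition quasi_static_feedback ::
  "(real ^ 'n \<Rightarrow> real ^ 'm \<Rightarrow> real ^ 'n) \<Rightarrow> ('n::finite, 'm::finite) jet set \<Rightarrow> ('n, 'm) jet set \<Rightarrow>
   (('n, 'm) jet \<Rightarrow> real ^ 'm) \<Rightarrow> (('n, 'm) jet \<Rightarrow> real ^ 'm) \<Rightarrow> bool" where
  "quasi_static_feedback f W V a b \<longleftrightarrow>
     (let A = prolong (closed_loop f a) a; B = prolong (open_loop f) b in
        open W \<and> open V \<and>
        (\<forall>c. smooth_on V (\<lambda>w. A w c)) \<and> (\<forall>c. smooth_on W (\<lambda>z. B z c)) \<and>
        (\<forall>w\<in>V. A w \<in> W \<and> B (A w) = w) \<and> (\<forall>z\<in>W. B z \<in> V \<and> A (B z) = z) \<and>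
        independent_differentials W UNIV (\<lambda>c z. B z c))"

definition trajectory_jet :: "(real \<Rightarrow> real ^ 'n) \<Rightarrow> (real \<Rightarrow> real ^ 'm) \<Rightarrow> real \<Rightarrow>
    ('n::finite, 'm::finite) jet" where
  "trajectory_jet x v t =
     (\<lambda>c. case c of Xc i \<Rightarrow> x t $ i | Uc j k \<Rightarrow> (deriv ^^ k) (\<lambda>s. v s $ j) t)"

definition closed_loop_trajectory ::
  "(real ^ 'n \<Rightarrow> real ^ 'm \<Rightarrow> real ^ 'n) \<Rightarrow> ('n::finite, 'm::finite) jet set \<Rightarrow>
   (('n, 'm) jet \<Rightarrow> real ^ 'm) \<Rightarrow> real set \<Rightarrow> (real \<Rightarrow> real ^ 'n) \<Rightarrow> (real \<Rightarrow> real ^ 'm) \<Rightarrow> bool" where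
  "closed_loop_trajectory f V a T x v \<longleftrightarrow> open T \<and> is_interval T \<and>
     (\<forall>t\<in>T. \<forall>j k. (deriv ^^ k) (\<lambda>s. v s $ j) field_differentiable at t) \<and>
     (\<forall>t\<in>T. trajectory_jet x v t \<in> V \<and>
        (x has_vector_derivative f (x t) (a (trajectory_jet x v t))) (at t))"

definition io_behavior ::
  "(real ^ 'n \<Rightarrow> real ^ 'm \<Rightarrow> real ^ 'n) \<Rightarrow> (real ^ 'n \<Rightarrow> real ^ 'm \<Rightarrow> real ^ 'm) \<Rightarrow>
   ('n::finite, 'm::finite) jet set \<Rightarrow> (('n, 'm) jet \<Rightarrow> real ^ 'm) \<Rightarrow> ('m \<Rightarrow> nat) \<Rightarrow> bool" where
  "io_behavior f \<phi> V a \<kappa> \<longleftrightarrow>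
     (\<forall>T x v. closed_loop_trajectory f V a T x v \<longrightarrow>
        (\<forall>t\<in>T. \<forall>j. let y = (\<lambda>s. \<phi> (x s) (a (trajectory_jet x v s)) $ j) in
           (\<forall>k<\<kappa> j. (deriv ^^ k) y field_differentiable at t) \<and> (deriv ^^ \<kappa> j) y t = v t $ j))"

end

theory Submission
  imports Defs
begin

text \<open>
  Let \<open>\<Phi>\<close> be the jet map \<open>z \<mapsto> (\<phi>\<^sup>j\<^bsub>[\<beta>]\<^esub>)\<close>, which \<open>F\<^sub>x\<close>, \<open>F\<^sub>u\<close> and the derivatives of
  \<open>F\<^sub>u\<close> invert from the left.  Counting differentials shows that those of \<open>\<Phi>\<close> are
  generically independent.  Order them by \<open>\<beta>\<close> and select greedily a basis modulo \<open>dx\<close>.  The key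
  point is that once \<open>d\<phi>\<^sup>j\<^bsub>[\<beta>]\<^esub>\<close> is selected, so are all \<open>d\<phi>\<^sup>j\<^bsub>[\<gamma>]\<^esub>\<close> with \<open>\<gamma> \<ge> \<beta>\<close>: integrating once
  a relation between differentials of order up to \<open>\<beta> + 1\<close> gives a form \<open>\<eta>\<close> whose Lie derivative is
  a combination of \<open>dx\<close> and \<open>d\<phi>\<^bsub>[0]\<^esub>\<close>, hence of \<open>dx\<close> and \<open>du\<close> because \<open>\<phi>\<close> depends on \<open>(x, u)\<close> only, and then
  \<open>\<eta>\<close> itself is a combination of \<open>dx\<close>.  The first selected orders form \<open>\<kappa>\<close>, and \<open>|\<kappa>| = n\<close> and
  \<open>\<kappa> \<le> R\<close> follow by counting.  The map \<open>\<phi>\<^bsub>[0,R]\<^esub> \<mapsto> (x, \<phi>\<^bsub>[\<kappa>,R]\<^esub>)\<close> is inverted by exchanging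
  one coordinate at a time, by the implicit function theorem for one unknown.
\<close>

section \<open>Smooth functions on coordinate spaces\<close>

text \<open>The jets have infinitely many coordinates, and their product topology comes from no
  norm, so the inverse function theorem of Banach spaces does not apply; this is why only scalar
  equations are ever solved, all other coordinates being carried along. Relations between
  differentials are differentiated along the vector field, so their coefficients must be smooth
  functions and not merely numbers at a point. Linear algebra is therefore done with dual vector
  fields on an open set, which shrinks each time a new form proves independent somewhere. Starting
  this in an arbitrary nonempty open subset of \<open>W\<close> gives density. Listing the outputs
  as one sequence, by order first and by component second, makes one time derivative a shift of the
  index by m, so that "earlier" has the same meaning before and after differentiation. For
  |\<kappa>| = n the selected differentials are counted among all orders up to a bound, for \<kappa>
  \<le> R only among the orders below R: these already span dx, so dx and the selected ones among
  them cannot outnumber them.\<close>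

lemma open_contains_coordinate_box:
  fixes S :: "('c \<Rightarrow> real) set"
  assumes "open S" "z \<in> S"
  obtains D \<epsilon> where "finite D" "\<epsilon> > 0" "\<forall>z'. (\<forall>d\<in>D. \<bar>z' d - z d\<bar> < \<epsilon>) \<longrightarrow> z' \<in> S"
proof -
  have "openin (product_topology (\<lambda>_::'c. euclidean) UNIV) S"
    using \<open>open S\<close> unfolding open_fun_def .
  from product_topology_open_contains_basis[OF this \<open>z \<in> S\<close>]
  obtain A :: "'c \<Rightarrow> real set" where A: "z \<in> (\<Pi>\<^sub>E i\<in>UNIV. A i)" "\<And>i. openin euclidean (A i)"
      "finite {i. A i \<noteq> topspace euclidean}" "(\<Pi>\<^sub>E i\<in>UNIV. A i) \<subseteq> S"
    by blast
  note A = A(1) A(2)[THEN open_openin[THEN iffD2]] A(3)[unfolded topspace_euclidean] A(4)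
  let ?D = "{i. A i \<noteq> UNIV}"
  have "\<exists>e>0. \<forall>y. dist y (z i) < e \<longrightarrow> y \<in> A i" for i
  proof -
    have "z i \<in> A i" using A(1) by auto
    with A(2)[of i] show ?thesis unfolding open_dist by blast
  qed
  then obtain e where e: "\<And>i. e i > 0" "\<And>i y. dist y (z i) < e i \<Longrightarrow> y \<in> A i" by (metis (no_types))
  \<comment> \<open>The 1 keeps the minimum defined when no coordinate is constrained.\<close>
  define \<epsilon> where "\<epsilon> = Min (insert 1 (e ` ?D))"
  have "\<epsilon> > 0" unfolding \<epsilon>_def using A(3) e(1) by (subst Min_gr_iff) auto
  moreover have "z' \<in> S" if "\<And>d. d \<in> ?D \<Longrightarrow> \<bar>z' d - z d\<bar> < \<epsilon>" for z'
  proof -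
    have "z' i \<in> A i" for i
    proof (cases "i \<in> ?D")
      case True
      then have "\<epsilon> \<le> e i" unfolding \<epsilon>_def using A(3) by auto
      with that[OF True] show ?thesis by (intro e(2)) (auto simp: dist_real_def)
    qed auto
    then show ?thesis using A(4) by auto
  qed
  ultimately show thesis using that[OF A(3)] by blast
qed

lemma open_coordinate_box:
  fixes z :: "'c \<Rightarrow> real"
  assumes "finite D"
  shows "open {z'. \<forall>d\<in>D. \<bar>z' d - z d\<bar> < \<epsilon>}"
proof -
  have "{z'. \<forall>d\<in>D. \<bar>z' d - z d\<bar> < \<epsilon>} = (\<Inter>d\<in>D. {z'. \<bar>z' d - z d\<bar> < \<epsilon>})" by auto
  moreover have "open {z' :: 'c \<Rightarrow> real. \<bar>z' d - z d\<bar> < \<epsilon>}" for d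
    by (intro open_Collect_less continuous_intros) auto
  ultimately show ?thesis using assms by auto
qed

lemma continuous_on_fun_upd [continuous_intros]:
  fixes g :: "'a::topological_space \<Rightarrow> 'c \<Rightarrow> real"
  assumes "continuous_on T g" "continuous_on T h"
  shows "continuous_on T (\<lambda>t. (g t)(c := h t))"
proof (rule continuous_on_coordinatewise_then_product)
  show "continuous_on T (\<lambda>t. ((g t)(c := h t)) d)" for d
    using assms by (cases "d = c") (auto intro: continuous_on_product_then_coordinatewise)
qed

lemma open_vimage_on:
  assumes "open S" "open T" "continuous_on S f"
  shows "open {z \<in> S. f z \<in> T}"
  using continuous_open_preimage[OF assms(3,1,2)] by (simp add: vimage_def Int_def)

lemma open_line:
  fixes S :: "('c \<Rightarrow> real) set"
  assumes "open S"
  shows "open {t. z(c := t) \<in> S}"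
proof -
  have "continuous_on UNIV (\<lambda>t. z(c := t))" by (intro continuous_intros)
  from open_vimage_on[OF open_UNIV assms this] show ?thesis by simp
qed

lemma eventually_line:
  fixes S :: "('c \<Rightarrow> real) set"
  assumes "open S" "z \<in> S"
  shows "\<forall>\<^sub>F t in nhds (z c). z(c := t) \<in> S"
  using open_line[OF assms(1), of z c] assms(2) by (auto simp: eventually_nhds intro!: exI[of _ "{t. z(c := t) \<in> S}"])

lemma depends_on_mono: "depends_on C S h \<Longrightarrow> C \<subseteq> D \<Longrightarrow> T \<subseteq> S \<Longrightarrow> depends_on D T h"
  unfolding depends_on_def by blast

lemma depends_on_apply:
  assumes "depends_on C S h"
  shows "depends_on C S (\<lambda>z. g (h z))"
  using assms unfolding depends_on_def by (intro ballI impI arg_cong[where f = g]) blast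

section \<open>Partial derivatives and differentiability classes\<close>

lemma partial_cong:
  assumes "open S" "z \<in> S" "\<And>z. z \<in> S \<Longrightarrow> h z = h' z"
  shows "partial c h z = partial c h' z"
  unfolding partial_def
  by (rule deriv_cong_ev) (auto intro: eventually_mono[OF eventually_line[OF assms(1,2)]] assms(3))

lemma partial_zero:
  assumes "open S" "z \<in> S" "depends_on C S h" "c \<notin> C"
  shows "partial c h z = 0"
proof -
  have "\<forall>\<^sub>F t in nhds (z c). h (z(c := t)) = h z"
    using eventually_line[OF assms(1,2)]
  proof (rule eventually_mono)
    fix t assume "z(c := t) \<in> S"
    moreover have "\<forall>d\<in>C. (z(c := t)) d = z d" using assms(4) by auto
    ultimately show "h (z(c := t)) = h z" using assms(2,3) unfolding depends_on_def by blast
  qed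
  then show ?thesis unfolding partial_def by (subst deriv_cong_ev[of _ "\<lambda>_. h z"]) auto
qed

text \<open>For \<open>c\<close> outside \<open>C\<close> both derivatives vanish; for
  \<open>c\<close> in \<open>C\<close> the two points share the coordinate at which the derivative
  is taken.\<close>

lemma depends_on_partial:
  assumes "open S" "depends_on C S h"
  shows "depends_on C S (partial c h)"
  unfolding depends_on_def
proof (intro ballI impI)
  fix z z' assume z: "z \<in> S" "z' \<in> S" and eq: "\<forall>d\<in>C. z d = z' d"
  show "partial c h z = partial c h z'"
  proof (cases "c \<in> C")
    case False
    then show ?thesis using partial_zero[OF assms(1) _ assms(2)] z by metis
  next
    case True
    then have c: "z c = z' c" using eq by auto
    have "\<forall>\<^sub>F t in nhds (z c). h (z(c := t)) = h (z'(c := t))"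
      using eventually_conj[OF eventually_line[OF assms(1) z(1)] eventually_line[OF assms(1) z(2), of c, folded c]]
    proof (rule eventually_mono)
      fix t assume "z(c := t) \<in> S \<and> z'(c := t) \<in> S"
      moreover have "\<forall>d\<in>C. (z(c := t)) d = (z'(c := t)) d" using eq by auto
      ultimately show "h (z(c := t)) = h (z'(c := t))" using assms(2) unfolding depends_on_def by blast
    qed
    then show ?thesis unfolding partial_def c[symmetric] by (rule deriv_cong_ev) simp
  qed
qed

lemma Ck_on_continuous: "Ck_on k S h \<Longrightarrow> continuous_on S h"
  by (cases k) auto

lemma Ck_on_Suc_lower: "Ck_on (Suc k) S h \<Longrightarrow> Ck_on k S h"
  by (induction k arbitrary: h) (auto simp del: Ck_on.simps(2) simp: Ck_on.simps(2)[of "Suc _"], auto)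

lemma Ck_on_subset: "Ck_on k S h \<Longrightarrow> T \<subseteq> S \<Longrightarrow> Ck_on k T h"
  by (induction k arbitrary: h) (auto intro: continuous_on_subset)

lemma Ck_on_partial: "Ck_on (Suc k) S h \<Longrightarrow> Ck_on k S (partial c h)"
  by simp

lemma has_derivative_partial:
  assumes "Ck_on (Suc k) S h" "z \<in> S"
  shows "((\<lambda>t. h (z(c := t))) has_real_derivative partial c h z) (at (z c))"
  using assms DERIV_deriv_iff_field_differentiable unfolding partial_def by force

lemma Ck_on_cong:
  assumes "open S" "\<And>z. z \<in> S \<Longrightarrow> h z = h' z" "Ck_on k S h"
  shows "Ck_on k S h'"
  using assms(2,3)
proof (induction k arbitrary: h h')
  case 0
  then show ?case using continuous_on_cong by fastforce
next
  case (Suc k)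
  have "Ck_on k S (partial c h')" for c
    by (rule Suc.IH[of "partial c h"])
      (use Suc.prems in \<open>auto intro: partial_cong[OF assms(1)]\<close>)
  moreover have "(\<lambda>t. h' (z(c := t))) field_differentiable at (z c)" if "z \<in> S" for z c
  proof -
    have "((\<lambda>t. h (z(c := t))) has_real_derivative partial c h z) (at (z c))"
      using has_derivative_partial[OF Suc.prems(2) that] .
    moreover have "\<forall>\<^sub>F t in nhds (z c). h (z(c := t)) = h' (z(c := t))"
      using eventually_line[OF assms(1) that] by eventually_elim (rule Suc.prems(1))
    ultimately have "((\<lambda>t. h' (z(c := t))) has_real_derivative partial c h z) (at (z c))"
      using DERIV_cong_ev[OF refl _ refl] by fast
    then show ?thesis using field_differentiable_def by blast
  qed
  moreover have "continuous_on S h'"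
    using Suc.prems continuous_on_cong by (metis Ck_on_continuous)
  ultimately show ?case by simp
qed

text \<open>Taking a candidate \<open>p\<close> for the partial derivatives lets inductions on the
  class work with an explicit formula instead of \<open>partial c h\<close>.\<close>

lemma Ck_on_SucI:
  assumes "open S" "continuous_on S h"
    and "\<And>z c. z \<in> S \<Longrightarrow> ((\<lambda>t. h (z(c := t))) has_real_derivative p c z) (at (z c))"
    and "\<And>c. Ck_on k S (p c)"
  shows "Ck_on (Suc k) S h"
proof -
  have "partial c h z = p c z" if "z \<in> S" for z c
    unfolding partial_def by (rule DERIV_imp_deriv) (rule assms(3)[OF that])
  then have "Ck_on k S (partial c h)" for c
    using Ck_on_cong[OF assms(1) _ assms(4)] by metis
  moreover have "(\<lambda>t. h (z(c := t))) field_differentiable at (z c)" if "z \<in> S" for z c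
    unfolding field_differentiable_def using assms(3)[OF that] by blast
  ultimately show ?thesis using assms(2) by simp
qed

lemma partial_const [simp]: "partial c (\<lambda>_. a) = (\<lambda>_. 0)"
  by (auto simp: partial_def)

lemma partial_coordinate: "partial c (\<lambda>z. z d) = (\<lambda>_. if c = d then 1 else 0)"
  by (auto simp: partial_def fun_eq_iff)

lemma Ck_on_const [simp]: "Ck_on k S (\<lambda>_. a)"
  by (induction k arbitrary: a) (auto simp: field_differentiable_const)

lemma Ck_on_coordinate: "Ck_on k S (\<lambda>z. z d)"
proof (cases k)
  case (Suc l)
  have "(\<lambda>t. (z(c := t)) d) field_differentiable at (z c)" for z :: "'a \<Rightarrow> real" and c
    by (cases "c = d") (auto simp: field_differentiable_const)
  with Suc show ?thesis
    by (auto simp: partial_coordinate intro: continuous_on_subset[OF continuous_on_product_coordinates])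
qed (auto intro: continuous_on_subset[OF continuous_on_product_coordinates])

lemma Ck_on_add:
  assumes "open S" "Ck_on k S g" "Ck_on k S h"
  shows "Ck_on k S (\<lambda>z. g z + h z)"
  using assms(2,3)
proof (induction k arbitrary: g h)
  case (Suc k)
  show ?case
  proof (rule Ck_on_SucI[OF assms(1), where p = "\<lambda>c z. partial c g z + partial c h z"])
    show "((\<lambda>t. g (z(c := t)) + h (z(c := t))) has_real_derivative partial c g z + partial c h z) (at (z c))"
      if "z \<in> S" for z c
      by (intro DERIV_add has_derivative_partial[OF Suc.prems(1) that] has_derivative_partial[OF Suc.prems(2) that])
  qed (use Suc in \<open>auto intro: continuous_intros\<close>)
qed (auto intro: continuous_intros)

lemma Ck_on_mult:
  assumes "open S" "Ck_on k S g" "Ck_on k S h"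
  shows "Ck_on k S (\<lambda>z. g z * h z)"
  using assms(2,3)
proof (induction k arbitrary: g h)
  case (Suc k)
  show ?case
  proof (rule Ck_on_SucI[OF assms(1), where p = "\<lambda>c z. partial c g z * h z + partial c h z * g z"])
    show "((\<lambda>t. g (z(c := t)) * h (z(c := t))) has_real_derivative
        partial c g z * h z + partial c h z * g z) (at (z c))" if "z \<in> S" for z c
      by (rule DERIV_cong[OF DERIV_mult[OF has_derivative_partial[OF Suc.prems(1) that]
              has_derivative_partial[OF Suc.prems(2) that]]]) simp
    show "Ck_on k S (\<lambda>z. partial c g z * h z + partial c h z * g z)" for c
      using Suc.prems by (intro Ck_on_add[OF assms(1)] Suc.IH) (auto intro: Ck_on_Suc_lower)
  qed (use Suc in \<open>auto intro: continuous_intros\<close>)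
qed (auto intro: continuous_intros)

lemma Ck_on_inverse:
  assumes "open S" "Ck_on k S g" "\<And>z. z \<in> S \<Longrightarrow> g z \<noteq> 0"
  shows "Ck_on k S (\<lambda>z. inverse (g z))"
  using assms(2)
proof (induction k)
  case 0
  then show ?case using assms(3) by (auto intro!: continuous_intros)
next
  case (Suc k)
  show ?case
  \<comment> \<open>The derivative is a product containing the inverse itself, so the induction
    hypothesis covers it.\<close>
  proof (rule Ck_on_SucI[OF assms(1), where p = "\<lambda>c z. - 1 * (partial c g z * (inverse (g z) * inverse (g z)))"])
    show "continuous_on S (\<lambda>z. inverse (g z))"
      using assms(3) Suc.prems by (auto intro!: continuous_intros)
    show "((\<lambda>t. inverse (g (z(c := t)))) has_real_derivative
        - 1 * (partial c g z * (inverse (g z) * inverse (g z)))) (at (z c))" if "z \<in> S" for z c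
      by (rule DERIV_cong[OF DERIV_inverse_fun[OF has_derivative_partial[OF Suc.prems that]]])
        (use assms(3)[OF that] in \<open>auto simp: mult_ac power2_eq_square\<close>)
    show "Ck_on k S (\<lambda>z. - 1 * (partial c g z * (inverse (g z) * inverse (g z))))" for c
      using Suc.prems by (intro Ck_on_mult[OF assms(1)] Ck_on_const Suc.IH) (auto intro: Ck_on_Suc_lower)
  qed
qed

section \<open>Closure properties of smooth functions\<close>

lemma smooth_on_Ck: "smooth_on S h \<Longrightarrow> Ck_on k S h"
  by (simp add: smooth_on_def)

lemma smooth_on_continuous: "smooth_on S h \<Longrightarrow> continuous_on S h"
  using smooth_on_Ck[of S h 0] by simp

lemma smooth_on_depends:
  assumes "smooth_on S h"
  obtains C where "finite C" "depends_on C S h"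
  using assms unfolding smooth_on_def by blast

lemma smooth_on_subset: "smooth_on S h \<Longrightarrow> T \<subseteq> S \<Longrightarrow> smooth_on T h"
  unfolding smooth_on_def by (meson Ck_on_subset depends_on_mono subset_refl)

lemma smooth_on_cong:
  assumes "open S" "smooth_on S h" "\<And>z. z \<in> S \<Longrightarrow> h z = h' z"
  shows "smooth_on S h'"
proof -
  have "depends_on C S h \<Longrightarrow> depends_on C S h'" for C
    using assms(3) unfolding depends_on_def by metis
  moreover have "Ck_on k S h \<Longrightarrow> Ck_on k S h'" for k
    by (rule Ck_on_cong[OF assms(1) assms(3)])
  ultimately show ?thesis
    using assms(2) unfolding smooth_on_def by blast
qed

lemma smooth_on_partial: "open S \<Longrightarrow> smooth_on S h \<Longrightarrow> smooth_on S (partial c h)"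
  unfolding smooth_on_def using Ck_on_partial[of _ S h c] depends_on_partial[of S _ h c] by blast

lemma smooth_on_const [simp, intro]: "smooth_on S (\<lambda>_. a)"
  unfolding smooth_on_def by (auto simp: depends_on_def)

lemma smooth_on_coordinate [simp, intro]: "smooth_on S (\<lambda>z. z d)"
  unfolding smooth_on_def
  by (auto simp: depends_on_def Ck_on_coordinate intro!: exI[of _ "{d}"])

lemma depends_on_binop:
  assumes "depends_on C S g" "depends_on C S h"
  shows "depends_on C S (\<lambda>z. F (g z) (h z))"
  using assms unfolding depends_on_def by metis

lemma smooth_on_depends2:
  assumes "smooth_on S g" "smooth_on S h"
  obtains E where "finite E" "depends_on E S g" "depends_on E S h"
proof -
  obtain C D where C: "finite C" "depends_on C S g" and D: "finite D" "depends_on D S h"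
    using assms smooth_on_depends by meson
  show thesis
    by (rule that[of "C \<union> D"]) (use C D in \<open>auto intro: depends_on_mono\<close>)
qed

lemma smooth_on_add:
  assumes "open S" "smooth_on S g" "smooth_on S h"
  shows "smooth_on S (\<lambda>z. g z + h z)"
proof -
  obtain E where "finite E" "depends_on E S g" "depends_on E S h"
    by (rule smooth_on_depends2[OF assms(2,3)])
  then have "finite E" "depends_on E S (\<lambda>z. g z + h z)"
    by (auto intro: depends_on_binop[where F = "(+)"])
  moreover have "Ck_on k S (\<lambda>z. g z + h z)" for k
    by (intro Ck_on_add smooth_on_Ck assms)
  ultimately show ?thesis unfolding smooth_on_def by blast
qed

lemma smooth_on_mult:
  assumes "open S" "smooth_on S g" "smooth_on S h"
  shows "smooth_on S (\<lambda>z. g z * h z)"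
proof -
  obtain E where "finite E" "depends_on E S g" "depends_on E S h"
    by (rule smooth_on_depends2[OF assms(2,3)])
  then have "finite E" "depends_on E S (\<lambda>z. g z * h z)"
    by (auto intro: depends_on_binop[where F = "(*)"])
  moreover have "Ck_on k S (\<lambda>z. g z * h z)" for k
    by (intro Ck_on_mult smooth_on_Ck assms)
  ultimately show ?thesis unfolding smooth_on_def by blast
qed

lemma smooth_on_diff:
  assumes "open S" "smooth_on S g" "smooth_on S h"
  shows "smooth_on S (\<lambda>z. g z - h z)"
  using smooth_on_add[OF assms(1,2) smooth_on_mult[OF assms(1) smooth_on_const[of S "-1"] assms(3)]] by simp

lemma smooth_on_inverse:
  assumes "open S" "smooth_on S g" "\<And>z. z \<in> S \<Longrightarrow> g z \<noteq> 0"
  shows "smooth_on S (\<lambda>z. inverse (g z))"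
proof -
  obtain C where "finite C" "depends_on C S g"
    using assms(2) smooth_on_depends by meson
  then have "depends_on C S (\<lambda>z. inverse (g z))"
    unfolding depends_on_def by metis
  moreover have "Ck_on k S (\<lambda>z. inverse (g z))" for k
    by (intro Ck_on_inverse smooth_on_Ck assms)
  ultimately show ?thesis using \<open>finite C\<close> unfolding smooth_on_def by blast
qed

lemma smooth_on_divide:
  assumes "open S" "smooth_on S g" "smooth_on S h" "\<And>z. z \<in> S \<Longrightarrow> h z \<noteq> 0"
  shows "smooth_on S (\<lambda>z. g z / h z)"
  unfolding divide_inverse by (intro smooth_on_mult smooth_on_inverse assms)

lemma smooth_on_sum:
  assumes "open S" "\<And>i. i \<in> I \<Longrightarrow> smooth_on S (g i)"
  shows "smooth_on S (\<lambda>z. \<Sum>i\<in>I. g i z)"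
  using assms(2)
  by (induction I rule: infinite_finite_induct) (auto intro!: smooth_on_add assms(1))

lemma Ck_on_sum:
  assumes "open S" "\<And>i. i \<in> I \<Longrightarrow> Ck_on k S (g i)"
  shows "Ck_on k S (\<lambda>z. \<Sum>i\<in>I. g i z)"
  using assms(2)
  by (induction I rule: infinite_finite_induct) (auto intro!: Ck_on_add assms(1))

section \<open>Mean values, the chain rule and symmetry of second derivatives\<close>

lemma mean_value_segment:
  fixes F :: "real \<Rightarrow> real"
  assumes "\<And>s. s \<in> closed_segment a b \<Longrightarrow> (F has_real_derivative F' s) (at s)"
  shows "\<exists>\<xi>\<in>closed_segment a b. F b - F a = (b - a) * F' \<xi>"
proof (cases a b rule: linorder_cases)
  case less
  then obtain \<xi> where "\<xi> > a" "\<xi> < b" "F b - F a = (b - a) * F' \<xi>"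
    using MVT2[of a b F F'] assms by (auto simp: closed_segment_eq_real_ivl)
  then show ?thesis using less by (auto simp: closed_segment_eq_real_ivl intro!: bexI[of _ \<xi>])
next
  case greater
  then obtain \<xi> where "\<xi> > b" "\<xi> < a" "F a - F b = (a - b) * F' \<xi>"
    using MVT2[of b a F F'] assms by (auto simp: closed_segment_eq_real_ivl)
  then show ?thesis using greater
    by (auto simp: closed_segment_eq_real_ivl algebra_simps intro!: bexI[of _ \<xi>])
qed simp

lemma segment_abs_less:
  fixes a b c :: real
  assumes "s \<in> closed_segment a b" "\<bar>a - c\<bar> < \<epsilon>" "\<bar>b - c\<bar> < \<epsilon>"
  shows "\<bar>s - c\<bar> < \<epsilon>"
  using assms by (auto simp: closed_segment_eq_real_ivl split: if_splits)

lemma has_derivative_line: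
  assumes "Ck_on (Suc k) S h" "z(c := s) \<in> S"
  shows "((\<lambda>t. h (z(c := t))) has_real_derivative partial c h (z(c := s))) (at s)"
  using has_derivative_partial[OF assms, of c] by simp

text \<open>By the mean value theorem the quotient is a partial derivative at an intermediate point,
  and continuity of that derivative gives the limit. The base point \<eta> and both endpoints may
  move along any filter, so one lemma serves the chain rule and the derivative of an implicit
  function.\<close>

lemma partial_difference_quotient:
  fixes \<eta> :: "'a \<Rightarrow> 'c \<Rightarrow> real"
  assumes S: "open S" "Ck_on (Suc k) S h" "z \<in> S"
    and \<eta>: "\<And>e. ((\<lambda>t. \<eta> t e) \<longlongrightarrow> z e) F" and \<sigma>: "(\<sigma> \<longlongrightarrow> z c) F" and \<tau>: "(\<tau> \<longlongrightarrow> z c) F"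
  obtains q where "(q \<longlongrightarrow> partial c h z) F"
    "\<And>t. h ((\<eta> t)(c := \<sigma> t)) - h ((\<eta> t)(c := \<tau> t)) = q t * (\<sigma> t - \<tau> t)"
proof
  define L where "L = partial c h z"
  \<comment> \<open>The default \<open>L\<close> keeps both the factorization and the limit where
    the endpoints coincide.\<close>
  define q where "q t = (if \<sigma> t = \<tau> t then L
    else (h ((\<eta> t)(c := \<sigma> t)) - h ((\<eta> t)(c := \<tau> t))) / (\<sigma> t - \<tau> t))" for t
  show "h ((\<eta> t)(c := \<sigma> t)) - h ((\<eta> t)(c := \<tau> t)) = q t * (\<sigma> t - \<tau> t)" for t
    by (auto simp: q_def)
  \<comment> \<open>An open set constrains finitely many coordinates, so coordinatewise convergence
    of \<eta> is enough, without uniformity.\<close>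
  have near: "\<forall>\<^sub>F t in F. \<forall>s\<in>closed_segment (\<tau> t) (\<sigma> t). (\<eta> t)(c := s) \<in> T"
    if T: "open T" "z \<in> T" for T
  proof -
    obtain D \<epsilon> where D: "finite D" "\<epsilon> > 0"
      and box: "\<forall>z'. (\<forall>e\<in>D. \<bar>z' e - z e\<bar> < \<epsilon>) \<longrightarrow> z' \<in> T"
      by (rule open_contains_coordinate_box[OF T])
    have "\<forall>\<^sub>F t in F. \<forall>e\<in>D. dist (\<eta> t e) (z e) < \<epsilon>"
      using tendstoD[OF \<eta> D(2)] D(1) by (intro eventually_ball_finite) auto
    then show ?thesis using tendstoD[OF \<sigma> D(2)] tendstoD[OF \<tau> D(2)]
    proof eventually_elim
      case (elim t)
      show ?case
      proof
        fix s assume "s \<in> closed_segment (\<tau> t) (\<sigma> t)"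
        then have "\<bar>s - z c\<bar> < \<epsilon>"
          by (rule segment_abs_less) (use elim in \<open>auto simp: dist_real_def\<close>)
        moreover have "\<bar>\<eta> t e - z e\<bar> < \<epsilon>" if "e \<in> D" for e
          using elim that by (auto simp: dist_real_def)
        ultimately show "(\<eta> t)(c := s) \<in> T"
          by (intro box[rule_format]) auto
      qed
    qed
  qed
  show "(q \<longlongrightarrow> partial c h z) F"
  proof (rule tendstoI)
    fix e :: real assume "e > 0"
    have cp: "continuous_on S (partial c h)"
      using S(2) Ck_on_continuous by auto
    define T where "T = {z \<in> S. partial c h z \<in> ball L e}"
    have T: "open T" unfolding T_def by (intro open_vimage_on S(1) open_ball cp)
    have "z \<in> T" using S(3) \<open>e > 0\<close> by (auto simp: T_def L_def)
    from near[OF T this] show "\<forall>\<^sub>F t in F. dist (q t) (partial c h z) < e"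
    proof eventually_elim
      case (elim t)
      show ?case
      proof (cases "\<sigma> t = \<tau> t")
        case False
        define G where "G s = h ((\<eta> t)(c := s))" for s
        have "(G has_real_derivative partial c h ((\<eta> t)(c := s))) (at s)"
          if "s \<in> closed_segment (\<tau> t) (\<sigma> t)" for s
          unfolding G_def
          by (rule has_derivative_line[OF S(2)]) (use elim that in \<open>auto simp: T_def\<close>)
        then obtain \<xi> where \<xi>: "\<xi> \<in> closed_segment (\<tau> t) (\<sigma> t)"
          "G (\<sigma> t) - G (\<tau> t) = (\<sigma> t - \<tau> t) * partial c h ((\<eta> t)(c := \<xi>))"
          using mean_value_segment[of "\<tau> t" "\<sigma> t" G "\<lambda>s. partial c h ((\<eta> t)(c := s))"] by auto
        then have "q t = partial c h ((\<eta> t)(c := \<xi>))"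
          using False by (simp add: q_def G_def)
        moreover have "(\<eta> t)(c := \<xi>) \<in> T" using elim \<xi>(1) by blast
        ultimately show ?thesis by (simp add: T_def L_def dist_commute)
      qed (use \<open>e > 0\<close> in \<open>auto simp: q_def L_def\<close>)
    qed
  qed
qed

text \<open>Coordinates start to move one after the other, each contributing a factorized increment;
  this replaces total differentiability. Coordinates outside \<open>A\<close> stay at their values
  at \<open>t0\<close>.\<close>

lemma chain_rule_curve_finite:
  fixes \<gamma> :: "real \<Rightarrow> 'c \<Rightarrow> real"
  assumes S: "open S" "Ck_on (Suc k) S h" "\<gamma> t0 \<in> S"
    and "finite A" "\<And>d. d \<in> A \<Longrightarrow> ((\<lambda>t. \<gamma> t d) has_real_derivative \<gamma>' d) (at t0)"
  shows "((\<lambda>t. h (\<lambda>d. if d \<in> A then \<gamma> t d else \<gamma> t0 d)) has_real_derivative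
    (\<Sum>d\<in>A. partial d h (\<gamma> t0) * \<gamma>' d)) (at t0)"
  using assms(4,5)
proof (induction A)
  case empty
  show ?case by simp
next
  case (insert d A)
  define \<eta> where "\<eta> t = (\<lambda>e. if e \<in> A then \<gamma> t e else \<gamma> t0 e)" for t
  have \<eta>d: "(\<eta> t)(d := \<gamma> t0 d) = \<eta> t" for t using insert.hyps by (auto simp: \<eta>_def)
  have split: "(\<lambda>e. if e \<in> insert d A then \<gamma> t e else \<gamma> t0 e) = (\<eta> t)(d := \<gamma> t d)" for t
    by (auto simp: \<eta>_def)
  have cont: "((\<lambda>t. \<gamma> t e) \<longlongrightarrow> \<gamma> t0 e) (at t0)" if "e \<in> insert d A" for e
    using DERIV_isCont[OF insert.prems[OF that]] by (simp add: isCont_def)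
  have "((\<lambda>t. \<eta> t e) \<longlongrightarrow> \<gamma> t0 e) (at t0)" for e
    using cont[of e] by (cases "e \<in> A") (auto simp: \<eta>_def)
  from partial_difference_quotient[OF S this cont[of d] tendsto_const]
  obtain q where q: "(q \<longlongrightarrow> partial d h (\<gamma> t0)) (at t0)"
    "\<And>t. h ((\<eta> t)(d := \<gamma> t d)) - h (\<eta> t) = q t * (\<gamma> t d - \<gamma> t0 d)"
    unfolding \<eta>d by auto
  have diff: "h ((\<eta> t)(d := \<gamma> t d)) = h (\<eta> t) + q t * (\<gamma> t d - \<gamma> t0 d)" for t
    using q(2)[of t] by simp
  have "((\<lambda>t. q t * ((\<gamma> t d - \<gamma> t0 d) / (t - t0))) \<longlongrightarrow> partial d h (\<gamma> t0) * \<gamma>' d) (at t0)"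
    using insert.prems[of d] by (intro tendsto_mult q) (auto simp: has_field_derivative_iff)
  then have "((\<lambda>t. q t * (\<gamma> t d - \<gamma> t0 d)) has_real_derivative partial d h (\<gamma> t0) * \<gamma>' d) (at t0)"
    by (simp add: has_field_derivative_iff)
  moreover have "((\<lambda>t. h (\<eta> t)) has_real_derivative (\<Sum>e\<in>A. partial e h (\<gamma> t0) * \<gamma>' e)) (at t0)"
    unfolding \<eta>_def using insert by simp
  ultimately have "((\<lambda>t. h (\<eta> t) + q t * (\<gamma> t d - \<gamma> t0 d)) has_real_derivative
      (\<Sum>e\<in>A. partial e h (\<gamma> t0) * \<gamma>' e) + partial d h (\<gamma> t0) * \<gamma>' d) (at t0)"
    by (intro DERIV_add)
  then show ?case unfolding split diff using insert.hyps by (simp add: add.commute)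
qed

text \<open>Freezing the coordinates outside the support \<open>C\<close> does not change
  \<open>h\<close>, so the curve needs derivatives only in the finitely many coordinates of
  \<open>C\<close>.\<close>

lemma chain_rule_curve:
  fixes \<gamma> :: "real \<Rightarrow> 'c \<Rightarrow> real"
  assumes S: "open S" "Ck_on (Suc k) S h" and C: "finite C" "depends_on C S h"
    and \<gamma>: "\<forall>\<^sub>F t in nhds t0. \<gamma> t \<in> S" "\<And>d. d \<in> C \<Longrightarrow> ((\<lambda>t. \<gamma> t d) has_real_derivative \<gamma>' d) (at t0)"
  shows "((\<lambda>t. h (\<gamma> t)) has_real_derivative (\<Sum>d\<in>C. partial d h (\<gamma> t0) * \<gamma>' d)) (at t0)"
proof -
  define \<eta> where "\<eta> t = (\<lambda>d. if d \<in> C then \<gamma> t d else \<gamma> t0 d)" for t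
  have t0: "\<gamma> t0 \<in> S" using \<gamma>(1) eventually_nhds_x_imp_x by fastforce
  obtain D \<epsilon> where D: "finite D" "\<epsilon> > 0"
    and box: "\<forall>z'. (\<forall>e\<in>D. \<bar>z' e - \<gamma> t0 e\<bar> < \<epsilon>) \<longrightarrow> z' \<in> S"
    by (rule open_contains_coordinate_box[OF S(1) t0])
  have "\<forall>\<^sub>F t in nhds t0. dist (\<gamma> t e) (\<gamma> t0 e) < \<epsilon>" if "e \<in> C" for e
    using DERIV_isCont[OF \<gamma>(2)[OF that]] D(2)
    unfolding continuous_at tendsto_iff eventually_at_filter
    by (auto elim!: eventually_mono)
  then have "\<forall>\<^sub>F t in nhds t0. \<forall>e\<in>C. dist (\<gamma> t e) (\<gamma> t0 e) < \<epsilon>"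
    using C(1) by (intro eventually_ball_finite) auto
  then have "\<forall>\<^sub>F t in nhds t0. \<eta> t \<in> S"
    by eventually_elim (use D(2) in \<open>auto intro!: box[rule_format] simp: \<eta>_def dist_real_def\<close>)
  then have "\<forall>\<^sub>F t in nhds t0. h (\<eta> t) = h (\<gamma> t)"
    using \<gamma>(1)
  proof eventually_elim
    case (elim t)
    have "\<forall>e\<in>C. \<eta> t e = \<gamma> t e" by (auto simp: \<eta>_def)
    then show ?case using elim C(2) unfolding depends_on_def by blast
  qed
  moreover have "((\<lambda>t. h (\<eta> t)) has_real_derivative (\<Sum>d\<in>C. partial d h (\<gamma> t0) * \<gamma>' d)) (at t0)"
    unfolding \<eta>_def by (rule chain_rule_curve_finite[OF S t0 C(1) \<gamma>(2)])
  ultimately show ?thesis using DERIV_cong_ev[OF refl _ refl] by fast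
qed

lemma has_derivative_compose:
  fixes F :: "('b \<Rightarrow> real) \<Rightarrow> 'c \<Rightarrow> real"
  assumes U: "open U" "\<And>d. Ck_on (Suc k) U (\<lambda>z. F z d)" and V: "open V" "\<And>z. z \<in> U \<Longrightarrow> F z \<in> V"
    and h: "Ck_on (Suc l) V h" "finite C" "depends_on C V h" and z: "z \<in> U"
  shows "((\<lambda>t. h (F (z(c := t)))) has_real_derivative
    (\<Sum>d\<in>C. partial d h (F z) * partial c (\<lambda>z. F z d) z)) (at (z c))"
proof -
  have "\<forall>\<^sub>F t in nhds (z c). F (z(c := t)) \<in> V"
    using eventually_line[OF U(1) z] by eventually_elim (rule V(2))
  from chain_rule_curve[OF V(1) h this has_derivative_partial[OF U(2) z]]
  show ?thesis by simp
qed

lemma partial_compose: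
  fixes F :: "('b \<Rightarrow> real) \<Rightarrow> 'c \<Rightarrow> real"
  assumes U: "open U" "\<And>d. smooth_on U (\<lambda>z. F z d)" and V: "open V" "\<And>z. z \<in> U \<Longrightarrow> F z \<in> V"
    and h: "smooth_on V h" "finite C" "depends_on C V h" and z: "z \<in> U"
  shows "partial c (\<lambda>z. h (F z)) z = (\<Sum>d\<in>C. partial d h (F z) * partial c (\<lambda>z. F z d) z)"
  unfolding partial_def[of c "\<lambda>z. h (F z)"]
  by (rule DERIV_imp_deriv)
    (rule has_derivative_compose[OF U(1) smooth_on_Ck[OF U(2)] V smooth_on_Ck[OF h(1)] h(2,3) z])

text \<open>The inner map is only of class k, because an implicit function is bootstrapped one class
  at a time.\<close>

lemma Ck_on_compose:
  fixes F :: "('b \<Rightarrow> real) \<Rightarrow> 'c \<Rightarrow> real"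
  assumes U: "open U" "\<And>d. Ck_on k U (\<lambda>z. F z d)" and V: "open V" "\<And>z. z \<in> U \<Longrightarrow> F z \<in> V"
    and h: "smooth_on V h"
  shows "Ck_on k U (\<lambda>z. h (F z))"
  using U(2) h
proof (induction k arbitrary: h)
  case 0
  then have "continuous_on U F" by (auto intro: continuous_on_coordinatewise_then_product)
  then show ?case
    using continuous_on_compose2[OF smooth_on_continuous[OF 0(2)]] V(2) by auto
next
  case (Suc k)
  obtain C where C: "finite C" "depends_on C V h" using smooth_on_depends[OF Suc.prems(2)] .
  have lower: "Ck_on k U (\<lambda>z. F z d)" for d
    by (rule Ck_on_Suc_lower[OF Suc.prems(1)])
  show ?case
  proof (rule Ck_on_SucI[OF U(1)])
    show "continuous_on U (\<lambda>z. h (F z))"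
      using Ck_on_continuous[OF Suc.IH[OF lower Suc.prems(2)]] .
    show "((\<lambda>t. h (F (z(c := t)))) has_real_derivative
        (\<Sum>d\<in>C. partial d h (F z) * partial c (\<lambda>z. F z d) z)) (at (z c))" if "z \<in> U" for z c
      by (rule has_derivative_compose[OF U(1) Suc.prems(1) V smooth_on_Ck[OF Suc.prems(2)] C that])
    show "Ck_on k U (\<lambda>z. \<Sum>d\<in>C. partial d h (F z) * partial c (\<lambda>z. F z d) z)" for c
      using Ck_on_mult[OF U(1) Suc.IH[OF lower smooth_on_partial[OF V(1) Suc.prems(2)]]
          Ck_on_partial[OF Suc.prems(1)]]
      by (intro Ck_on_sum U(1)) auto
  qed
qed

lemma smooth_on_compose:
  fixes F :: "('b \<Rightarrow> real) \<Rightarrow> 'c \<Rightarrow> real"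
  assumes U: "open U" "\<And>d. smooth_on U (\<lambda>z. F z d)" and V: "open V" "\<And>z. z \<in> U \<Longrightarrow> F z \<in> V"
    and h: "smooth_on V h"
  shows "smooth_on U (\<lambda>z. h (F z))"
proof -
  obtain C where C: "finite C" "depends_on C V h" using smooth_on_depends[OF h] .
  have "\<exists>D. finite D \<and> depends_on D U (\<lambda>z. F z d)" for d
    using smooth_on_depends[OF U(2)] by metis
  then obtain D where D: "\<And>d. finite (D d)" "\<And>d. depends_on (D d) U (\<lambda>z. F z d)" by metis
  \<comment> \<open>\<open>F\<close> has infinitely many components, but only those in the finite
    support of \<open>h\<close> count.\<close>
  have "depends_on (\<Union>d\<in>C. D d) U (\<lambda>z. h (F z))"
    unfolding depends_on_def
  proof (intro ballI impI)
    fix z z' assume z: "z \<in> U" "z' \<in> U" "\<forall>c\<in>\<Union> (D ` C). z c = z' c"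
    then have "F z d = F z' d" if "d \<in> C" for d
      using D(2)[of d] that unfolding depends_on_def by blast
    with z(1,2) V(2) C(2) show "h (F z) = h (F z')" unfolding depends_on_def by blast
  qed
  moreover have "Ck_on k U (\<lambda>z. h (F z))" for k
    by (rule Ck_on_compose[OF U(1) smooth_on_Ck[OF U(2)] V h])
  ultimately show ?thesis using C(1) D(1) unfolding smooth_on_def by blast
qed

lemma smooth_map_continuous_on:
  fixes F :: "('b \<Rightarrow> real) \<Rightarrow> 'c \<Rightarrow> real"
  assumes "\<And>d. smooth_on U (\<lambda>z. F z d)"
  shows "continuous_on U F"
  by (intro continuous_on_coordinatewise_then_product smooth_on_continuous assms)

text \<open>The second difference over a square of side \<delta> is symmetric in \<open>c\<close>
  and \<open>d\<close>. Two applications of the mean value theorem turn it into \<delta> * \<delta>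
  times either mixed derivative at a nearby point, and continuity brings both points to
  \<open>z\<close>.\<close>

lemma partial_commute:
  fixes h :: "('c \<Rightarrow> real) \<Rightarrow> real"
  assumes S: "open S" "smooth_on S h" "z \<in> S"
  shows "partial c (partial d h) z = partial d (partial c h) z"
proof (cases "c = d")
  case False
  have *: "\<exists>w. w \<in> T \<and> h (z(c := z c + \<delta>, d := z d + \<delta>)) - h (z(d := z d + \<delta>)) - h (z(c := z c + \<delta>)) + h z
      = \<delta> * \<delta> * partial d (partial c h) w"
    if T: "\<And>z'. (\<forall>e. \<bar>z' e - z e\<bar> \<le> \<delta>) \<Longrightarrow> z' \<in> T" "T \<subseteq> S" and "c \<noteq> d" "\<delta> > 0" for c d :: 'c and T \<delta>
  proof -
    let ?p = "\<lambda>s t. z(c := s, d := t)"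
    have mem: "?p s t \<in> T" if "s \<in> closed_segment (z c) (z c + \<delta>)" "t \<in> closed_segment (z d) (z d + \<delta>)" for s t
      using that \<open>\<delta> > 0\<close> by (intro T(1)) (auto simp: closed_segment_eq_real_ivl)
    have sw: "?p s t = z(d := t, c := s)" for s t using \<open>c \<noteq> d\<close> by (rule fun_upd_twist)
    define F where "F s = h (?p s (z d + \<delta>)) - h (?p s (z d))" for s
    define F' where "F' s = partial c h (?p s (z d + \<delta>)) - partial c h (?p s (z d))" for s
    have "(F has_real_derivative F' s) (at s)" if s: "s \<in> closed_segment (z c) (z c + \<delta>)" for s
    proof -
      have m: "z(d := t, c := s) \<in> S" if "t \<in> closed_segment (z d) (z d + \<delta>)" for t
        using mem[OF s that] T(2) unfolding sw by blast
      show ?thesis unfolding F_def F'_def sw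
        by (intro DERIV_diff has_derivative_line[OF smooth_on_Ck[OF S(2)]]; rule m; simp)
    qed
    then obtain \<xi> where \<xi>: "\<xi> \<in> closed_segment (z c) (z c + \<delta>)" "F (z c + \<delta>) - F (z c) = \<delta> * F' \<xi>"
      using mean_value_segment[of "z c" "z c + \<delta>" F F'] by auto
    define G where "G t = partial c h (?p \<xi> t)" for t
    define G' where "G' t = partial d (partial c h) (?p \<xi> t)" for t
    have "(G has_real_derivative G' t) (at t)" if t: "t \<in> closed_segment (z d) (z d + \<delta>)" for t
      unfolding G_def G'_def
      by (rule has_derivative_line[OF smooth_on_Ck[OF smooth_on_partial[OF S(1,2)]]])
        (use mem[OF \<xi>(1) t] T(2) in auto)
    then obtain \<eta> where \<eta>: "\<eta> \<in> closed_segment (z d) (z d + \<delta>)" "G (z d + \<delta>) - G (z d) = \<delta> * G' \<eta>"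
      using mean_value_segment[of "z d" "z d + \<delta>" G G'] by auto
    have "?p (z c + \<delta>) (z d) = z(c := z c + \<delta>)" "?p (z c) (z d + \<delta>) = z(d := z d + \<delta>)"
      "?p (z c) (z d) = z" using \<open>c \<noteq> d\<close> by auto
    then have "F (z c + \<delta>) - F (z c)
        = h (?p (z c + \<delta>) (z d + \<delta>)) - h (z(d := z d + \<delta>)) - h (z(c := z c + \<delta>)) + h z"
      unfolding F_def by simp
    moreover have "F' \<xi> = G (z d + \<delta>) - G (z d)" unfolding F'_def G_def ..
    ultimately show ?thesis
      using \<xi>(2) \<eta>(2) mem[OF \<xi>(1) \<eta>(1)] unfolding G'_def by (intro exI[of _ "?p \<xi> \<eta>"]) simp
  qed
  have "dist (partial c (partial d h) z) (partial d (partial c h) z) < e" if "e > 0" for e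
  proof -
    define T where "T = {w \<in> S. partial c (partial d h) w \<in> ball (partial c (partial d h) z) (e/2)}
       \<inter> {w \<in> S. partial d (partial c h) w \<in> ball (partial d (partial c h) z) (e/2)}"
    have "open T" unfolding T_def
      by (intro open_Int open_vimage_on S(1) open_ball smooth_on_continuous smooth_on_partial S(2))
    moreover have "z \<in> T" using \<open>e > 0\<close> S(3) by (auto simp: T_def)
    ultimately obtain D \<epsilon> where D: "finite D" "\<epsilon> > 0"
      and box: "\<forall>z'. (\<forall>e\<in>D. \<bar>z' e - z e\<bar> < \<epsilon>) \<longrightarrow> z' \<in> T"
      by (rule open_contains_coordinate_box)
    have bx: "z' \<in> T" if "\<forall>e. \<bar>z' e - z e\<bar> \<le> \<epsilon>/2" for z'
    proof (rule box[rule_format])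
      fix e
      have "\<bar>z' e - z e\<bar> \<le> \<epsilon>/2" using that by blast
      then show "\<bar>z' e - z e\<bar> < \<epsilon>" using D(2) by linarith
    qed
    have "T \<subseteq> S" by (auto simp: T_def)
    have "\<epsilon>/2 > 0" using D(2) by simp
    from *[OF bx \<open>T \<subseteq> S\<close> False this] *[OF bx \<open>T \<subseteq> S\<close> False[symmetric] this]
    obtain w w' where w: "w \<in> T" "w' \<in> T"
      "h (z(c := z c + \<epsilon>/2, d := z d + \<epsilon>/2)) - h (z(d := z d + \<epsilon>/2)) - h (z(c := z c + \<epsilon>/2)) + h z
       = \<epsilon>/2 * (\<epsilon>/2) * partial d (partial c h) w"
      "h (z(d := z d + \<epsilon>/2, c := z c + \<epsilon>/2)) - h (z(c := z c + \<epsilon>/2)) - h (z(d := z d + \<epsilon>/2)) + h z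
       = \<epsilon>/2 * (\<epsilon>/2) * partial c (partial d h) w'" by blast
    have tw: "z(d := z d + \<epsilon>/2, c := z c + \<epsilon>/2) = z(c := z c + \<epsilon>/2, d := z d + \<epsilon>/2)"
      using False by (intro fun_upd_twist) auto
    have "\<epsilon>/2 * (\<epsilon>/2) * partial d (partial c h) w = \<epsilon>/2 * (\<epsilon>/2) * partial c (partial d h) w'"
      unfolding w(3)[symmetric] w(4)[symmetric] tw by simp
    then have "partial d (partial c h) w = partial c (partial d h) w'" using D(2) by simp
    moreover have "dist (partial c (partial d h) z) (partial c (partial d h) w') < e/2"
      "dist (partial d (partial c h) z) (partial d (partial c h) w) < e/2"
      using w(1,2) by (auto simp: T_def)
    ultimately show ?thesis unfolding dist_real_def by linarith
  qed
  then show ?thesis using zero_less_dist_iff by blast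
qed simp

section \<open>Product rules and derivations along vector fields\<close>

lemma has_derivative_smooth:
  assumes "smooth_on S h" "z \<in> S"
  shows "((\<lambda>t. h (z(c := t))) has_real_derivative partial c h z) (at (z c))"
  by (rule has_derivative_partial[OF smooth_on_Ck[OF assms(1)] assms(2)])

lemma partial_add:
  assumes "smooth_on S g" "smooth_on S h" "z \<in> S"
  shows "partial c (\<lambda>z. g z + h z) z = partial c g z + partial c h z"
  unfolding partial_def[of c "\<lambda>z. g z + h z"]
  by (intro DERIV_imp_deriv DERIV_add has_derivative_smooth[OF assms(1,3)]
      has_derivative_smooth[OF assms(2,3)])

lemma partial_mult:
  assumes "smooth_on S g" "smooth_on S h" "z \<in> S"
  shows "partial c (\<lambda>z. g z * h z) z = partial c g z * h z + g z * partial c h z"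
  unfolding partial_def[of c "\<lambda>z. g z * h z"]
  using DERIV_imp_deriv[OF DERIV_mult[OF has_derivative_smooth[OF assms(1,3), of c]
        has_derivative_smooth[OF assms(2,3), of c]]]
  by (simp add: mult.commute)

lemma partial_sum:
  assumes "open S" "\<And>i. i \<in> I \<Longrightarrow> smooth_on S (g i)" "z \<in> S"
  shows "partial c (\<lambda>z. \<Sum>i\<in>I. g i z) z = (\<Sum>i\<in>I. partial c (g i) z)"
  using assms(2)
proof (induction I rule: infinite_finite_induct)
  case (insert i I)
  then have "partial c (\<lambda>z. g i z + (\<Sum>i\<in>I. g i z)) z = partial c (g i) z + partial c (\<lambda>z. \<Sum>i\<in>I. g i z) z"
    by (intro partial_add[of S] smooth_on_sum assms(1,3)) auto
  with insert show ?case by simp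
qed auto

text \<open>Summing over the nonzero partial derivatives keeps the sum finite for every smooth
  function without naming a support. Open loop, closed loop and the shift of output jets all become
  fields \<open>X\<close> of this kind.\<close>

definition vderiv :: "('c \<Rightarrow> ('c \<Rightarrow> real) \<Rightarrow> real) \<Rightarrow> (('c \<Rightarrow> real) \<Rightarrow> real) \<Rightarrow> ('c \<Rightarrow> real) \<Rightarrow> real" where
  "vderiv X h z = (\<Sum>c | partial c h z \<noteq> 0. X c z * partial c h z)"

lemma vderiv_eq_sum:
  assumes "finite D" "\<And>c. c \<notin> D \<Longrightarrow> partial c h z = 0"
  shows "vderiv X h z = (\<Sum>c\<in>D. X c z * partial c h z)"
  unfolding vderiv_def by (rule sum.mono_neutral_left) (use assms in auto)

lemma vderiv_eq_sum_depends:
  assumes "open S" "z \<in> S" "finite D" "depends_on D S h"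
  shows "vderiv X h z = (\<Sum>c\<in>D. X c z * partial c h z)"
  using vderiv_eq_sum[OF assms(3)] partial_zero[OF assms(1,2,4)] by blast

lemma vderiv_cong:
  assumes "open S" "z \<in> S" "\<And>z. z \<in> S \<Longrightarrow> h z = h' z"
  shows "vderiv X h z = vderiv X h' z"
  unfolding vderiv_def using partial_cong[OF assms] by simp

lemma smooth_on_vderiv:
  assumes "open S" "\<And>c. smooth_on S (X c)" "smooth_on S h"
  shows "smooth_on S (vderiv X h)"
proof -
  obtain D where D: "finite D" "depends_on D S h" using smooth_on_depends[OF assms(3)] .
  have "smooth_on S (\<lambda>z. \<Sum>c\<in>D. X c z * partial c h z)"
    by (intro smooth_on_sum smooth_on_mult smooth_on_partial assms)
  then show ?thesis
    by (rule smooth_on_cong[OF assms(1)]) (use vderiv_eq_sum_depends[OF assms(1) _ D] in simp)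
qed

text \<open>\<open>E\<close> exceeds \<open>C\<close> because the field in direction
  \<open>c\<close> may involve further coordinates; for the shift of output jets these are the next
  orders.\<close>

lemma depends_on_vderiv:
  assumes "open S" "depends_on C S h" "C \<subseteq> E" "\<And>c. c \<in> C \<Longrightarrow> depends_on E S (X c)"
  shows "depends_on E S (vderiv X h)"
  unfolding depends_on_def
proof (intro ballI impI)
  fix z z' assume z: "z \<in> S" "z' \<in> S" and eq: "\<forall>c\<in>E. z c = z' c"
  have p: "partial c h z = partial c h z'" for c
    using depends_on_partial[OF assms(1,2)] z eq assms(3) unfolding depends_on_def by blast
  have "X c z = X c z'" if "partial c h z \<noteq> 0" for c
  proof -
    have "c \<in> C" using that partial_zero[OF assms(1) z(1) assms(2)] by blast
    then show ?thesis using assms(4) z eq unfolding depends_on_def by blast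
  qed
  then show "vderiv X h z = vderiv X h z'"
    unfolding vderiv_def p[symmetric] by (intro sum.cong) auto
qed

lemma vderiv_const [simp]: "vderiv X (\<lambda>_. a) z = 0"
  by (simp add: vderiv_def)

lemma vderiv_coordinate [simp]: "vderiv X (\<lambda>z. z d) z = X d z"
  by (subst vderiv_eq_sum[of "{d}"]) (auto simp: partial_coordinate)

lemma vderiv_add:
  assumes "open S" "smooth_on S g" "smooth_on S h" "z \<in> S"
  shows "vderiv X (\<lambda>z. g z + h z) z = vderiv X g z + vderiv X h z"
proof -
  obtain E where E: "finite E" "depends_on E S g" "depends_on E S h"
    by (rule smooth_on_depends2[OF assms(2,3)])
  note eq = vderiv_eq_sum_depends[OF assms(1,4) E(1)]
  show ?thesis
    unfolding eq[OF E(2)] eq[OF E(3)] eq[OF depends_on_binop[where F = "(+)", OF E(2,3)]]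
    by (simp add: partial_add[OF assms(2-4)] sum.distrib algebra_simps)
qed

lemma vderiv_mult:
  assumes "open S" "smooth_on S g" "smooth_on S h" "z \<in> S"
  shows "vderiv X (\<lambda>z. g z * h z) z = vderiv X g z * h z + g z * vderiv X h z"
proof -
  obtain E where E: "finite E" "depends_on E S g" "depends_on E S h"
    by (rule smooth_on_depends2[OF assms(2,3)])
  note eq = vderiv_eq_sum_depends[OF assms(1,4) E(1)]
  show ?thesis
    unfolding eq[OF E(2)] eq[OF E(3)] eq[OF depends_on_binop[where F = "(*)", OF E(2,3)]]
    by (simp add: partial_mult[OF assms(2-4)] sum.distrib sum_distrib_left sum_distrib_right algebra_simps)
qed

lemma vderiv_sum:
  assumes "open S" "\<And>i. i \<in> I \<Longrightarrow> smooth_on S (g i)" "z \<in> S"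
  shows "vderiv X (\<lambda>z. \<Sum>i\<in>I. g i z) z = (\<Sum>i\<in>I. vderiv X (g i) z)"
  using assms(2)
proof (induction I rule: infinite_finite_induct)
  case (insert i I)
  then have "vderiv X (\<lambda>z. g i z + (\<Sum>i\<in>I. g i z)) z = vderiv X (g i) z + vderiv X (\<lambda>z. \<Sum>i\<in>I. g i z) z"
    by (intro vderiv_add[of S] smooth_on_sum assms(1,3)) auto
  with insert show ?case by simp
qed auto

text \<open>Naturality for related vector fields: if \<open>F\<close> carries \<open>X\<close> to
  \<open>X'\<close>, then pulling back commutes with differentiation. All later passages between
  time derivatives in different coordinates rest on it.\<close>

lemma vderiv_compose:
  fixes F :: "('b \<Rightarrow> real) \<Rightarrow> 'c \<Rightarrow> real"
  assumes U: "open U" "\<And>d. smooth_on U (\<lambda>z. F z d)" and V: "open V" "\<And>z. z \<in> U \<Longrightarrow> F z \<in> V"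
    and h: "smooth_on V h" and z: "z \<in> U"
    and F: "\<And>d. vderiv X (\<lambda>z. F z d) z = X' d (F z)"
  shows "vderiv X (\<lambda>z. h (F z)) z = vderiv X' h (F z)"
proof -
  obtain C where C: "finite C" "depends_on C V h" using smooth_on_depends[OF h] .
  have "\<exists>D. finite D \<and> depends_on D U (\<lambda>z. F z d)" for d
    using smooth_on_depends[OF U(2)] by metis
  then obtain D where D: "\<And>d. finite (D d)" "\<And>d. depends_on (D d) U (\<lambda>z. F z d)" by metis
  define E where "E = (\<Union>d\<in>C. D d)"
  have E: "finite E" using C(1) D(1) by (simp add: E_def)
  have zero: "partial c (\<lambda>z. F z d) z = 0" if "c \<notin> E" "d \<in> C" for c d
    by (rule partial_zero[OF U(1) z D(2)]) (use that in \<open>auto simp: E_def\<close>)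
  have pc: "partial c (\<lambda>z. h (F z)) z = (\<Sum>d\<in>C. partial d h (F z) * partial c (\<lambda>z. F z d) z)" for c
    by (rule partial_compose[OF U V h C z])
  have "vderiv X (\<lambda>z. h (F z)) z = (\<Sum>c\<in>E. X c z * partial c (\<lambda>z. h (F z)) z)"
    by (rule vderiv_eq_sum[OF E]) (auto simp: pc zero)
  also have "\<dots> = (\<Sum>c\<in>E. \<Sum>d\<in>C. partial d h (F z) * (X c z * partial c (\<lambda>z. F z d) z))"
    by (intro sum.cong refl, subst pc) (simp add: sum_distrib_left mult_ac)
  also have "\<dots> = (\<Sum>d\<in>C. partial d h (F z) * (\<Sum>c\<in>E. X c z * partial c (\<lambda>z. F z d) z))"
    by (subst sum.swap) (simp add: sum_distrib_left)
  also have "\<dots> = (\<Sum>d\<in>C. X' d (F z) * partial d h (F z))"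
    by (intro sum.cong refl, subst vderiv_eq_sum[OF E zero, symmetric]) (auto simp: F mult_ac)
  also have "\<dots> = vderiv X' h (F z)"
    by (rule vderiv_eq_sum_depends[OF V(1) V(2)[OF z] C, symmetric])
  finally show ?thesis .
qed

text \<open>The coordinate form of d(L h) = L(dh) for the Lie derivative L along \<open>X\<close>.
  The support \<open>D\<close> must be uniform over \<open>S\<close>, since the derivation is
  rewritten as a finite sum before it is differentiated.\<close>

lemma partial_vderiv:
  assumes S: "open S" "z \<in> S" and X: "\<And>c. smooth_on S (X c)" and h: "smooth_on S h"
    and D: "finite D" "\<And>z c. z \<in> S \<Longrightarrow> c \<notin> D \<Longrightarrow> partial c h z = 0"
  shows "partial c (vderiv X h) z = vderiv X (partial c h) z + (\<Sum>d\<in>D. partial c (X d) z * partial d h z)"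
proof -
  have "partial c (vderiv X h) z = partial c (\<lambda>z. \<Sum>d\<in>D. X d z * partial d h z) z"
    by (rule partial_cong[OF S]) (rule vderiv_eq_sum[OF D(1) D(2)])
  also have "\<dots> = (\<Sum>d\<in>D. partial c (X d) z * partial d h z + X d z * partial c (partial d h) z)"
    using S X h by (subst partial_sum[OF S(1)])
      (auto intro!: sum.cong smooth_on_mult smooth_on_partial partial_mult[of S])
  also have "\<dots> = (\<Sum>d\<in>D. X d z * partial d (partial c h) z) + (\<Sum>d\<in>D. partial c (X d) z * partial d h z)"
    unfolding sum.distrib partial_commute[OF S(1) h S(2)] by simp
  also have "(\<Sum>d\<in>D. X d z * partial d (partial c h) z) = vderiv X (partial c h) z"
  proof (rule vderiv_eq_sum[OF D(1), symmetric])
    fix d assume "d \<notin> D"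
    have "partial c (partial d h) z = partial c (\<lambda>_. 0) z"
      by (rule partial_cong[OF S]) (use D(2) \<open>d \<notin> D\<close> in auto)
    then show "partial d (partial c h) z = 0"
      using partial_commute[OF S(1) h S(2)] by simp
  qed
  finally show ?thesis .
qed

lemma vderiv_curve:
  fixes \<gamma> :: "real \<Rightarrow> 'c \<Rightarrow> real"
  assumes S: "open S" "smooth_on S h"
    and \<gamma>: "\<forall>\<^sub>F t in nhds t0. \<gamma> t \<in> S" "\<And>d. ((\<lambda>t. \<gamma> t d) has_real_derivative X d (\<gamma> t0)) (at t0)"
  shows "((\<lambda>t. h (\<gamma> t)) has_real_derivative vderiv X h (\<gamma> t0)) (at t0)"
proof -
  obtain C where C: "finite C" "depends_on C S h" using smooth_on_depends[OF S(2)] .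
  have "\<gamma> t0 \<in> S" using \<gamma>(1) eventually_nhds_x_imp_x by fastforce
  then have "vderiv X h (\<gamma> t0) = (\<Sum>d\<in>C. partial d h (\<gamma> t0) * X d (\<gamma> t0))"
    using vderiv_eq_sum_depends[OF S(1) _ C] by (simp add: mult.commute)
  with chain_rule_curve[OF S(1) smooth_on_Ck[OF S(2)] C \<gamma>] show ?thesis by simp
qed

section \<open>The Lie derivative of the system as a derivation along a field on jets\<close>

definition jet_field :: "(('n, 'm) jet \<Rightarrow> real ^ 'n) \<Rightarrow> ('n::finite, 'm) coord \<Rightarrow> ('n, 'm) jet \<Rightarrow> real" where
  "jet_field g c z = (case c of Xc i \<Rightarrow> g z $ i | Uc j k \<Rightarrow> z (Uc j (Suc k)))"

lemma jet_field_simps [simp]: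
  "jet_field g (Xc i) z = g z $ i" "jet_field g (Uc j k) z = z (Uc j (Suc k))"
  by (simp_all add: jet_field_def)

lemma depends_on_state_inp:
  "depends_on (range Xc \<union> range (\<lambda>j. Uc j 0)) S (\<lambda>z :: ('n::finite, 'm::finite) jet. F (state z) (inp z))"
  unfolding depends_on_def
proof (intro ballI impI)
  fix z z' :: "('n, 'm) jet" assume "\<forall>c\<in>range Xc \<union> range (\<lambda>j. Uc j 0). z c = z' c"
  then have "state z = state z'" "inp z = inp z'" by (auto simp: state_def inp_def vec_eq_iff)
  then show "F (state z) (inp z) = F (state z') (inp z')" by simp
qed

lemma finite_input_orders:
  fixes D :: "('n, 'm) coord set"
  assumes "finite D"
  obtains l where "\<And>j k. Uc j k \<in> D \<Longrightarrow> k < l"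
proof -
  have "finite (case_coord (\<lambda>_. 0) (\<lambda>_ k. k) ` D)" using assms by simp
  then obtain l where "\<And>j k. Uc j k \<in> D \<Longrightarrow> k < l"
    using finite_nat_set_iff_bounded by (metis coord.simps(6) image_eqI)
  then show thesis by (rule that)
qed

lemma smooth_on_jet_field:
  assumes "\<And>i. smooth_on S (\<lambda>z. g z $ i)"
  shows "smooth_on S (jet_field g c)"
  by (cases c) (use assms in \<open>auto simp: jet_field_def[abs_def]\<close>)

text \<open>The support of \<open>h\<close> contains input derivatives below some order
  \<open>l\<close> only, which truncates the series in \<open>lie\<close> to a finite sum.\<close>

lemma lie_eq_vderiv:
  fixes g :: "('n::finite, 'm::finite) jet \<Rightarrow> real ^ 'n"
  assumes "open S" "z \<in> S" "smooth_on S h"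
  shows "lie g h z = vderiv (jet_field g) h z"
proof -
  obtain C where C: "finite C" "depends_on C S h" using smooth_on_depends[OF assms(3)] .
  obtain l where l: "\<And>j k. Uc j k \<in> C \<Longrightarrow> k < l" using finite_input_orders[OF C(1)] by blast
  define D where "D = range (Xc :: 'n \<Rightarrow> ('n, 'm) coord) \<union> {Uc j \<alpha> | j \<alpha>. \<alpha> < l}"
  have "C \<subseteq> D"
  proof
    fix c assume "c \<in> C" then show "c \<in> D" using l by (cases c) (auto simp: D_def)
  qed
  then have dep: "depends_on D S h" using C(2) depends_on_mono by blast
  have D: "D = range Xc \<union> (\<lambda>(j, \<alpha>). Uc j \<alpha>) ` (UNIV \<times> {..<l})" by (auto simp: D_def)
  have "finite D" unfolding D by simp
  from vderiv_eq_sum_depends[OF assms(1,2) this dep]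
  have "vderiv (jet_field g) h z = (\<Sum>c\<in>D. jet_field g c z * partial c h z)" .
  also have "\<dots> = (\<Sum>c\<in>range Xc. jet_field g c z * partial c h z)
      + (\<Sum>c\<in>(\<lambda>(j, \<alpha>). Uc j \<alpha>) ` (UNIV \<times> {..<l}). jet_field g c z * partial c h z)"
    unfolding D by (rule sum.union_disjoint) auto
  also have "(\<Sum>c\<in>range Xc. jet_field g c z * partial c h z) = (\<Sum>i\<in>UNIV. g z $ i * partial (Xc i) h z)"
    by (subst sum.reindex) (auto simp: inj_on_def)
  also have "(\<Sum>c\<in>(\<lambda>(j::'m, \<alpha>). Uc j \<alpha>) ` (UNIV \<times> {..<l}). jet_field g c z * partial c h z)
      = (\<Sum>j\<in>UNIV. \<Sum>\<alpha><l. z (Uc j (Suc \<alpha>)) * partial (Uc j \<alpha>) h z)"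
    by (subst sum.reindex) (auto simp: inj_on_def sum.cartesian_product case_prod_beta)
  finally show ?thesis
    using lie_truncate[OF assms(1,2) dep[unfolded D_def]] by simp
qed

lemma lie_cong:
  assumes "open S" "z \<in> S" "\<And>z. z \<in> S \<Longrightarrow> h z = h' z"
  shows "lie g h z = lie g h' z"
  unfolding lie_def using partial_cong[OF assms] by simp

lemma smooth_on_lie:
  fixes g :: "('n::finite, 'm::finite) jet \<Rightarrow> real ^ 'n"
  assumes "open S" "\<And>i. smooth_on S (\<lambda>z. g z $ i)" "smooth_on S h"
  shows "smooth_on S (lie g h)"
  using smooth_on_vderiv[OF assms(1) smooth_on_jet_field[OF assms(2)] assms(3)]
  by (rule smooth_on_cong[OF assms(1)]) (use lie_eq_vderiv[OF assms(1) _ assms(3)] in simp)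

section \<open>Inverse functions by exchanging coordinates\<close>

text \<open>On a coordinate box around \<open>z0\<close> the function \<open>h\<close> is strictly
  increasing in \<open>c\<close>. Monotonicity makes the solution \<open>g\<close> of h(w(c := t)) =
  w c unique, the intermediate value theorem makes it persist for nearby \<open>w\<close>, and its
  derivatives follow by implicit differentiation.\<close>

lemma coordinate_swap_pos:
  fixes h :: "('c \<Rightarrow> real) \<Rightarrow> real"
  assumes S: "open S" "smooth_on S h" "z0 \<in> S" and pos: "partial c h z0 > 0"
  obtains U V g where "open U" "z0 \<in> U" "U \<subseteq> S" "open V" "smooth_on V g"
    "\<forall>z\<in>U. z(c := h z) \<in> V \<and> g (z(c := h z)) = z c"
    "\<forall>w\<in>V. w(c := g w) \<in> U \<and> h (w(c := g w)) = w c"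
proof -
  obtain C where C: "finite C" "depends_on C S h" using smooth_on_depends[OF S(2)] .
  define T where "T = {z \<in> S. partial c h z \<in> {0<..}}"
  have T: "open T" unfolding T_def
    by (intro open_vimage_on S(1) open_greaterThan smooth_on_continuous smooth_on_partial S(2))
  have "z0 \<in> T" using S(3) pos by (auto simp: T_def)
  then obtain D0 \<epsilon> where D0: "finite D0" "\<epsilon> > 0"
    and box: "\<forall>z'. (\<forall>e\<in>D0. \<bar>z' e - z0 e\<bar> < \<epsilon>) \<longrightarrow> z' \<in> T"
    by (rule open_contains_coordinate_box[OF T])
  \<comment> \<open>Including \<open>c\<close> makes the section of the box in direction
    \<open>c\<close> the interval \<open>I\<close>; including the support of \<open>h\<close> makes
    \<open>D\<close> a support of \<open>g\<close>.\<close>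
  define D where "D = D0 \<union> C \<union> {c}"
  define U where "U = {z. \<forall>d\<in>D. \<bar>z d - z0 d\<bar> < \<epsilon>}"
  \<comment> \<open>The coordinate \<open>c\<close> is left free, because in the new coordinates it
    stores a value of \<open>h\<close>.\<close>
  define N where "N = {w. \<forall>d\<in>D - {c}. \<bar>w d - z0 d\<bar> < \<epsilon>}"
  define I where "I = {t. \<bar>t - z0 c\<bar> < \<epsilon>}"
  have fin: "finite D" using D0 C by (simp add: D_def)
  have oU: "open U" and oN: "open N"
    unfolding U_def N_def by (rule open_coordinate_box; simp add: fin)+
  have UT: "U \<subseteq> T" using box by (auto simp: U_def D_def)
  then have US: "U \<subseteq> S" by (auto simp: T_def)
  have upd: "w(c := t) \<in> U" if "w \<in> N" "t \<in> I" for w t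
    using that by (auto simp: U_def N_def I_def)
  have Usplit: "z \<in> N" "z c \<in> I" if "z \<in> U" for z
    using that by (auto simp: U_def N_def I_def D_def)
  have seg: "s \<in> I" if "t1 \<in> I" "t2 \<in> I" "t1 \<le> s" "s \<le> t2" for s t1 t2
    using that by (auto simp: I_def)
  have deriv: "((\<lambda>t. h (w(c := t))) has_real_derivative partial c h (w(c := t))) (at t)"
    if "w \<in> N" "t \<in> I" for w t
    by (rule has_derivative_line[OF smooth_on_Ck[OF S(2)]]) (use upd[OF that] US in auto)
  have dpos: "partial c h (w(c := t)) > 0" if "w \<in> N" "t \<in> I" for w t
    using upd[OF that] UT by (auto simp: T_def)
  have mono: "h (w(c := t1)) < h (w(c := t2))" if "w \<in> N" "t1 \<in> I" "t2 \<in> I" "t1 < t2" for w t1 t2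
    by (rule DERIV_pos_imp_increasing[OF that(4)])
      (use deriv[OF that(1)] dpos[OF that(1)] seg[OF that(2,3)] in blast)
  have ineq: "(h (w(c := t1)) < h (w(c := t2))) \<longleftrightarrow> t1 < t2" if "w \<in> N" "t1 \<in> I" "t2 \<in> I" for w t1 t2
    using mono[OF that] mono[OF that(1,3,2)] by (cases t1 t2 rule: linorder_cases) auto
  have cont: "continuous_on N (\<lambda>w. h (w(c := t)))" if "t \<in> I" for t
    by (rule continuous_on_compose2[OF smooth_on_continuous[OF S(2)]])
      (use upd[OF _ that] US in \<open>auto intro: continuous_on_fun_upd continuous_on_id continuous_on_const\<close>)
  have side: "open {w \<in> N. h (w(c := t)) - w c \<in> A}" if "t \<in> I" "open A" for t A
    by (intro open_vimage_on oN that continuous_on_diff cont)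
      (auto intro: continuous_on_subset[OF continuous_on_product_coordinates])
  define V where "V = {w \<in> N. \<exists>t\<in>I. h (w(c := t)) = w c}"
  define g where "g w = (THE t. t \<in> I \<and> h (w(c := t)) = w c)" for w
  have uniq: "t = t'" if "w \<in> N" "t \<in> I" "t' \<in> I" "h (w(c := t)) = h (w(c := t'))" for w t t'
    using ineq[OF that(1-3)] ineq[OF that(1,3,2)] that(4) by (metis linorder_neqE_linordered_idom less_irrefl)
  have g: "g w = t" if "w \<in> N" "t \<in> I" "h (w(c := t)) = w c" for w t
    unfolding g_def by (rule the_equality) (use that uniq in auto)
  have gV: "g w \<in> I" "h (w(c := g w)) = w c" "w \<in> N" if "w \<in> V" for w
    using that g unfolding V_def by auto
  have Iopen: "\<exists>t1\<in>I. \<exists>t2\<in>I. a < t1 \<and> t1 < t \<and> t < t2 \<and> t2 < b" if "t \<in> I" "a < t" "t < b" for t a b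
  proof -
    have "open I" unfolding I_def
      by (intro open_Collect_less continuous_intros)
    then have "open (I \<inter> {a<..<b})" by auto
    moreover have "t \<in> I \<inter> {a<..<b}" using that by auto
    ultimately obtain e where e: "e > 0" "ball t e \<subseteq> I \<inter> {a<..<b}" using open_contains_ball by blast
    then have "t - e/2 \<in> ball t e" "t + e/2 \<in> ball t e" by (auto simp: dist_real_def)
    then have "t - e/2 \<in> I \<inter> {a<..<b}" "t + e/2 \<in> I \<inter> {a<..<b}" using e(2) by blast+
    then show ?thesis using e(1) by (intro bexI[of _ "t - e/2"] bexI[of _ "t + e/2"]) auto
  qed
  have between: "w \<in> V \<and> t1 < g w \<and> g w < t2"
    if w: "w \<in> N" and t: "t1 \<in> I" "t2 \<in> I" "h (w(c := t1)) < w c" "w c < h (w(c := t2))" for w t1 t2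
  proof -
    have "t1 < t2" using ineq[OF w t(1,2)] t(3,4) by linarith
    moreover have "continuous_on {t1..t2} (\<lambda>t. h (w(c := t)))"
      by (intro continuous_at_imp_continuous_on ballI DERIV_isCont[OF deriv[OF w seg[OF t(1,2)]]]) auto
    ultimately obtain s where s: "s \<in> I" "h (w(c := s)) = w c"
      using IVT'[of "\<lambda>t. h (w(c := t))" t1 "w c" t2] t seg[OF t(1,2)] by auto
    with g[OF w this] ineq[OF w t(1) s(1)] ineq[OF w s(1) t(2)] t w show ?thesis by (auto simp: V_def)
  qed
  \<comment> \<open>The two strict inequalities that bracket the solution between \<open>t1\<close>
    and \<open>t2\<close> are open conditions on \<open>w\<close>. This yields at once that
    \<open>V\<close> is open and that \<open>g\<close> is continuous.\<close>
  have nbhd: "\<exists>M. open M \<and> w \<in> M \<and> (\<forall>w'\<in>M. w' \<in> V \<and> a < g w' \<and> g w' < b)"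
    if w: "w \<in> V" "a < g w" "g w < b" for w a b
  proof -
    obtain t1 t2 where t: "t1 \<in> I" "t2 \<in> I" "a < t1" "t1 < g w" "g w < t2" "t2 < b"
      using Iopen[OF gV(1)[OF w(1)] w(2,3)] by blast
    define M where "M = {w \<in> N. h (w(c := t1)) - w c \<in> {..<0}} \<inter> {w \<in> N. h (w(c := t2)) - w c \<in> {0<..}}"
    have "open M" unfolding M_def by (intro open_Int side t open_lessThan open_greaterThan)
    moreover have "w \<in> M"
      using gV[OF w(1)] t ineq[OF gV(3)[OF w(1)], of t1 "g w"] ineq[OF gV(3)[OF w(1)], of "g w" t2]
      by (auto simp: M_def)
    moreover have "w' \<in> V \<and> a < g w' \<and> g w' < b" if "w' \<in> M" for w'
      using between[of w' t1 t2] that t by (auto simp: M_def)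
    ultimately show ?thesis by blast
  qed
  have oV: "open V"
    using nbhd[of _ "g _ - 1" "g _ + 1"] by (subst open_subopen) (metis subsetI less_add_one diff_less_eq)
  have gc: "continuous_on V g"
    unfolding continuous_on_def
  proof
    fix w assume w: "w \<in> V"
    show "(g \<longlongrightarrow> g w) (at w within V)"
    proof (rule order_tendstoI)
      fix a assume "a < g w"
      from nbhd[OF w this, of "g w + 1"] show "\<forall>\<^sub>F x in at w within V. a < g x"
        unfolding eventually_at_topological by auto
    next
      fix b assume "g w < b"
      from nbhd[OF w _ this, of "g w - 1"] show "\<forall>\<^sub>F x in at w within V. g x < b"
        unfolding eventually_at_topological by auto
    qed
  qed
  define G where "G w = w(c := g w)" for w
  have GU: "G w \<in> U" if "w \<in> V" for w
    unfolding G_def by (rule upd) (use gV[OF that] in auto)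
  \<comment> \<open>Implicit differentiation of h(w(c := g w)) = w c: the right side contributes 1
    when \<open>d = c\<close>, and \<open>h\<close> sees the change of \<open>d\<close> directly
    only when \<open>d\<close> differs from \<open>c\<close>.\<close>
  define p where "p d w = ((if d = c then 1 else 0) - (if d = c then 0 else partial d h (G w))) / partial c h (G w)" for d w
  have gd: "((\<lambda>t. g (w(d := t))) has_real_derivative p d w) (at (w d))" if w: "w \<in> V" for w d
  proof -
    define s where "s t = g (w(d := t))" for t
    \<comment> \<open>The defect left by the old solution \<open>g w\<close> at the moved point. It
      equals q t * (s t - g w), and its own derivative involves only the coordinate
      \<open>d\<close>.\<close>
    define r where "r t = (w(d := t)) c - h ((w(d := t))(c := g w))" for t
    have ev: "\<forall>\<^sub>F t in at (w d). w(d := t) \<in> V"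
      using eventually_line[OF oV w] unfolding eventually_at_filter by (rule eventually_mono) auto
    have "continuous_on {t. w(d := t) \<in> V} s"
      unfolding s_def by (rule continuous_on_compose2[OF gc])
        (auto intro: continuous_on_fun_upd continuous_on_id continuous_on_const)
    then have "isCont s (w d)"
      using open_line[OF oV, of w d] w by (simp add: continuous_on_eq_continuous_at)
    then have slim: "(s \<longlongrightarrow> g w) (at (w d))" by (simp add: isCont_def s_def)
    have lim: "((\<lambda>t. (w(d := t)) e) \<longlongrightarrow> w e) (at (w d))" if "e \<noteq> c" for e
      by (cases "e = d") (auto intro: tendsto_ident_at)
    have lim2: "((\<lambda>t. ((w(d := t))(c := g w)) e) \<longlongrightarrow> G w e) (at (w d))" for e
      using lim[of e] by (cases "e = c") (auto simp: G_def)
    have GS: "G w \<in> S" using GU[OF w] US by auto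
    have "(s \<longlongrightarrow> G w c) (at (w d))" "((\<lambda>_. g w) \<longlongrightarrow> G w c) (at (w d))"
      using slim by (auto simp: G_def)
    from partial_difference_quotient[OF S(1) smooth_on_Ck[OF S(2)] GS lim2 this]
    obtain q where q: "(q \<longlongrightarrow> partial c h (G w)) (at (w d))"
      "\<And>t. h ((w(d := t))(c := s t)) - h ((w(d := t))(c := g w)) = q t * (s t - g w)"
      by (auto simp del: fun_upd_apply)
    have Lpos: "partial c h (G w) > 0" using GU[OF w] UT by (auto simp: T_def)
    have rd: "(r has_real_derivative (if d = c then 1 else 0) - (if d = c then 0 else partial d h (G w))) (at (w d))"
    proof (cases "d = c")
      case True
      then show ?thesis unfolding r_def by (auto intro!: derivative_eq_intros)
    next
      case False
      have "((\<lambda>t. h ((G w)(d := t))) has_real_derivative partial d h (G w)) (at (G w d))"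
        by (rule has_derivative_smooth[OF S(2) GS])
      moreover have "(w(d := t))(c := g w) = (G w)(d := t)" for t
        using False unfolding G_def by (rule fun_upd_twist)
      ultimately show ?thesis using False unfolding r_def
        by (auto simp: G_def intro!: derivative_eq_intros)
    qed
    have r0: "r (w d) = 0" using gV[OF w] by (simp add: r_def)
    have "((\<lambda>t. (r t / (t - w d)) / q t) \<longlongrightarrow> p d w) (at (w d))"
      unfolding p_def using rd r0 Lpos by (intro tendsto_divide q) (auto simp: has_field_derivative_iff)
    moreover have "\<forall>\<^sub>F t in at (w d). (r t / (t - w d)) / q t = (s t - s (w d)) / (t - w d)"
      using order_tendstoD(1)[OF q(1) Lpos] ev
    proof eventually_elim
      case (elim t)
      have "r t = q t * (s t - g w)"
        using q(2)[of t] gV(2)[OF elim(2)] by (simp add: r_def s_def)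
      then show ?case using elim by (simp add: s_def)
    qed
    ultimately have "((\<lambda>t. (s t - s (w d)) / (t - w d)) \<longlongrightarrow> p d w) (at (w d))"
      by (rule Lim_transform_eventually)
    then show ?thesis by (simp add: has_field_derivative_iff s_def)
  qed
  \<comment> \<open>The formula \<open>p\<close> contains \<open>g\<close> but none of its
    derivatives, so class k of \<open>g\<close> gives class k + 1.\<close>
  have "Ck_on k V g" for k
  proof (induction k)
    case (Suc k)
    have GC: "Ck_on k V (\<lambda>w. G w e)" for e
      using Suc Ck_on_coordinate by (cases "e = c") (auto simp: G_def)
    have c1: "Ck_on k V (\<lambda>w. partial d h (G w))" for d
      by (rule Ck_on_compose[OF oV GC S(1) _ smooth_on_partial[OF S(1,2)]]) (use GU US in auto)
    have c2: "Ck_on k V (\<lambda>w. inverse (partial c h (G w)))"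
      by (rule Ck_on_inverse[OF oV c1]) (use GU UT in \<open>force simp: T_def\<close>)
    have c3: "Ck_on k V (\<lambda>w. (if d = c then 1 else 0) - (if d = c then 0 else partial d h (G w)))" for d
      using Ck_on_add[OF oV Ck_on_const[of k V 0] Ck_on_mult[OF oV Ck_on_const[of k V "-1"] c1]] by (cases "d = c") auto
    have "Ck_on k V (p d)" for d
      unfolding p_def[abs_def] divide_inverse by (rule Ck_on_mult[OF oV c3 c2])
    with gd show ?case by (intro Ck_on_SucI[OF oV gc]) auto
  qed (use gc in simp)
  moreover have "depends_on D V g"
    unfolding depends_on_def
  proof (intro ballI impI)
    fix w w' assume w: "w \<in> V" "w' \<in> V" and eq: "\<forall>d\<in>D. w d = w' d"
    have "w'(c := g w) \<in> S" "w(c := g w) \<in> S"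
      using upd[OF gV(3)[OF w(2)] gV(1)[OF w(1)]] upd[OF gV(3)[OF w(1)] gV(1)[OF w(1)]] US by blast+
    moreover have "\<forall>d\<in>C. (w'(c := g w)) d = (w(c := g w)) d" using eq by (auto simp: D_def)
    ultimately have "h (w'(c := g w)) = h (w(c := g w))"
      using C(2) unfolding depends_on_def by blast
    moreover have "w c = w' c" using eq by (auto simp: D_def)
    ultimately show "g w = g w'" using g[OF gV(3)[OF w(2)] gV(1)[OF w(1)]] gV(2)[OF w(1)] by simp
  qed
  ultimately have gs: "smooth_on V g" unfolding smooth_on_def using fin by blast
  have "z0 \<in> U" using D0(2) by (auto simp: U_def)
  moreover have "z(c := h z) \<in> V \<and> g (z(c := h z)) = z c" if z: "z \<in> U" for z
  proof -
    have "z(c := h z) \<in> N" using Usplit[OF z] by (auto simp: N_def)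
    moreover have "h ((z(c := h z))(c := z c)) = (z(c := h z)) c" by simp
    ultimately show ?thesis using g[OF _ Usplit(2)[OF z]] Usplit(2)[OF z] unfolding V_def by blast
  qed
  moreover have "w(c := g w) \<in> U \<and> h (w(c := g w)) = w c" if "w \<in> V" for w
    using GU[OF that] gV[OF that] by (simp add: G_def)
  ultimately show thesis using that[OF oU _ US oV gs] by blast
qed

lemma coordinate_swap:
  fixes h :: "('c \<Rightarrow> real) \<Rightarrow> real"
  assumes S: "open S" "smooth_on S h" "z0 \<in> S" and nz: "partial c h z0 \<noteq> 0"
  obtains U V g where "open U" "z0 \<in> U" "U \<subseteq> S" "open V" "smooth_on V g"
    "\<forall>z\<in>U. z(c := h z) \<in> V \<and> g (z(c := h z)) = z c"
    "\<forall>w\<in>V. w(c := g w) \<in> U \<and> h (w(c := g w)) = w c"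
proof (cases "partial c h z0 > 0")
  case True
  show thesis by (rule coordinate_swap_pos[OF S True]) (rule that)
next
  case False
  have "smooth_on S (\<lambda>z. (-1) * h z)" by (intro smooth_on_mult S(1,2)) auto
  then have sm: "smooth_on S (\<lambda>z. - h z)" by simp
  have "partial c (\<lambda>z. (-1) * h z) z0 = - partial c h z0"
    by (subst partial_mult[OF smooth_on_const S(2,3)]) simp
  then have "partial c (\<lambda>z. - h z) z0 > 0" using False nz by simp
  from coordinate_swap_pos[OF S(1) sm S(3) this] obtain U V g where *:
    "open U" "z0 \<in> U" "U \<subseteq> S" "open V" "smooth_on V g"
    "\<forall>z\<in>U. z(c := - h z) \<in> V \<and> g (z(c := - h z)) = z c"
    "\<forall>w\<in>V. w(c := g w) \<in> U \<and> - h (w(c := g w)) = w c" .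
  \<comment> \<open>The chart for the negated function stores - h in the coordinate
    \<open>c\<close>; this reflection corrects the sign.\<close>
  define n where "n w = w(c := - w c)" for w :: "'c \<Rightarrow> real"
  define V' where "V' = {w. n w \<in> V}"
  have ns: "smooth_on UNIV (\<lambda>w. n w d)" for d
    using smooth_on_mult[OF open_UNIV smooth_on_const[of _ "-1"] smooth_on_coordinate[of UNIV c]]
    by (cases "d = c") (auto simp: n_def)
  have "open V'"
    using open_vimage_on[OF open_UNIV *(4) smooth_map_continuous_on[OF ns]] by (simp add: V'_def)
  moreover have "smooth_on V' (\<lambda>w. g (n w))"
    by (rule smooth_on_compose[OF \<open>open V'\<close> smooth_on_subset[OF ns] *(4) _ *(5)]) (auto simp: V'_def)
  moreover have "z(c := h z) \<in> V' \<and> g (n (z(c := h z))) = z c" if "z \<in> U" for z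
    using *(6)[rule_format, OF that] by (simp add: V'_def n_def)
  moreover have "w(c := g (n w)) \<in> U \<and> h (w(c := g (n w))) = w c" if "w \<in> V'" for w
    using *(7)[rule_format, of "n w"] that by (simp add: V'_def n_def)
  ultimately show thesis using that[OF *(1-3)] by blast
qed

text \<open>The slot \<sigma> p of a coordinate given up receives the function \<open>h p\<close>,
  so source and target share one coordinate space, and all but finitely many coordinates are
  untouched. \<open>T\<close> is prescribed at every point, its inversion only on
  \<open>U\<close>.\<close>

definition coordinate_chart :: "'i set \<Rightarrow> ('i \<Rightarrow> ('c \<Rightarrow> real) \<Rightarrow> real) \<Rightarrow> ('i \<Rightarrow> 'c) \<Rightarrow>
    ('c \<Rightarrow> real) set \<Rightarrow> ('c \<Rightarrow> real) set \<Rightarrow> (('c \<Rightarrow> real) \<Rightarrow> 'c \<Rightarrow> real) \<Rightarrow>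
    (('c \<Rightarrow> real) \<Rightarrow> 'c \<Rightarrow> real) \<Rightarrow> bool" where
  "coordinate_chart P h \<sigma> U V T G \<longleftrightarrow> inj_on \<sigma> P \<and> open U \<and> open V \<and>
    (\<forall>z. \<forall>p\<in>P. T z (\<sigma> p) = h p z) \<and> (\<forall>z. \<forall>c. c \<notin> \<sigma> ` P \<longrightarrow> T z c = z c) \<and>
    (\<forall>c. smooth_on V (\<lambda>w. G w c)) \<and>
    (\<forall>z\<in>U. T z \<in> V \<and> G (T z) = z) \<and> (\<forall>w\<in>V. G w \<in> U \<and> T (G w) = w)"

lemma coordinate_chart_exists:
  fixes h :: "'i \<Rightarrow> ('c \<Rightarrow> real) \<Rightarrow> real"
  assumes "finite P" and S: "open S" "z0 \<in> S" and h: "\<And>p. p \<in> P \<Longrightarrow> smooth_on S (h p)"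
    and ind: "\<And>a. \<forall>c\<in>C. (\<Sum>p\<in>P. a p * partial c (h p) z0) = 0 \<Longrightarrow> \<forall>p\<in>P. a p = 0"
  shows "\<exists>\<sigma> U V T G. coordinate_chart P h \<sigma> U V T G \<and> \<sigma> ` P \<subseteq> C \<and> z0 \<in> U \<and> U \<subseteq> S"
  using assms(1) h ind
proof (induction P)
  case empty
  show ?case
    by (rule exI[of _ "\<lambda>_. undefined"], rule exI[of _ S], rule exI[of _ S], rule exI[of _ id], rule exI[of _ id])
      (auto simp: S coordinate_chart_def)
next
  case (insert p P)
  have ind': "\<forall>q\<in>P. a q = 0" if a: "\<forall>c\<in>C. (\<Sum>q\<in>P. a q * partial c (h q) z0) = 0" for a
  proof -
    have "(\<Sum>q\<in>insert p P. (a(p := 0)) q * partial c (h q) z0) = (\<Sum>q\<in>P. a q * partial c (h q) z0)" for c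
      using insert.hyps by (auto intro!: sum.cong)
    with a have "\<forall>c\<in>C. (\<Sum>q\<in>insert p P. (a(p := 0)) q * partial c (h q) z0) = 0" by simp
    from insert.prems(2)[OF this] insert.hyps(2) show ?thesis by (metis fun_upd_other insertI2)
  qed
  from insert.IH[OF insert.prems(1) ind'] obtain \<sigma> U V T G where
    ch: "coordinate_chart P h \<sigma> U V T G" and IH2: "\<sigma> ` P \<subseteq> C" "z0 \<in> U" "U \<subseteq> S" by auto
  note IH = ch[unfolded coordinate_chart_def, THEN conjunct1] IH2(1)
    ch[unfolded coordinate_chart_def, THEN conjunct2, THEN conjunct1] IH2(2,3)
    ch[unfolded coordinate_chart_def, THEN conjunct2, THEN conjunct2, THEN conjunct1]
  have T: "\<And>z q. q \<in> P \<Longrightarrow> T z (\<sigma> q) = h q z" "\<And>z c. c \<notin> \<sigma> ` P \<Longrightarrow> T z c = z c"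
    and G: "\<And>c. smooth_on V (\<lambda>w. G w c)"
    and UV: "\<And>z. z \<in> U \<Longrightarrow> T z \<in> V" "\<And>z. z \<in> U \<Longrightarrow> G (T z) = z"
    and VU: "\<And>w. w \<in> V \<Longrightarrow> G w \<in> U" "\<And>w. w \<in> V \<Longrightarrow> T (G w) = w"
    using ch by (simp_all add: coordinate_chart_def)
  define h' where "h' w = h p (G w)" for w
  have h': "smooth_on V h'"
    unfolding h'_def by (rule smooth_on_compose[OF IH(6) G S(1) _ insert.prems(1)]) (use VU IH(5) in auto)
  have Ts: "smooth_on U (\<lambda>z. T z c)" for c
  proof (cases "c \<in> \<sigma> ` P")
    case True
    then obtain q where q: "q \<in> P" "c = \<sigma> q" by blast
    then show ?thesis using T(1) smooth_on_subset[OF insert.prems(1)[of q] IH(5)] by simp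
  qed (simp add: T(2))
  define w0 where "w0 = T z0"
  have w0: "w0 \<in> V" using UV IH(4) by (simp add: w0_def)
  have "\<exists>c\<in>C - \<sigma> ` P. partial c h' w0 \<noteq> 0"
  proof (rule ccontr)
    assume "\<not> ?thesis"
    then have zero: "partial c h' w0 = 0" if "c \<in> C" "c \<notin> \<sigma> ` P" for c using that by blast
    obtain D where D: "finite D" "depends_on D V h'" using smooth_on_depends[OF h'] .
    define E where "E = D \<union> \<sigma> ` P"
    have E: "finite E" "depends_on E V h'" using D insert.hyps(1) by (auto simp: E_def intro: depends_on_mono)
    \<comment> \<open>If \<open>h'\<close> varied along exchanged coordinates only, the chain rule
      would express the differential of \<open>h p\<close> on \<open>C\<close> by those of the
      \<open>h q\<close>; the -1 makes this a forbidden relation.\<close>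
    define a where "a q = (if q = p then -1 else partial (\<sigma> q) h' w0)" for q
    have "(\<Sum>q\<in>insert p P. a q * partial c (h q) z0) = 0" if c: "c \<in> C" for c
    proof -
      have "partial c (h p) z0 = partial c (\<lambda>z. h' (T z)) z0"
        by (rule partial_cong[OF IH(3,4)]) (simp add: h'_def UV)
      also have "\<dots> = (\<Sum>d\<in>E. partial d h' w0 * partial c (\<lambda>z. T z d) z0)"
        unfolding w0_def by (rule partial_compose[OF IH(3) Ts IH(6) UV(1) h' E IH(4)])
      also have "\<dots> = (\<Sum>d\<in>\<sigma> ` P. partial d h' w0 * partial c (\<lambda>z. T z d) z0)"
        by (rule sum.mono_neutral_right[OF E(1)])
          (use zero[OF c] in \<open>auto simp: E_def T(2) partial_coordinate\<close>)
      also have "\<dots> = (\<Sum>q\<in>P. a q * partial c (h q) z0)"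
        using insert.hyps(2) by (subst sum.reindex[OF IH(1)]) (auto intro!: sum.cong simp: a_def T(1))
      finally show ?thesis using insert.hyps by (simp add: a_def)
    qed
    then have "a p = 0" using insert.prems(2)[of a] by blast
    then show False by (simp add: a_def)
  qed
  then obtain c where c: "c \<in> C" "c \<notin> \<sigma> ` P" "partial c h' w0 \<noteq> 0" by blast
  obtain U2 V2 g where sw: "open U2" "w0 \<in> U2" "U2 \<subseteq> V" "open V2" "smooth_on V2 g"
    and sw': "\<forall>z\<in>U2. z(c := h' z) \<in> V2 \<and> g (z(c := h' z)) = z c"
      "\<forall>w\<in>V2. w(c := g w) \<in> U2 \<and> h' (w(c := g w)) = w c"
    by (rule coordinate_swap[OF IH(6) h' w0 c(3)])
  note sw1 = bspec[OF sw'(1)] and sw2 = bspec[OF sw'(2)]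
  define \<sigma>' where "\<sigma>' = \<sigma>(p := c)"
  define U' where "U' = {z \<in> U. T z \<in> U2}"
  define T' where "T' z = (T z)(c := h p z)" for z
  define G' where "G' w = G (w(c := g w))" for w
  have \<sigma>': "\<sigma>' ` insert p P = insert c (\<sigma> ` P)" "\<And>q. q \<in> P \<Longrightarrow> \<sigma>' q = \<sigma> q" "\<sigma>' p = c"
    using insert.hyps(2) by (auto simp: \<sigma>'_def)
  have U': "open U'" unfolding U'_def
    by (rule open_vimage_on[OF IH(3) sw(1) smooth_map_continuous_on[OF Ts]])
  have upd: "smooth_on V2 (\<lambda>w. (w(c := g w)) d)" for d using sw(5) by (cases "d = c") auto
  have G': "smooth_on V2 (\<lambda>w. G' w d)" for d
    unfolding G'_def by (rule smooth_on_compose[OF sw(4) upd IH(6) _ G]) (use sw2 sw(3) in blast)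
  have 1: "T' z \<in> V2 \<and> G' (T' z) = z" if "z \<in> U'" for z
  proof -
    have z: "z \<in> U" "T z \<in> U2" using that by (auto simp: U'_def)
    have "T' z = (T z)(c := h' (T z))" using UV(2)[OF z(1)] by (simp add: T'_def h'_def)
    with sw1[OF z(2)] UV(2)[OF z(1)] show ?thesis by (simp add: G'_def)
  qed
  have 2: "G' w \<in> U' \<and> T' (G' w) = w" if "w \<in> V2" for w
  proof -
    have w: "w(c := g w) \<in> U2" "h' (w(c := g w)) = w c" "w(c := g w) \<in> V" using sw2[OF that] sw(3) by auto
    then show ?thesis using VU[OF w(3)] unfolding U'_def T'_def G'_def h'_def by auto
  qed
  have "inj_on \<sigma>' (insert p P)"
    using IH(1) c(2) insert.hyps(2) \<sigma>' by (auto simp: inj_on_def image_iff)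
  moreover have "\<sigma>' ` insert p P \<subseteq> C" unfolding \<sigma>'(1) using IH(2) c(1) by auto
  moreover have "z0 \<in> U'" using IH(4) sw(2) by (simp add: U'_def w0_def)
  moreover have "U' \<subseteq> S" using IH(5) by (auto simp: U'_def)
  moreover have "\<forall>z. \<forall>q\<in>insert p P. T' z (\<sigma>' q) = h q z"
  proof (intro allI ballI)
    fix z q assume "q \<in> insert p P"
    then consider "q = p" | "q \<in> P" by blast
    then show "T' z (\<sigma>' q) = h q z"
    proof cases
      case 2
      then have "\<sigma> q \<noteq> c" using c(2) by auto
      with 2 show ?thesis by (simp add: \<sigma>' T'_def T)
    qed (simp add: \<sigma>' T'_def)
  qed
  moreover have "\<forall>z. \<forall>d. d \<notin> \<sigma>' ` insert p P \<longrightarrow> T' z d = z d"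
    unfolding \<sigma>'(1) by (auto simp: T'_def T)
  ultimately have "coordinate_chart (insert p P) h \<sigma>' U' V2 T' G'"
    unfolding coordinate_chart_def using U' sw(4) G' 1 2 by blast
  moreover note \<open>\<sigma>' ` insert p P \<subseteq> C\<close> \<open>z0 \<in> U'\<close> \<open>U' \<subseteq> S\<close>
  ultimately show ?case by blast
qed

section \<open>Generic linear independence of differentials\<close>

lemma nontrivial_relation:
  fixes a :: "'i \<Rightarrow> 'k \<Rightarrow> real"
  assumes "finite K" "finite I" "card K < card I"
  shows "\<exists>c. (\<exists>i\<in>I. c i \<noteq> 0) \<and> (\<forall>k\<in>K. (\<Sum>i\<in>I. c i * a i k) = 0)"
  using assms
proof (induction K arbitrary: I a)
  case empty
  then have "I \<noteq> {}" by auto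
  then show ?case by (intro exI[of _ "\<lambda>_. 1"]) auto
next
  case (insert k K)
  show ?case
  proof (cases "\<forall>i\<in>I. a i k = 0")
    case True
    have "card K < card I" using insert by simp
    from insert.IH[OF insert.prems(1) this, of a] True show ?thesis by auto
  next
    case False
    \<comment> \<open>Gaussian elimination: the pivot row \<open>i0\<close> clears column
      \<open>k\<close>, and its coefficient in \<open>c'\<close> below collects the multiples that
      were subtracted.\<close>
    then obtain i0 where i0: "i0 \<in> I" "a i0 k \<noteq> 0" by blast
    let ?I = "I - {i0}"
    have "card K < card ?I" using insert i0 by (simp add: card_Diff_singleton)
    from insert.IH[OF _ this, of "\<lambda>i l. a i l - a i k / a i0 k * a i0 l"] insert.prems(1)
    obtain c where c: "\<exists>i\<in>?I. c i \<noteq> 0"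
      "\<And>l. l \<in> K \<Longrightarrow> (\<Sum>i\<in>?I. c i * (a i l - a i k / a i0 k * a i0 l)) = 0" by auto
    define c' where "c' i = (if i = i0 then - (\<Sum>i\<in>?I. c i * (a i k / a i0 k)) else c i)" for i
    have sum: "(\<Sum>i\<in>I. c' i * a i l) = (\<Sum>i\<in>?I. c i * (a i l - a i k / a i0 k * a i0 l))" for l
    proof -
      have "(\<Sum>i\<in>I. c' i * a i l) = c' i0 * a i0 l + (\<Sum>i\<in>?I. c' i * a i l)"
        by (rule sum.remove[OF insert.prems(1) i0(1)])
      also have "(\<Sum>i\<in>?I. c' i * a i l) = (\<Sum>i\<in>?I. c i * a i l)"
        by (intro sum.cong) (auto simp: c'_def)
      finally show ?thesis
        by (simp add: c'_def algebra_simps sum_subtractf sum_distrib_left)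
    qed
    have "(\<Sum>i\<in>I. c' i * a i k) = 0" unfolding sum using i0(2) by simp
    then have "\<forall>l\<in>insert k K. (\<Sum>i\<in>I. c' i * a i l) = 0" using c(2) sum by auto
    moreover have "\<exists>i\<in>I. c' i \<noteq> 0" using c(1) by (auto simp: c'_def)
    ultimately show ?thesis by blast
  qed
qed

text \<open>A left kernel vector of the factor \<open>a\<close> would also be one of the identity
  matrix. The rank comparisons below all reduce to this.\<close>

lemma card_le_of_factorization:
  fixes a :: "'i \<Rightarrow> 'k \<Rightarrow> real"
  assumes "finite I" "finite K"
    and "\<And>i j. i \<in> I \<Longrightarrow> j \<in> I \<Longrightarrow> (\<Sum>k\<in>K. a i k * b k j) = (if i = j then 1 else 0)"
  shows "card I \<le> card K"
proof (rule ccontr)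
  assume "\<not> ?thesis"
  then obtain c where c: "\<exists>i\<in>I. c i \<noteq> 0" "\<forall>k\<in>K. (\<Sum>i\<in>I. c i * a i k) = 0"
    using nontrivial_relation[OF assms(2,1), of a] by auto
  have "c j = 0" if j: "j \<in> I" for j
  proof -
    have "0 = (\<Sum>k\<in>K. (\<Sum>i\<in>I. c i * a i k) * b k j)" using c(2) by simp
    also have "\<dots> = (\<Sum>i\<in>I. c i * (\<Sum>k\<in>K. a i k * b k j))"
      unfolding sum_distrib_right sum_distrib_left by (subst sum.swap) (simp add: mult.assoc)
    also have "\<dots> = (\<Sum>i\<in>I. if i = j then c i else 0)"
      using assms(3) j by (intro sum.cong) auto
    also have "\<dots> = c j" using assms(1) j by simp
    finally show ?thesis by simp
  qed
  with c(1) show False by blast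
qed

section \<open>One-forms, dual vector fields and spans\<close>

definition pairing :: "'c set \<Rightarrow> ('c \<Rightarrow> ('c \<Rightarrow> real) \<Rightarrow> real) \<Rightarrow> ('c \<Rightarrow> ('c \<Rightarrow> real) \<Rightarrow> real) \<Rightarrow> ('c \<Rightarrow> real) \<Rightarrow> real" where
  "pairing C v \<omega> z = (\<Sum>c\<in>C. v c z * \<omega> c z)"

text \<open>The fields certify independence at every point of \<open>U\<close> at once, the
  certificate survives restriction, and the coefficients of a dependent form are pairings, hence
  smooth.\<close>

definition dual_system :: "('c \<Rightarrow> real) set \<Rightarrow> 'i set \<Rightarrow> ('i \<Rightarrow> 'c \<Rightarrow> ('c \<Rightarrow> real) \<Rightarrow> real) \<Rightarrow>
    'c set \<Rightarrow> ('i \<Rightarrow> 'c \<Rightarrow> ('c \<Rightarrow> real) \<Rightarrow> real) \<Rightarrow> bool" where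
  "dual_system U B \<omega> C v \<longleftrightarrow> finite B \<and> finite C \<and> (\<forall>b\<in>B. \<forall>c. smooth_on U (v b c)) \<and>
     (\<forall>b\<in>B. \<forall>b'\<in>B. \<forall>z\<in>U. pairing C (v b) (\<omega> b') z = (if b = b' then 1 else 0))"

lemma dual_system_subset: "dual_system U B \<omega> C v \<Longrightarrow> U' \<subseteq> U \<Longrightarrow> B' \<subseteq> B \<Longrightarrow> dual_system U' B' \<omega> C v"
  unfolding dual_system_def by (meson finite_subset smooth_on_subset subset_eq)

lemma dual_system_pairing:
  "dual_system U B \<omega> C v \<Longrightarrow> b \<in> B \<Longrightarrow> b' \<in> B \<Longrightarrow> z \<in> U \<Longrightarrow>
    pairing C (v b) (\<omega> b') z = (if b = b' then 1 else 0)"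
  unfolding dual_system_def by blast

lemma smooth_on_pairing:
  assumes "open U" "\<And>c. smooth_on U (v c)" "\<And>c. smooth_on U (\<omega> c)"
  shows "smooth_on U (pairing C v \<omega>)"
  unfolding pairing_def[abs_def] by (intro smooth_on_sum smooth_on_mult assms)

lemma pairing_sum:
  assumes "\<And>c. c \<in> C \<Longrightarrow> \<omega> c z = (\<Sum>b\<in>B. g b * \<eta> b c z)"
  shows "pairing C v \<omega> z = (\<Sum>b\<in>B. g b * pairing C v (\<eta> b) z)"
proof -
  have "pairing C v \<omega> z = (\<Sum>c\<in>C. \<Sum>b\<in>B. g b * (v c z * \<eta> b c z))"
    unfolding pairing_def by (intro sum.cong) (auto simp: assms sum_distrib_left mult_ac)
  also have "\<dots> = (\<Sum>b\<in>B. g b * pairing C v (\<eta> b) z)"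
    by (subst sum.swap) (simp add: pairing_def sum_distrib_left)
  finally show ?thesis .
qed

text \<open>
  One Gram-Schmidt step with dual vector fields keeps all coefficients smooth without inverting
  matrices.
\<close>

lemma dual_system_extend:
  assumes U: "open U" and dual: "dual_system U B \<omega> C v" and p: "p \<notin> B"
    and sm: "\<And>b c. b \<in> insert p B \<Longrightarrow> smooth_on U (\<omega> b c)"
    and z1: "z1 \<in> U" "\<omega> p c1 z1 \<noteq> (\<Sum>b\<in>B. pairing C (v b) (\<omega> p) z1 * \<omega> b c1 z1)"
  shows "\<exists>U' C' v'. open U' \<and> U' \<noteq> {} \<and> U' \<subseteq> U \<and> dual_system U' (insert p B) \<omega> C' v'"
proof -
  have fin: "finite B" "finite C" and vs: "\<And>b c. b \<in> B \<Longrightarrow> smooth_on U (v b c)"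
    and du: "\<And>b b' z. b \<in> B \<Longrightarrow> b' \<in> B \<Longrightarrow> z \<in> U \<Longrightarrow> pairing C (v b) (\<omega> b') z = (if b = b' then 1 else 0)"
    using dual by (auto simp: dual_system_def)
  define g where "g b = pairing C (v b) (\<omega> p)" for b
  define r where "r z = \<omega> p c1 z - (\<Sum>b\<in>B. g b z * \<omega> b c1 z)" for z
  have gs: "smooth_on U (g b)" if "b \<in> B" for b
    unfolding g_def by (rule smooth_on_pairing[OF U vs[OF that] sm]) simp
  have rs: "smooth_on U r"
    unfolding r_def[abs_def] by (intro smooth_on_diff smooth_on_sum smooth_on_mult gs sm U) auto
  define U' where "U' = {z \<in> U. r z \<in> - {0}}"
  have U': "open U'" unfolding U'_def by (intro open_vimage_on U smooth_on_continuous rs) auto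
  have U'U: "U' \<subseteq> U" "z1 \<in> U'" using z1 by (auto simp: U'_def r_def g_def)
  define C' where "C' = insert c1 C"
  \<comment> \<open>Outside \<open>C\<close> the fields are unconstrained, so they are cut off
    before \<open>c1\<close> joins the range of summation.\<close>
  define vv where "vv b c z = (if c \<in> C then v b c z else 0)" for b c z
  \<comment> \<open>The coordinate field of \<open>c1\<close>, corrected to annihilate the old forms
    and normalized on the new one.\<close>
  define vp where "vp c z = ((if c = c1 then 1 else 0) - (\<Sum>b\<in>B. \<omega> b c1 z * vv b c z)) / r z" for c z
  define v' where "v' b c z = (if b = p then vp c z else vv b c z - g b z * vp c z)" for b c z
  have vv: "pairing C' (vv b) \<eta> z = pairing C (v b) \<eta> z" for b \<eta> z
    unfolding pairing_def using fin(2) by (intro sum.mono_neutral_cong_right) (auto simp: C'_def vv_def)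
  have vp: "pairing C' vp \<eta> z = (\<eta> c1 z - (\<Sum>b\<in>B. \<omega> b c1 z * pairing C (v b) \<eta> z)) / r z" for \<eta> z
  proof -
    have "pairing C' vp \<eta> z = (\<Sum>c\<in>C'. (if c = c1 then \<eta> c z else 0)
        - (\<Sum>b\<in>B. \<omega> b c1 z * (vv b c z * \<eta> c z))) / r z"
      unfolding pairing_def vp_def sum_divide_distrib
    proof (intro sum.cong refl)
      fix c
      show "((if c = c1 then 1 else 0) - (\<Sum>b\<in>B. \<omega> b c1 z * vv b c z)) / r z * \<eta> c z
          = ((if c = c1 then \<eta> c z else 0) - (\<Sum>b\<in>B. \<omega> b c1 z * (vv b c z * \<eta> c z))) / r z"
        by (cases "c = c1") (simp_all add: left_diff_distrib sum_distrib_right mult.assoc)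
    qed
    also have "\<dots> = (\<eta> c1 z - (\<Sum>b\<in>B. \<omega> b c1 z * pairing C' (vv b) \<eta> z)) / r z"
    proof -
      have "(\<Sum>c\<in>C'. (if c = c1 then \<eta> c z else 0)) = \<eta> c1 z"
        using fin(2) by (simp add: C'_def)
      moreover have "(\<Sum>c\<in>C'. \<Sum>b\<in>B. \<omega> b c1 z * (vv b c z * \<eta> c z))
          = (\<Sum>b\<in>B. \<omega> b c1 z * pairing C' (vv b) \<eta> z)"
        by (subst sum.swap) (simp add: pairing_def sum_distrib_left)
      ultimately show ?thesis by (simp add: sum_subtractf)
    qed
    finally show ?thesis unfolding vv .
  qed
  have v'b: "pairing C' (v' b) \<eta> z = pairing C (v b) \<eta> z - g b z * pairing C' vp \<eta> z" if "b \<noteq> p" for b \<eta> z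
    using that vv[of b \<eta> z] unfolding pairing_def v'_def
    by (simp add: left_diff_distrib sum_subtractf sum_distrib_left mult.assoc)
  have v'p: "pairing C' (v' p) \<eta> z = pairing C' vp \<eta> z" for \<eta> z
    by (simp add: pairing_def v'_def)
  have vpb: "pairing C' vp (\<omega> b) z = 0" if "b \<in> B" "z \<in> U'" for b z
  proof -
    have "(\<Sum>b'\<in>B. \<omega> b' c1 z * pairing C (v b') (\<omega> b) z) = (\<Sum>b'\<in>B. if b' = b then \<omega> b' c1 z else 0)"
      using du that U'U by (intro sum.cong) auto
    then show ?thesis using fin(1) that by (simp add: vp)
  qed
  have vpp: "pairing C' vp (\<omega> p) z = 1" if "z \<in> U'" for z
    using that by (simp add: vp U'_def r_def g_def[symmetric] mult.commute)
  have vvs: "smooth_on U' (vv b c)" if "b \<in> B" for b c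
    using smooth_on_subset[OF vs[OF that] U'U(1)] unfolding vv_def by (cases "c \<in> C") auto
  have vps: "smooth_on U' (vp c)" for c
    unfolding vp_def[abs_def]
    by (intro smooth_on_divide smooth_on_diff smooth_on_sum smooth_on_mult U' vvs
        smooth_on_subset[OF rs U'U(1)] smooth_on_subset[OF sm U'U(1)]) (auto simp: U'_def)
  have v's: "smooth_on U' (v' b c)" if "b \<in> insert p B" for b c
  proof (cases "b = p")
    case True
    then show ?thesis using vps by (simp add: v'_def[abs_def])
  next
    case False
    then show ?thesis
      using that smooth_on_diff[OF U' vvs smooth_on_mult[OF U' smooth_on_subset[OF gs U'U(1)] vps], of b b]
      unfolding v'_def by auto
  qed
  have "pairing C' (v' b) (\<omega> b') z = (if b = b' then 1 else 0)"
    if b: "b \<in> insert p B" "b' \<in> insert p B" and z: "z \<in> U'" for b b' z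
  proof (cases "b = p")
    case True
    then show ?thesis using v'p vpb[OF _ z] vpp[OF z] b(2) by auto
  next
    case False
    then have "b \<in> B" using b by auto
    show ?thesis
    proof (cases "b' = p")
      case True
      then show ?thesis unfolding v'b[OF False] using vpp[OF z] False by (simp add: g_def)
    next
      case b': False
      then show ?thesis unfolding v'b[OF False] using vpb[of b' z] du[OF \<open>b \<in> B\<close>, of b' z] b z U'U by auto
    qed
  qed
  then have "dual_system U' (insert p B) \<omega> C' v'"
    unfolding dual_system_def using fin v's by (auto simp: C'_def)
  with U' U'U show ?thesis by blast
qed

definition smooth_span :: "('c \<Rightarrow> real) set \<Rightarrow> 'i set \<Rightarrow> ('i \<Rightarrow> 'c \<Rightarrow> ('c \<Rightarrow> real) \<Rightarrow> real) \<Rightarrow>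
    ('c \<Rightarrow> ('c \<Rightarrow> real) \<Rightarrow> real) \<Rightarrow> bool" where
  "smooth_span U B \<omega> \<eta> \<longleftrightarrow> (\<exists>g. (\<forall>b\<in>B. smooth_on U (g b)) \<and>
     (\<forall>z\<in>U. \<forall>c. \<eta> c z = (\<Sum>b\<in>B. g b z * \<omega> b c z)))"

lemma smooth_span_subset: "smooth_span U B \<omega> \<eta> \<Longrightarrow> U' \<subseteq> U \<Longrightarrow> smooth_span U' B \<omega> \<eta>"
  unfolding smooth_span_def
proof (elim exE conjE)
  fix g assume "U' \<subseteq> U" "\<forall>b\<in>B. smooth_on U (g b)" "\<forall>z\<in>U. \<forall>c. \<eta> c z = (\<Sum>b\<in>B. g b z * \<omega> b c z)"
  then show "\<exists>g. (\<forall>b\<in>B. smooth_on U' (g b)) \<and> (\<forall>z\<in>U'. \<forall>c. \<eta> c z = (\<Sum>b\<in>B. g b z * \<omega> b c z))"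
    by (intro exI[of _ g]) (auto intro: smooth_on_subset)
qed

lemma smooth_span_mono:
  assumes "smooth_span U B \<omega> \<eta>" "B \<subseteq> B'" "finite B'"
  shows "smooth_span U B' \<omega> \<eta>"
proof -
  obtain g where g: "\<forall>b\<in>B. smooth_on U (g b)" "\<forall>z\<in>U. \<forall>c. \<eta> c z = (\<Sum>b\<in>B. g b z * \<omega> b c z)"
    using assms(1) unfolding smooth_span_def by blast
  define g' where "g' b = (if b \<in> B then g b else (\<lambda>_. 0))" for b
  have "(\<Sum>b\<in>B. g b z * \<omega> b c z) = (\<Sum>b\<in>B'. g' b z * \<omega> b c z)" for c z
    by (intro sum.mono_neutral_cong_left assms) (auto simp: g'_def)
  moreover have "\<forall>b\<in>B'. smooth_on U (g' b)" using g(1) by (simp add: g'_def)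
  ultimately show ?thesis unfolding smooth_span_def using g(2) by (intro exI[of _ g']) simp
qed

text \<open>Either the next form equals its projection on all of the current open set, with smooth
  pairings as coefficients, or it differs from it at some point and the set shrinks to where it
  stays independent. Relations found earlier survive the shrinking, and each involves previously
  selected indices only.\<close>

lemma dual_system_greedy:
  fixes idx :: "nat \<Rightarrow> 'i"
  assumes U: "open U" "U \<noteq> {}" and dual: "dual_system U B0 \<omega> C v"
    and idx: "inj idx" "\<And>s. idx s \<notin> B0"
    and sm: "\<And>b c. smooth_on U (\<omega> b c)"
  shows "\<exists>U' B C' v'. open U' \<and> U' \<noteq> {} \<and> U' \<subseteq> U \<and> B \<subseteq> {..<N} \<and> dual_system U' (B0 \<union> idx ` B) \<omega> C' v' \<and>
    (\<forall>s<N. s \<notin> B \<longrightarrow> smooth_span U' (B0 \<union> idx ` (B \<inter> {..<s})) \<omega> (\<omega> (idx s)))"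
proof (induction N)
  case 0
  show ?case using U dual
    by (intro exI[of _ U] exI[of _ "{}"] exI[of _ C] exI[of _ v]) auto
next
  case (Suc N)
  then obtain U' B C' v' where IH: "open U'" "U' \<noteq> {}" "U' \<subseteq> U" "B \<subseteq> {..<N}"
    "dual_system U' (B0 \<union> idx ` B) \<omega> C' v'"
    and dep: "\<forall>s<N. s \<notin> B \<longrightarrow> smooth_span U' (B0 \<union> idx ` (B \<inter> {..<s})) \<omega> (\<omega> (idx s))"
    by auto
  have sm': "smooth_on U' (\<omega> b c)" for b c using smooth_on_subset[OF sm IH(3)] .
  let ?B = "B0 \<union> idx ` B"
  have BN: "B \<inter> {..<N} = B" using IH(4) by auto
  show ?case
  proof (cases "\<forall>z\<in>U'. \<forall>c. \<omega> (idx N) c z = (\<Sum>b\<in>?B. pairing C' (v' b) (\<omega> (idx N)) z * \<omega> b c z)")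
    case True
    have "\<forall>b\<in>?B. smooth_on U' (pairing C' (v' b) (\<omega> (idx N)))"
    proof
      fix b assume "b \<in> ?B"
      then have "smooth_on U' (v' b c)" for c using IH(5) by (simp add: dual_system_def)
      then show "smooth_on U' (pairing C' (v' b) (\<omega> (idx N)))"
        by (intro smooth_on_pairing IH(1) sm')
    qed
    with True have "smooth_span U' (B0 \<union> idx ` (B \<inter> {..<N})) \<omega> (\<omega> (idx N))"
      unfolding smooth_span_def BN by (intro exI[of _ "\<lambda>b. pairing C' (v' b) (\<omega> (idx N))"] conjI)
    with dep have "\<forall>s<Suc N. s \<notin> B \<longrightarrow> smooth_span U' (B0 \<union> idx ` (B \<inter> {..<s})) \<omega> (\<omega> (idx s))"
      by (auto simp: less_Suc_eq)
    moreover have "B \<subseteq> {..<Suc N}" using IH(4) by auto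
    ultimately show ?thesis using IH by blast
  next
    case False
    then obtain z1 c1 where z1: "z1 \<in> U'"
      "\<omega> (idx N) c1 z1 \<noteq> (\<Sum>b\<in>?B. pairing C' (v' b) (\<omega> (idx N)) z1 * \<omega> b c1 z1)" by blast
    have "idx N \<notin> ?B" using idx IH(4) by (auto dest: injD)
    from dual_system_extend[OF IH(1,5) this sm' z1]
    obtain U'' C'' v'' where U'': "open U''" "U'' \<noteq> {}" "U'' \<subseteq> U'"
      "dual_system U'' (insert (idx N) ?B) \<omega> C'' v''" by blast
    have ins: "insert (idx N) ?B = B0 \<union> idx ` insert N B" by auto
    have "\<forall>s<Suc N. s \<notin> insert N B \<longrightarrow> smooth_span U'' (B0 \<union> idx ` (insert N B \<inter> {..<s})) \<omega> (\<omega> (idx s))"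
    proof (intro allI impI)
      fix s assume s: "s < Suc N" "s \<notin> insert N B"
      then have "s < N" "s \<notin> B" and eq: "insert N B \<inter> {..<s} = B \<inter> {..<s}" by auto
      with dep show "smooth_span U'' (B0 \<union> idx ` (insert N B \<inter> {..<s})) \<omega> (\<omega> (idx s))"
        unfolding eq using smooth_span_subset[OF _ U''(3)] by blast
    qed
    moreover have "insert N B \<subseteq> {..<Suc N}" "U'' \<subseteq> U" using IH(3,4) U''(3) by auto
    ultimately show ?thesis using U''(1,2,4)[unfolded ins] by blast
  qed
qed

text \<open>The counterpart of \<open>smooth_span\<close> at a single point, sufficient for
  counting.\<close>

definition lin_span :: "'i set \<Rightarrow> ('i \<Rightarrow> 'c \<Rightarrow> real) \<Rightarrow> ('c \<Rightarrow> real) \<Rightarrow> bool" where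
  "lin_span Q a \<eta> \<longleftrightarrow> (\<exists>h. \<forall>c. \<eta> c = (\<Sum>q\<in>Q. h q * a q c))"

lemma lin_span_base:
  assumes "finite Q" "q \<in> Q"
  shows "lin_span Q a (a q)"
proof -
  have "a q c = (\<Sum>p\<in>Q. (if p = q then 1 else 0) * a p c)" for c
    using assms by (subst sum.remove[OF assms]) (auto intro!: sum.neutral)
  then show ?thesis unfolding lin_span_def by (intro exI[of _ "\<lambda>p. if p = q then 1 else 0"]) auto
qed

lemma lin_span_trans:
  assumes "lin_span B a \<eta>" "\<And>b. b \<in> B \<Longrightarrow> lin_span Q a' (a b)"
  shows "lin_span Q a' \<eta>"
proof -
  obtain h where h: "\<And>c. \<eta> c = (\<Sum>b\<in>B. h b * a b c)" using assms(1) unfolding lin_span_def by blast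
  have "\<forall>b\<in>B. \<exists>k. \<forall>c. a b c = (\<Sum>q\<in>Q. k q * a' q c)" using assms(2) unfolding lin_span_def by blast
  then obtain k where k: "\<And>b c. b \<in> B \<Longrightarrow> a b c = (\<Sum>q\<in>Q. k b q * a' q c)" by metis
  have "\<eta> c = (\<Sum>q\<in>Q. (\<Sum>b\<in>B. h b * k b q) * a' q c)" for c
  proof -
    have "\<eta> c = (\<Sum>b\<in>B. \<Sum>q\<in>Q. h b * k b q * a' q c)"
      unfolding h by (intro sum.cong) (auto simp: k sum_distrib_left mult.assoc)
    also have "\<dots> = (\<Sum>q\<in>Q. (\<Sum>b\<in>B. h b * k b q) * a' q c)"
      by (subst sum.swap) (simp add: sum_distrib_right)
    finally show ?thesis .
  qed
  then show ?thesis unfolding lin_span_def by (intro exI[of _ "\<lambda>q. \<Sum>b\<in>B. h b * k b q"]) auto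
qed

lemma lin_span_mono:
  assumes "lin_span Q a \<eta>" "Q \<subseteq> Q'" "finite Q'"
  shows "lin_span Q' a \<eta>"
  by (rule lin_span_trans[OF assms(1)]) (use assms in \<open>auto intro: lin_span_base\<close>)

lemma lin_span_image:
  assumes "lin_span Q (\<lambda>q. a (g q)) \<eta>" "finite Q"
  shows "lin_span (g ` Q) a \<eta>"
  by (rule lin_span_trans[OF assms(1)]) (use assms in \<open>auto intro: lin_span_base\<close>)

lemma smooth_span_imp_lin_span:
  "smooth_span U B \<omega> \<eta> \<Longrightarrow> z \<in> U \<Longrightarrow> lin_span B (\<lambda>b c. \<omega> b c z) (\<lambda>c. \<eta> c z)"
  unfolding smooth_span_def lin_span_def by (elim exE conjE, rule_tac x = "\<lambda>b. g b z" in exI) auto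

lemma pairing_lin_span_zero:
  assumes "lin_span B (\<lambda>b c. \<omega> b c z) (\<lambda>c. \<eta> c z)" "\<And>b. b \<in> B \<Longrightarrow> pairing C v (\<omega> b) z = 0"
  shows "pairing C v \<eta> z = 0"
proof -
  obtain h where "\<And>c. \<eta> c z = (\<Sum>b\<in>B. h b * \<omega> b c z)" using assms(1) unfolding lin_span_def by blast
  from pairing_sum[of C \<eta> z h \<omega> B v, OF this] assms(2) show ?thesis by simp
qed

text \<open>Pairing the expansions with the dual fields factors the identity on \<open>I\<close>
  through \<open>K\<close>.\<close>

lemma card_le_of_dual_system:
  assumes dual: "dual_system U I \<omega> C v" and z: "z \<in> U" and K: "finite K"
    and span: "\<And>i. i \<in> I \<Longrightarrow> lin_span K (\<lambda>k c. \<omega> k c z) (\<lambda>c. \<omega> i c z)"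
  shows "card I \<le> card K"
proof -
  have "\<forall>i\<in>I. \<exists>h. \<forall>c. \<omega> i c z = (\<Sum>k\<in>K. h k * \<omega> k c z)" using span unfolding lin_span_def by blast
  then obtain h where h: "\<And>i c. i \<in> I \<Longrightarrow> \<omega> i c z = (\<Sum>k\<in>K. h i k * \<omega> k c z)" by metis
  show ?thesis
  proof (rule card_le_of_factorization[OF _ K, where a = h and b = "\<lambda>k j. pairing C (v j) (\<omega> k) z"])
    fix i j assume ij: "i \<in> I" "j \<in> I"
    have "(\<Sum>k\<in>K. h i k * pairing C (v j) (\<omega> k) z) = pairing C (v j) (\<omega> i) z"
      by (rule pairing_sum[symmetric]) (rule h[OF ij(1)])
    then show "(\<Sum>k\<in>K. h i k * pairing C (v j) (\<omega> k) z) = (if i = j then 1 else 0)"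
      using dual ij z unfolding dual_system_def by auto
  qed (use dual in \<open>simp add: dual_system_def\<close>)
qed

lemma dual_system_independent:
  assumes dual: "dual_system U I \<omega> C v" and "z \<in> U" "J \<subseteq> I" "i \<in> J"
    and "\<And>c. (\<Sum>j\<in>J. a j * \<omega> j c z) = 0"
  shows "a i = 0"
proof -
  have J: "finite J" using dual assms(3) finite_subset unfolding dual_system_def by blast
  have "(0::real) = pairing C (v i) (\<lambda>_ _. 0) z" by (simp add: pairing_def)
  also have "\<dots> = (\<Sum>j\<in>J. a j * pairing C (v i) (\<omega> j) z)"
    by (rule pairing_sum) (simp add: assms(5))
  also have "\<dots> = (\<Sum>j\<in>J. if j = i then a j else 0)"
    using dual_system_pairing[OF dual _ _ assms(2)] assms(3,4) by (intro sum.cong) (auto simp: subset_iff)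
  also have "\<dots> = a i" using J assms(4) by simp
  finally show ?thesis by simp
qed

section \<open>Differentials of a flat output\<close>

text \<open>All \<phi>^j_[\<beta>] as one sequence in which adding \<open>m\<close> is one time
  derivative. \<open>order_zero\<close> expresses that the outputs themselves depend on (x, u)
  only.\<close>

locale output_sequence =
  fixes f :: "real ^ 'n \<Rightarrow> real ^ 'm \<Rightarrow> real ^ 'n"
    and W :: "('n::finite, 'm::finite) jet set"
    and y :: "nat \<Rightarrow> ('n, 'm) jet \<Rightarrow> real"
    and m :: nat
  assumes open_W: "open W"
    and smooth_f: "\<And>i. smooth_on W (\<lambda>z. open_loop f z $ i)"
    and smooth_y: "\<And>s. smooth_on W (y s)"
    and m_pos: "m > 0"
    and lie_y: "\<And>s z. z \<in> W \<Longrightarrow> lie (open_loop f) (y s) z = y (s + m) z"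
    and order_zero: "\<And>s j k z. s < m \<Longrightarrow> z \<in> W \<Longrightarrow> partial (Uc j (Suc k)) (y s) z = 0"
begin

abbreviation "X \<equiv> jet_field (open_loop f)"

lemma smooth_X: "smooth_on W (X c)"
  by (rule smooth_on_jet_field[OF smooth_f])

lemma finite_support:
  "\<exists>D. finite D \<and> (\<forall>t<N. \<forall>c z. z \<in> W \<longrightarrow> c \<notin> D \<longrightarrow> partial c (y t) z = 0)"
proof -
  have "\<exists>C. finite C \<and> depends_on C W (y t)" for t
    using smooth_on_depends[OF smooth_y] by metis
  then obtain C where C: "\<And>t. finite (C t)" "\<And>t. depends_on (C t) W (y t)" by metis
  have "partial c (y t) z = 0" if "t < N" "z \<in> W" "c \<notin> (\<Union>t<N. C t)" for t c z
    by (rule partial_zero[OF open_W that(2) C(2)[of t]]) (use that in auto)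
  then show ?thesis using C(1) by (intro exI[of _ "\<Union>t<N. C t"]) auto
qed

lemma partial_shift:
  assumes "finite D" "\<And>z c. z \<in> W \<Longrightarrow> c \<notin> D \<Longrightarrow> partial c (y t) z = 0" "z \<in> W"
  shows "partial c (y (t + m)) z = vderiv X (partial c (y t)) z + (\<Sum>e\<in>D. partial c (X e) z * partial e (y t) z)"
proof -
  have "partial c (y (t + m)) z = partial c (vderiv X (y t)) z"
    by (rule partial_cong[OF open_W assms(3)]) (simp add: lie_y[symmetric] lie_eq_vderiv[OF open_W _ smooth_y])
  also have "\<dots> = vderiv X (partial c (y t)) z + (\<Sum>e\<in>D. partial c (X e) z * partial e (y t) z)"
    by (rule partial_vderiv[OF open_W assms(3) smooth_X smooth_y assms(1,2)])
  finally show ?thesis .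
qed

text \<open>The Leibniz rule for the Lie derivative of the form \<eta> with coefficients
  \<open>d\<close>, read in the coordinate \<open>c\<close>: that component is the derivative of
  \<eta>_c along \<open>X\<close> plus the terms from differentiating \<open>X\<close>.\<close>

lemma lie_combination:
  assumes U: "open U" "U \<subseteq> W" "z \<in> U" and d: "\<And>t. smooth_on U (d t)"
    and D: "finite D" "\<And>t c z. t < N \<Longrightarrow> z \<in> W \<Longrightarrow> c \<notin> D \<Longrightarrow> partial c (y t) z = 0"
  shows "(\<Sum>t<N. vderiv X (d t) z * partial c (y t) z + d t z * partial c (y (t + m)) z)
    = vderiv X (\<lambda>z. \<Sum>t<N. d t z * partial c (y t) z) z
      + (\<Sum>e\<in>D. partial c (X e) z * (\<Sum>t<N. d t z * partial e (y t) z))"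
proof -
  have z: "z \<in> W" using U by blast
  have ps: "smooth_on U (partial c (y t))" for t
    using smooth_on_subset[OF smooth_on_partial[OF open_W smooth_y] U(2)] .
  have "vderiv X (\<lambda>z. \<Sum>t<N. d t z * partial c (y t) z) z
      = (\<Sum>t<N. vderiv X (d t) z * partial c (y t) z + d t z * vderiv X (partial c (y t)) z)"
    by (subst vderiv_sum[OF U(1) smooth_on_mult[OF U(1) d ps] U(3)])
      (simp add: vderiv_mult[OF U(1) d ps U(3)])
  moreover have "(\<Sum>e\<in>D. partial c (X e) z * (\<Sum>t<N. d t z * partial e (y t) z))
      = (\<Sum>t<N. d t z * (\<Sum>e\<in>D. partial c (X e) z * partial e (y t) z))"
    unfolding sum_distrib_left by (subst sum.swap) (simp add: mult_ac)
  moreover have "partial c (y (t + m)) z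
      = vderiv X (partial c (y t)) z + (\<Sum>e\<in>D. partial c (X e) z * partial e (y t) z)" if "t < N" for t
    by (rule partial_shift[OF D(1) D(2)[OF that] z])
  then have "(\<Sum>t<N. d t z * partial c (y (t + m)) z) = (\<Sum>t<N. d t z * vderiv X (partial c (y t)) z)
      + (\<Sum>t<N. d t z * (\<Sum>e\<in>D. partial c (X e) z * partial e (y t) z))"
    unfolding sum.distrib[symmetric] by (intro sum.cong) (auto simp: distrib_left)
  ultimately show ?thesis
    by (simp add: sum.distrib)
qed

text \<open>Neither \<open>f\<close> nor a higher component of the field contains u_[k+1]. This
  triangular form lets components of a form be computed from the next higher order.\<close>

lemma partial_field_higher_input:
  assumes "z \<in> W"
  shows "partial (Uc j (Suc k)) (X e) z = (if e = Uc j k then 1 else 0)"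
proof (cases e)
  case (Xc i)
  have "depends_on (range Xc \<union> range (\<lambda>j. Uc j 0)) W (X e)"
    using depends_on_state_inp[of W "\<lambda>x u. f x u $ i"]
    by (simp add: Xc jet_field_def[abs_def] open_loop_def)
  from partial_zero[OF open_W assms this, of "Uc j (Suc k)"] Xc show ?thesis by auto
next
  case (Uc j' k')
  then have "X e = (\<lambda>z. z (Uc j' (Suc k')))" by (simp add: fun_eq_iff)
  then show ?thesis using Uc by (auto simp: partial_coordinate)
qed

text \<open>State and output differentials share one index type, so a single dual system can hold
  both.\<close>

definition \<omega> :: "'n + nat \<Rightarrow> ('n, 'm) coord \<Rightarrow> ('n, 'm) jet \<Rightarrow> real" where
  "\<omega> b c z = (case b of Inl i \<Rightarrow> if c = Xc i then 1 else 0 | Inr s \<Rightarrow> partial c (y s) z)"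

lemma \<omega>_simps [simp]:
  "\<omega> (Inl i) c z = (if c = Xc i then 1 else 0)" "\<omega> (Inr s) c z = partial c (y s) z"
  by (simp_all add: \<omega>_def)

lemma smooth_\<omega>: "smooth_on W (\<omega> b c)"
  using smooth_on_partial[OF open_W smooth_y] by (cases b) (auto simp: \<omega>_def[abs_def])

text \<open>Lie differentiation of the relation: its left side moves to index s + m, and everything
  on the right stays strictly below.\<close>

lemma dependence_shift_up:
  assumes U: "open U" "U \<subseteq> W" and span: "smooth_span U (Inr ` {..<s}) \<omega> (\<omega> (Inr s))"
  shows "smooth_span U (Inr ` {..<s + m}) \<omega> (\<omega> (Inr (s + m)))"
proof -
  obtain g where g: "\<And>b. b \<in> Inr ` {..<s} \<Longrightarrow> smooth_on U (g b)"
    "\<And>z c. z \<in> U \<Longrightarrow> \<omega> (Inr s) c z = (\<Sum>b\<in>Inr ` {..<s}. g b z * \<omega> b c z)"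
    using span unfolding smooth_span_def by blast
  define d where "d t = (if t < s then g (Inr t) else (\<lambda>_. 0))" for t
  have ds: "smooth_on U (d t)" for t using g(1) by (auto simp: d_def)
  have eq: "partial c (y s) z = (\<Sum>t<s. d t z * partial c (y t) z)" if "z \<in> U" for c z
    using g(2)[OF that, of c] by (simp add: sum.reindex d_def)
  obtain D where D': "finite D" "\<forall>t<Suc s. \<forall>c z. z \<in> W \<longrightarrow> c \<notin> D \<longrightarrow> partial c (y t) z = 0"
    using finite_support[of "Suc s"] by blast
  note D = D'(1) D'(2)[rule_format]
  \<comment> \<open>By the Leibniz rule index \<open>t\<close> collects the derivative of its own
    coefficient and the coefficient shifted up from \<open>t - m\<close>; \<open>d\<close> is zero
    from \<open>s\<close> on.\<close>
  define g' where "g' b z = (case b of Inl i \<Rightarrow> 0 | Inr t \<Rightarrow> vderiv X (d t) z + (if m \<le> t then d (t - m) z else 0))"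
    for b :: "'n + nat" and z
  have "smooth_on U (g' b)" for b
  proof (cases b)
    case (Inr t)
    then show ?thesis unfolding g'_def[abs_def]
      using smooth_on_add[OF U(1) smooth_on_vderiv[OF U(1) smooth_on_subset[OF smooth_X U(2)] ds] ds]
        smooth_on_vderiv[OF U(1) smooth_on_subset[OF smooth_X U(2)] ds]
      by (cases "m \<le> t") auto
  qed (simp add: g'_def[abs_def])
  moreover have "\<omega> (Inr (s + m)) c z = (\<Sum>b\<in>Inr ` {..<s + m}. g' b z * \<omega> b c z)" if z: "z \<in> U" for c z
  proof -
    have zW: "z \<in> W" using z U by blast
    have "partial c (y (s + m)) z = vderiv X (partial c (y s)) z + (\<Sum>e\<in>D. partial c (X e) z * partial e (y s) z)"
      by (rule partial_shift[OF D(1) _ zW]) (use D(2) in auto)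
    also have "vderiv X (partial c (y s)) z = vderiv X (\<lambda>z. \<Sum>t<s. d t z * partial c (y t) z) z"
      by (rule vderiv_cong[OF U(1) z]) (rule eq)
    also have "(\<Sum>e\<in>D. partial c (X e) z * partial e (y s) z)
        = (\<Sum>e\<in>D. partial c (X e) z * (\<Sum>t<s. d t z * partial e (y t) z))"
      by (simp add: eq[OF z])
    also have "vderiv X (\<lambda>z. \<Sum>t<s. d t z * partial c (y t) z) z + \<dots>
        = (\<Sum>t<s. vderiv X (d t) z * partial c (y t) z + d t z * partial c (y (t + m)) z)"
      by (rule lie_combination[OF U z ds D(1), symmetric]) (use D(2) in auto)
    also have "\<dots> = (\<Sum>t<s. vderiv X (d t) z * partial c (y t) z) + (\<Sum>t<s. d t z * partial c (y (t + m)) z)"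
      by (rule sum.distrib)
    also have "(\<Sum>t<s. vderiv X (d t) z * partial c (y t) z) = (\<Sum>t<s + m. vderiv X (d t) z * partial c (y t) z)"
      by (rule sum.mono_neutral_left) (auto simp: d_def)
    also have "(\<Sum>t<s. d t z * partial c (y (t + m)) z) = (\<Sum>t\<in>{m..<s + m}. d (t - m) z * partial c (y t) z)"
      by (rule sum.reindex_bij_witness[of _ "\<lambda>t. t - m" "\<lambda>t. t + m"]) auto
    also have "\<dots> = (\<Sum>t<s + m. (if m \<le> t then d (t - m) z else 0) * partial c (y t) z)"
      by (rule sum.mono_neutral_cong_left) auto
    finally show ?thesis
      by (simp add: sum.reindex g'_def sum.distrib[symmetric] distrib_right)
  qed
  ultimately show ?thesis unfolding smooth_span_def by (intro exI[of _ g']) auto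
qed

text \<open>
  The first sum on the right is the Lie derivative of the form \<open>\<Sum>t<N. d t \<cdot> d(y t)\<close>, see
  \<open>lie_combination\<close>.
\<close>

lemma integrate_combination:
  assumes U: "open U" "U \<subseteq> W" and c: "\<And>t. smooth_on U (c t)"
  shows "\<exists>d e. (\<forall>t. smooth_on U (d t)) \<and> (N > 0 \<longrightarrow> d (N - 1) = c (N + m - 1)) \<and>
    (\<forall>z\<in>U. \<forall>x. (\<Sum>t<N + m. c t z * partial x (y t) z)
      = (\<Sum>t<N. vderiv X (d t) z * partial x (y t) z + d t z * partial x (y (t + m)) z)
        + (\<Sum>t<m. e t z * partial x (y t) z))"
  using c
proof (induction N arbitrary: c)
  case 0
  show ?case by (intro exI[of _ "\<lambda>_ _. 0"] exI[of _ c]) auto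
next
  case (Suc N)
  \<comment> \<open>Integration by parts of the top term: c(N + m) dy(N + m) is the Lie derivative
    of c(N + m) dy(N) minus a multiple of dy(N), which is absorbed at index
    \<open>N\<close>.\<close>
  define c' where "c' t z = (if t = N then c N z - vderiv X (c (N + m)) z else c t z)" for t z
  have c's: "smooth_on U (c' t)" for t
    using smooth_on_diff[OF U(1) Suc.prems smooth_on_vderiv[OF U(1) smooth_on_subset[OF smooth_X U(2)] Suc.prems]] Suc.prems[of t]
    unfolding c'_def[abs_def] by (cases "t = N") simp_all
  from Suc.IH[of c', OF c's] obtain d e where d: "\<And>t. smooth_on U (d t)"
    and eq: "\<And>z x. z \<in> U \<Longrightarrow> (\<Sum>t<N + m. c' t z * partial x (y t) z)
      = (\<Sum>t<N. vderiv X (d t) z * partial x (y t) z + d t z * partial x (y (t + m)) z)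
        + (\<Sum>t<m. e t z * partial x (y t) z)" by blast
  define d' where "d' = d(N := c (N + m))"
  have "(\<Sum>t<Suc N + m. c t z * partial x (y t) z)
      = (\<Sum>t<Suc N. vderiv X (d' t) z * partial x (y t) z + d' t z * partial x (y (t + m)) z)
        + (\<Sum>t<m. e t z * partial x (y t) z)" if z: "z \<in> U" for z x
  proof -
    have N: "N \<in> {..<N + m}" using m_pos by simp
    have "(\<Sum>t<N + m. c t z * partial x (y t) z)
        = (\<Sum>t<N + m. c' t z * partial x (y t) z) + vderiv X (c (N + m)) z * partial x (y N) z"
      unfolding sum.remove[OF finite_lessThan N] by (simp add: c'_def left_diff_distrib)
    with eq[OF z, of x] show ?thesis by (simp add: d'_def)
  qed
  moreover have "smooth_on U (d' t)" for t using d Suc.prems by (simp add: d'_def)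
  ultimately show ?case by (intro exI[of _ d'] exI[of _ e]) (simp add: d'_def)
qed

text \<open>Along u_[k+1] the integrated relation says that \<eta> at u_[k] is minus the derivative
  of \<eta> at u_[k+1]. As \<eta> has finite order, its input components vanish from the top down.
  What remains is a combination of dx whose leading coefficient, inherited from the relation, is 1,
  so it can be solved for dy(s).\<close>

lemma dependence_shift_down:
  assumes U: "open U" "U \<subseteq> W"
    and span: "smooth_span U (range Inl \<union> Inr ` {..<s + m}) \<omega> (\<omega> (Inr (s + m)))"
  shows "smooth_span U (range Inl \<union> Inr ` {..<s}) \<omega> (\<omega> (Inr s))"
proof -
  have union: "(\<Sum>b\<in>range Inl \<union> Inr ` {..<t}. h b) = (\<Sum>i\<in>UNIV. h (Inl i)) + (\<Sum>t<t. h (Inr t))"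
    for h :: "'n + nat \<Rightarrow> real" and t
    by (subst sum.union_disjoint) (auto simp: sum.reindex)
  obtain g where g: "\<And>b. b \<in> range Inl \<union> Inr ` {..<s + m} \<Longrightarrow> smooth_on U (g b)"
    "\<And>z c. z \<in> U \<Longrightarrow> \<omega> (Inr (s + m)) c z = (\<Sum>b\<in>range Inl \<union> Inr ` {..<s + m}. g b z * \<omega> b c z)"
    using span unfolding smooth_span_def by blast
  define c where "c t z = (if t < s + m then - 1 * g (Inr t) z else 1)" for t z
  have cs: "smooth_on U (c t)" for t
    using smooth_on_mult[OF U(1) smooth_on_const[of U "-1"] g(1)[of "Inr t"]]
    unfolding c_def[abs_def] by (cases "t < s + m") auto
  have c0: "(\<Sum>t<Suc s + m. c t z * partial (Uc j k) (y t) z) = 0" if "z \<in> U" for z j k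
    using g(2)[OF that, of "Uc j k"] by (simp add: union c_def sum_negf)
  from integrate_combination[OF U, of c "Suc s", OF cs] obtain d e where d: "\<And>t. smooth_on U (d t)"
    and top: "d s = c (s + m)"
    and eq: "\<And>z x. z \<in> U \<Longrightarrow> (\<Sum>t<Suc s + m. c t z * partial x (y t) z)
      = (\<Sum>t<Suc s. vderiv X (d t) z * partial x (y t) z + d t z * partial x (y (t + m)) z)
        + (\<Sum>t<m. e t z * partial x (y t) z)"
    unfolding add_Suc diff_Suc_1 by blast
  define \<eta> where "\<eta> x z = (\<Sum>t<Suc s. d t z * partial x (y t) z)" for x z
  have \<eta>s: "smooth_on U (\<eta> x)" for x
    unfolding \<eta>_def[abs_def]
    by (intro smooth_on_sum smooth_on_mult U(1) d smooth_on_subset[OF smooth_on_partial[OF open_W smooth_y] U(2)])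
  obtain D where D': "finite D" "\<forall>t<Suc s. \<forall>c z. z \<in> W \<longrightarrow> c \<notin> D \<longrightarrow> partial c (y t) z = 0"
    using finite_support[of "Suc s"] by blast
  note D = D'(1) D'(2)[rule_format]
  have \<eta>D: "\<eta> x z = 0" if "z \<in> U" "x \<notin> D" for x z
    using D(2)[of _ z x] that U(2) unfolding \<eta>_def by (intro sum.neutral) auto
  have rec: "\<eta> (Uc j k) z = - vderiv X (\<eta> (Uc j (Suc k))) z" if z: "z \<in> U" for j k z
  proof -
    have zW: "z \<in> W" using z U by blast
    \<comment> \<open>This is where dependence on (x, u) alone enters: the part that could not be
      integrated has no component along derivatives of the input.\<close>
    have "(\<Sum>t<m. e t z * partial (Uc j (Suc k)) (y t) z) = 0"
      using order_zero[OF _ zW] by (intro sum.neutral) auto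
    with eq[OF z, of "Uc j (Suc k)"] c0[OF z]
    have "0 = (\<Sum>t<Suc s. vderiv X (d t) z * partial (Uc j (Suc k)) (y t) z + d t z * partial (Uc j (Suc k)) (y (t + m)) z)"
      by simp
    also have "\<dots> = vderiv X (\<eta> (Uc j (Suc k))) z + (\<Sum>e\<in>D. partial (Uc j (Suc k)) (X e) z * \<eta> e z)"
      unfolding \<eta>_def by (rule lie_combination[OF U z d D])
    also have "(\<Sum>e\<in>D. partial (Uc j (Suc k)) (X e) z * \<eta> e z) = (\<Sum>e\<in>D. if e = Uc j k then \<eta> e z else 0)"
      by (intro sum.cong) (auto simp: partial_field_higher_input[OF zW])
    also have "\<dots> = \<eta> (Uc j k) z" using D(1) \<eta>D[OF z] by auto
    finally show ?thesis by simp
  qed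
  have step: "\<forall>z\<in>U. \<eta> (Uc j k) z = 0" if "\<forall>z\<in>U. \<eta> (Uc j (Suc k)) z = 0" for j k
  proof
    fix z assume z: "z \<in> U"
    have "vderiv X (\<eta> (Uc j (Suc k))) z = vderiv X (\<lambda>_. 0) z"
      by (rule vderiv_cong[OF U(1) z]) (use that in auto)
    then show "\<eta> (Uc j k) z = 0" using rec[OF z] by simp
  qed
  obtain l where l: "\<And>j k. Uc j k \<in> D \<Longrightarrow> k < l" using finite_input_orders[OF D(1)] by blast
  have zero: "\<forall>z\<in>U. \<eta> (Uc j k) z = 0" for j k
  proof (cases "k < l")
    case True
    then have "k \<le> l" by simp
    then show ?thesis
    proof (induction rule: inc_induct)
      case base
      show ?case using \<eta>D l by blast
    next
      case (step k)
      then show ?case using \<open>\<And>j k. _ \<Longrightarrow> \<forall>z\<in>U. \<eta> (Uc j k) z = 0\<close> by blast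
    qed
  next
    case False
    then show ?thesis using \<eta>D l by blast
  qed
  \<comment> \<open>Equates the two descriptions of \<eta>, by its state components and by the sum
    over the outputs, and isolates the term at \<open>s\<close>.\<close>
  define g' where "g' b z = (case b of Inl i \<Rightarrow> \<eta> (Xc i) z | Inr t \<Rightarrow> - 1 * d t z)" for b z
  have "smooth_on U (g' b)" for b
    using \<eta>s smooth_on_mult[OF U(1) smooth_on_const[of U "-1"] d]
    unfolding g'_def[abs_def] by (cases b) auto
  moreover have "\<omega> (Inr s) x z = (\<Sum>b\<in>range Inl \<union> Inr ` {..<s}. g' b z * \<omega> b x z)" if z: "z \<in> U" for x z
  proof -
    have "\<eta> x z = (\<Sum>i\<in>UNIV. \<eta> (Xc i) z * (if x = Xc i then 1 else 0))"
    proof (cases x)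
      case (Xc i)
      then have "(\<Sum>i'\<in>UNIV. \<eta> (Xc i') z * (if x = Xc i' then 1 else 0)) = (\<Sum>i'\<in>UNIV. if i' = i then \<eta> (Xc i') z else 0)"
        by (intro sum.cong) auto
      then show ?thesis using Xc by simp
    next
      case (Uc j k)
      then show ?thesis using zero z by simp
    qed
    moreover have "\<eta> x z = (\<Sum>t<s. d t z * partial x (y t) z) + partial x (y s) z"
      using top by (simp add: \<eta>_def c_def)
    ultimately show ?thesis by (simp add: union g'_def sum_negf)
  qed
  ultimately show ?thesis unfolding smooth_span_def by (intro exI[of _ g']) auto
qed

end

lemma card_image_Inl_Inr: "finite B \<Longrightarrow> card (range (Inl :: 'n::finite \<Rightarrow> 'n + 'b) \<union> Inr ` B) = CARD('n) + card B"
  by (subst card_Un_disjoint) (auto simp: card_image)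

text \<open>\<open>r\<close> bounds the orders in the parameterization. The last assumption is its
  pointwise trace: recovering inputs up to order l takes outputs up to order r + l, a cost that
  exceeds l by a constant.\<close>

locale flat_output_sequence = output_sequence f W y m
  for f and W :: "('n::finite, 'm::finite) jet set" and y m +
  fixes r :: nat
  assumes m_card: "m = CARD('m)"
    and coordinates: "\<And>c l z. z \<in> W \<Longrightarrow> c \<in> range Xc \<union> {Uc j k | j k. k \<le> l} \<Longrightarrow>
      lin_span {..<m * (r + l + 1)} (\<lambda>t x. partial x (y t) z) (\<lambda>x. if x = c then 1 else 0)"
begin

text \<open>
  A dependent \<open>y s\<close> makes all \<open>y (s + k * m)\<close> dependent, so the first \<open>N\<close> functions have
  at most about \<open>(m - 1) * N / m\<close> independent differentials, too few to recover the
  coordinates.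
\<close>

lemma no_dependence:
  assumes U: "open U" "U \<subseteq> W" "U \<noteq> {}"
  shows "\<not> smooth_span U (Inr ` {..<s}) \<omega> (\<omega> (Inr s))"
proof
  assume "smooth_span U (Inr ` {..<s}) \<omega> (\<omega> (Inr s))"
  then have dep: "smooth_span U (Inr ` {..<s + k * m}) \<omega> (\<omega> (Inr (s + k * m)))" for k
  proof (induction k)
    case (Suc k)
    from dependence_shift_up[OF U(1,2) Suc.IH[OF Suc.prems]] show ?case by (simp only: mult_Suc add_ac)
  qed simp
  obtain z where z: "z \<in> U" using U(3) by blast
  define E where "E = range (\<lambda>k. s + k * m)"
  let ?a = "\<lambda>t x. partial x (y t) z"
  \<comment> \<open>A relation may mention other members of \<open>E\<close>; they have smaller
    index and are eliminated recursively.\<close>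
  have red: "lin_span ({..t} - E) ?a (?a t)" for t
  proof (induction t rule: less_induct)
    case (less t)
    show ?case
    proof (cases "t \<in> E")
      case False
      then show ?thesis by (intro lin_span_base) auto
    next
      case True
      then obtain k where k: "t = s + k * m" by (auto simp: E_def)
      have "lin_span (Inr ` {..<t}) (\<lambda>b c. \<omega> b c z) (\<lambda>c. \<omega> (Inr t) c z)"
        using smooth_span_imp_lin_span[OF dep z, of k] by (simp only: k)
      then show ?thesis unfolding \<omega>_simps
      proof (rule lin_span_trans)
        fix b :: "'n + nat" assume "b \<in> Inr ` {..<t}"
        then obtain q where q: "b = Inr q" "q < t" by blast
        have "lin_span ({..t} - E) ?a (?a q)"
          by (rule lin_span_mono[OF less.IH[OF q(2)]]) (use q in auto)
        then show "lin_span ({..t} - E) ?a (\<lambda>c. \<omega> b c z)" by (simp add: q)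
      qed
    qed
  qed
  \<comment> \<open>The count below will require n + (r + l + 1 - s) \<le> m * r, which fails for
    this \<open>l\<close>.\<close>
  define l where "l = m * r + s"
  define T where "T = m * (r + l + 1)"
  define Cl :: "('n, 'm) coord set" where "Cl = range Xc \<union> {Uc j k | j k. k \<le> l}"
  define Q where "Q = {..<T} - E"
  have span: "lin_span Q ?a (\<lambda>x. if x = c then 1 else 0)" if c: "c \<in> Cl" for c :: "('n, 'm) coord"
  proof (rule lin_span_trans)
    show "lin_span {..<T} ?a (\<lambda>x. if x = c then 1 else 0)"
      using coordinates[of z c l] c z U(2) unfolding Cl_def T_def by blast
    show "lin_span Q ?a (?a t)" if "t \<in> {..<T}" for t
      by (rule lin_span_mono[OF red[of t]]) (use that in \<open>auto simp: Q_def\<close>)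
  qed
  have Cl: "Cl = range Xc \<union> (\<lambda>(j, k). Uc j k) ` (UNIV \<times> {..l})" by (auto simp: Cl_def)
  have finCl: "finite Cl" unfolding Cl by simp
  have "card (range (Xc :: 'n \<Rightarrow> ('n, 'm) coord)) = CARD('n)" by (rule card_image) (auto simp: inj_on_def)
  moreover have "card ((\<lambda>(j, k). Uc j k :: ('n, 'm) coord) ` (UNIV \<times> {..l})) = m * (l + 1)"
    by (subst card_image) (auto simp: inj_on_def m_card card_cartesian_product)
  ultimately have cardCl: "card Cl = CARD('n) + m * (l + 1)"
    unfolding Cl by (subst card_Un_disjoint) auto
  have "\<forall>c\<in>Cl. \<exists>h. \<forall>x. (if x = c then 1 else 0) = (\<Sum>q\<in>Q. h q * ?a q x)"
    using span unfolding lin_span_def by blast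
  then obtain h where h: "\<And>c x. c \<in> Cl \<Longrightarrow> (if x = c then 1 else 0) = (\<Sum>q\<in>Q. h c q * ?a q x)" by metis
  have "card Cl \<le> card Q"
  proof (rule card_le_of_factorization[OF finCl, where a = h and b = ?a])
    show "(\<Sum>k\<in>Q. h i k * partial j (y k) z) = (if i = j then 1 else 0)" if "i \<in> Cl" "j \<in> Cl" for i j
      using h[OF that(1), of j] by auto
  qed (simp add: Q_def)
  moreover have "card Q + (r + l + 1 - s) \<le> T"
  proof -
    \<comment> \<open>Since s + k * m \<le> (k + s) * m, at least r + l + 1 - s dependent indices
      lie below \<open>T\<close>.\<close>
    have sub: "(\<lambda>k. s + k * m) ` {..<r + l + 1 - s} \<subseteq> E \<inter> {..<T}"
    proof
      fix t assume "t \<in> (\<lambda>k. s + k * m) ` {..<r + l + 1 - s}"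
      then obtain k where "t = s + k * m" "k < r + l + 1 - s" by blast
      then have k: "t = s + k * m" "k + s + 1 \<le> r + l + 1" by auto
      have "t \<le> (k + s) * m" using m_pos k(1) by (simp add: distrib_right)
      also have "\<dots> < (k + s + 1) * m" using m_pos by simp
      also have "\<dots> \<le> T" unfolding T_def using k(2) by (simp only: mult.commute[of _ m] mult_le_mono2)
      finally show "t \<in> E \<inter> {..<T}" using k(1) by (auto simp: E_def)
    qed
    have "r + l + 1 - s = card ((\<lambda>k. s + k * m) ` {..<r + l + 1 - s})"
      using m_pos by (subst card_image) (auto simp: inj_on_def)
    also have "\<dots> \<le> card (E \<inter> {..<T})" by (rule card_mono[OF _ sub]) simp
    finally have "r + l + 1 - s \<le> card (E \<inter> {..<T})" .
    moreover have "card Q + card (E \<inter> {..<T}) = T"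
      unfolding Q_def by (subst card_Un_disjoint[symmetric]) (auto intro: arg_cong[where f = card, of _ "{..<T}", simplified])
    ultimately show ?thesis by simp
  qed
  ultimately have "CARD('n) + m * (l + 1) + (r + l + 1 - s) \<le> m * (r + l + 1)"
    unfolding cardCl T_def by linarith
  then show False unfolding l_def by (simp add: algebra_simps)
qed

text \<open>A greedy selection that starts from nothing cannot skip an index, because a skipped one
  would be a dependence excluded by \<open>no_dependence\<close>.\<close>

lemma generically_independent:
  assumes U: "open U" "U \<subseteq> W" "U \<noteq> {}"
  shows "\<exists>U' C v. open U' \<and> U' \<noteq> {} \<and> U' \<subseteq> U \<and> dual_system U' (Inr ` {..<N}) \<omega> C v"
proof -
  have "dual_system U {} \<omega> {} (\<lambda>_ _ _. 0)" by (simp add: dual_system_def)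
  from dual_system_greedy[OF U(1,3) this _ _ smooth_on_subset[OF smooth_\<omega> U(2)], of Inr N]
  obtain U' B C v where U': "open U'" "U' \<noteq> {}" "U' \<subseteq> U" "B \<subseteq> {..<N}" "dual_system U' (Inr ` B) \<omega> C v"
    and dep: "\<forall>s<N. s \<notin> B \<longrightarrow> smooth_span U' (Inr ` (B \<inter> {..<s})) \<omega> (\<omega> (Inr s))" by auto
  have "s \<in> B" if "s < N" for s
  proof (rule ccontr)
    assume "s \<notin> B"
    with dep that have "smooth_span U' (Inr ` (B \<inter> {..<s})) \<omega> (\<omega> (Inr s))" by blast
    then have "smooth_span U' (Inr ` {..<s}) \<omega> (\<omega> (Inr s))" by (rule smooth_span_mono) auto
    with no_dependence[of U' s] U' U(2) show False by blast
  qed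
  then have "B = {..<N}" using U'(4) by auto
  with U' show ?thesis by blast
qed

lemma dual_system_states:
  "dual_system U (range Inl) \<omega> (range Xc) (\<lambda>b c z. if c = (case b of Inl i \<Rightarrow> Xc i) then 1 else 0)"
  unfolding dual_system_def pairing_def
  by (auto simp: sum.reindex inj_on_def if_distrib[where f = "\<lambda>x. x * _"] cong: if_cong)

text \<open>The first dual system certifies all outputs below \<open>N\<close>, the second dx with
  the selected ones. \<open>dependence_shift_down\<close>, read contrapositively, closes the
  selection under time derivatives.\<close>

lemma generic_selection:
  assumes U: "open U" "U \<subseteq> W" "U \<noteq> {}"
  shows "\<exists>U' B C v C' v'. open U' \<and> U' \<noteq> {} \<and> U' \<subseteq> U \<and> B \<subseteq> {..<N} \<and>
    dual_system U' (Inr ` {..<N}) \<omega> C v \<and> dual_system U' (range Inl \<union> Inr ` B) \<omega> C' v' \<and>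
    (\<forall>s. s \<in> B \<longrightarrow> s + m < N \<longrightarrow> s + m \<in> B) \<and> N \<le> CARD('n) + card B"
proof -
  obtain U1 C v where U1: "open U1" "U1 \<noteq> {}" "U1 \<subseteq> U" and dual1: "dual_system U1 (Inr ` {..<N}) \<omega> C v"
    using generically_independent[OF U] by blast
  have "U1 \<subseteq> W" using U1 U by blast
  note sm = smooth_on_subset[OF smooth_\<omega> this]
  have "Inr s \<notin> range Inl" for s :: nat by auto
  from dual_system_greedy[OF U1(1,2) dual_system_states inj_Inr this sm, of N]
  obtain U' B C' v' where U': "open U'" "U' \<noteq> {}" "U' \<subseteq> U1" "B \<subseteq> {..<N}"
    and dual: "dual_system U' (range Inl \<union> Inr ` B) \<omega> C' v'"
    and dep: "\<forall>s<N. s \<notin> B \<longrightarrow> smooth_span U' (range Inl \<union> Inr ` (B \<inter> {..<s})) \<omega> (\<omega> (Inr s))"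
    by blast
  have U'W: "U' \<subseteq> W" using U' U1 U by blast
  obtain z where z: "z \<in> U'" using U'(2) by blast
  have finB: "finite B" using U'(4) finite_subset by blast
  have "s + m \<in> B" if s: "s \<in> B" "s + m < N" for s
  proof (rule ccontr)
    assume "s + m \<notin> B"
    with dep s have "smooth_span U' (range Inl \<union> Inr ` (B \<inter> {..<s + m})) \<omega> (\<omega> (Inr (s + m)))" by blast
    then have "smooth_span U' (range Inl \<union> Inr ` {..<s + m}) \<omega> (\<omega> (Inr (s + m)))"
      by (rule smooth_span_mono) auto
    from dependence_shift_down[OF U'(1) U'W this]
    have "lin_span (range Inl \<union> Inr ` {..<s}) (\<lambda>b c. \<omega> b c z) (\<lambda>c. \<omega> (Inr s) c z)"
      by (rule smooth_span_imp_lin_span[OF _ z])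
    \<comment> \<open>The field dual to dy(s) annihilates dx and what was selected before
      \<open>s\<close>, hence also the skipped forms in between. A relation for dy(s) would make it
      annihilate dy(s) as well.\<close>
    moreover have zB: "pairing C' (v' (Inr s)) (\<omega> b) z = 0" if "b \<in> range Inl \<union> Inr ` (B \<inter> {..<s})" for b
    proof -
      have b: "b \<in> range Inl \<union> Inr ` B" "Inr s \<in> range Inl \<union> Inr ` B" "Inr s \<noteq> b" using that s by auto
      from dual_system_pairing[OF dual b(2,1) z] b(3) show ?thesis by simp
    qed
    moreover have "pairing C' (v' (Inr s)) (\<omega> b) z = 0" if b: "b \<in> range Inl \<union> Inr ` {..<s}" for b
    proof (cases "b \<in> range Inl \<union> Inr ` (B \<inter> {..<s})")
      case False
      then obtain t where t: "b = Inr t" "t < s" "t \<notin> B" using b by auto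
      then have "smooth_span U' (range Inl \<union> Inr ` (B \<inter> {..<t})) \<omega> (\<omega> (Inr t))"
        using dep s by auto
      from smooth_span_imp_lin_span[OF this z] show ?thesis
        unfolding t(1) by (rule pairing_lin_span_zero, intro zB) (use t(2) in auto)
    qed (rule zB)
    ultimately have "pairing C' (v' (Inr s)) (\<omega> (Inr s)) z = 0" by (rule_tac pairing_lin_span_zero)
    moreover have "pairing C' (v' (Inr s)) (\<omega> (Inr s)) z = 1"
      using dual_system_pairing[OF dual _ _ z] s(1) by auto
    ultimately show False by simp
  qed
  \<comment> \<open>Each form below \<open>N\<close> is selected or a combination of dx and selected
    ones, while all \<open>N\<close> of them are independent.\<close>
  moreover have "card (Inr ` {..<N} :: ('n + nat) set) \<le> card (range Inl \<union> Inr ` B :: ('n + nat) set)"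
  proof (rule card_le_of_dual_system[OF dual1, of z])
    fix b :: "'n + nat" assume "b \<in> Inr ` {..<N}"
    then obtain s where s: "b = Inr s" "s < N" by blast
    show "lin_span (range Inl \<union> Inr ` B) (\<lambda>k c. \<omega> k c z) (\<lambda>c. \<omega> b c z)"
    proof (cases "s \<in> B")
      case True
      then show ?thesis unfolding s(1) using finB by (intro lin_span_base) auto
    next
      case False
      with dep s have "smooth_span U' (range Inl \<union> Inr ` (B \<inter> {..<s})) \<omega> (\<omega> (Inr s))" by blast
      from smooth_span_imp_lin_span[OF this z] show ?thesis
        unfolding s(1) by (rule lin_span_mono) (use finB in auto)
    qed
  qed (use z U' finB in auto)
  then have "N \<le> CARD('n) + card B"
    by (simp add: card_image_Inl_Inr[OF finB] card_image)
  moreover have "dual_system U' (Inr ` {..<N}) \<omega> C v" by (rule dual_system_subset[OF dual1 U'(3)]) simp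
  ultimately show ?thesis using U'(1,2,4) dual U'(3) U1(3) by blast
qed

text \<open>Once the outputs in \<open>T\<close> span dx, the independent family of dx and the
  selected members of \<open>T\<close> lies in their span. With all indices this helps to fix
  |\<kappa>|, with the orders below R it bounds \<kappa>.\<close>

lemma card_selected_le:
  assumes dual: "dual_system U' (range Inl \<union> Inr ` B) \<omega> C' v'" and z: "z \<in> U'" "z \<in> W" and T: "finite T"
    and span: "\<And>i. lin_span T (\<lambda>t x. partial x (y t) z) (\<lambda>x. if x = Xc i then 1 else 0)"
  shows "CARD('n) + card (B \<inter> T) \<le> card T"
proof -
  have "card (range Inl \<union> Inr ` (B \<inter> T) :: ('n + nat) set) \<le> card (Inr ` T :: ('n + nat) set)"
  proof (rule card_le_of_dual_system[OF dual_system_subset[OF dual subset_refl] z(1)])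
    show "(range Inl \<union> Inr ` (B \<inter> T) :: ('n + nat) set) \<subseteq> range Inl \<union> Inr ` B" by auto
    fix b :: "'n + nat" assume "b \<in> range Inl \<union> Inr ` (B \<inter> T)"
    then consider i where "b = Inl i" | t where "b = Inr t" "t \<in> T" by blast
    then show "lin_span (Inr ` T) (\<lambda>k c. \<omega> k c z) (\<lambda>c. \<omega> b c z)"
    proof cases
      case (1 i)
      have "lin_span T (\<lambda>t. (\<lambda>k c. \<omega> k c z) (Inr t)) (\<lambda>x. if x = Xc i then 1 else 0)"
        using span[of i] by simp
      from lin_span_image[of T "\<lambda>k c. \<omega> k c z" Inr, OF this T] show ?thesis using 1 by simp
    next
      case (2 t)
      then show ?thesis using T by (intro lin_span_base) auto
    qed
  qed (use T in auto)
  then show ?thesis using T by (simp add: card_image_Inl_Inr card_image)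
qed

end

section \<open>Output jets, with the shift as time derivative, and the prolonged
  parameterization\<close>

definition shift_field :: "'m \<times> nat \<Rightarrow> ('m \<times> nat \<Rightarrow> real) \<Rightarrow> real" where
  "shift_field p y = y (fst p, Suc (snd p))"

lemma smooth_on_shift_field [simp]: "smooth_on S (shift_field p)"
  unfolding shift_field_def[abs_def] by simp

definition order_le :: "('m \<Rightarrow> nat) \<Rightarrow> ('m \<times> nat) set" where
  "order_le R = {(j, \<beta>). \<beta> \<le> R j}"

definition order_less :: "('m \<Rightarrow> nat) \<Rightarrow> ('m \<times> nat) set" where
  "order_less R = {(j, \<beta>). \<beta> < R j}"

lemma order_simps [simp]: "(j, \<beta>) \<in> order_le R \<longleftrightarrow> \<beta> \<le> R j" "(j, \<beta>) \<in> order_less R \<longleftrightarrow> \<beta> < R j"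
  by (simp_all add: order_le_def order_less_def)

lemma finite_order [simp]:
  fixes R :: "'m::finite \<Rightarrow> nat"
  shows "finite (order_le R)" "finite (order_less R)"
proof -
  have "order_le R = Sigma UNIV (\<lambda>j. {..R j})" "order_less R = Sigma UNIV (\<lambda>j. {..<R j})"
    by (auto simp: order_le_def order_less_def)
  then show "finite (order_le R)" "finite (order_less R)" by auto
qed

lemma card_order_less:
  fixes R :: "'m::finite \<Rightarrow> nat"
  shows "card (order_less R) = (\<Sum>j\<in>UNIV. R j)"
proof -
  have "order_less R = Sigma UNIV (\<lambda>j. {..<R j})" by (auto simp: order_less_def)
  then show ?thesis by simp
qed

locale flat_system =
  fixes f :: "real ^ 'n \<Rightarrow> real ^ 'm \<Rightarrow> real ^ 'n"
    and \<phi> :: "real ^ 'n \<Rightarrow> real ^ 'm \<Rightarrow> real ^ 'm"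
    and W :: "('n::finite, 'm::finite) jet set"
    and Y :: "('m \<times> nat \<Rightarrow> real) set"
    and R :: "'m \<Rightarrow> nat"
    and Fx :: "('m \<times> nat \<Rightarrow> real) \<Rightarrow> real ^ 'n"
    and Fu :: "('m \<times> nat \<Rightarrow> real) \<Rightarrow> real ^ 'm"
  assumes system: "smooth_system f W"
    and flat: "flat_parameterization f (xu_output \<phi>) W Y R Fx Fu"
begin

abbreviation "X \<equiv> jet_field (open_loop f)"
abbreviation "\<Phi> \<equiv> output_jet f (xu_output \<phi>)"

lemma open_W: "open W" and smooth_f: "smooth_on W (\<lambda>z. open_loop f z $ i)"
  using system unfolding smooth_system_def by auto

lemma open_Y: "open Y" and smooth_Fx: "smooth_on Y (\<lambda>y. Fx y $ i)" and smooth_Fu: "smooth_on Y (\<lambda>y. Fu y $ j)"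
  and depends_Fx: "depends_on (order_less R) Y Fx" and depends_Fu: "depends_on (order_le R) Y Fu"
  using flat unfolding flat_parameterization_def order_le_def order_less_def by auto

lemma \<Phi>_Y: "z \<in> W \<Longrightarrow> \<Phi> z \<in> Y" and Fx_\<Phi>: "z \<in> W \<Longrightarrow> Fx (\<Phi> z) = state z" and Fu_\<Phi>: "z \<in> W \<Longrightarrow> Fu (\<Phi> z) = inp z"
  using flat unfolding flat_parameterization_def by auto

lemma \<Phi>_0: "\<Phi> z (j, 0) = \<phi> (state z) (inp z) $ j"
  by (simp add: output_jet_def xu_output_def)

lemma \<Phi>_Suc: "(\<lambda>z. \<Phi> z (j, Suc \<beta>)) = lie (open_loop f) (\<lambda>z. \<Phi> z (j, \<beta>))"
  by (simp add: output_jet_def)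

lemma smooth_\<Phi>: "smooth_on W (\<lambda>z. \<Phi> z p)"
proof -
  have "smooth_on W (\<lambda>z. \<Phi> z (j, \<beta>))" for j \<beta>
  proof (induction \<beta>)
    case 0
    then show ?case using flat unfolding flat_parameterization_def by (simp add: output_jet_def)
  next
    case (Suc \<beta>)
    then show ?case unfolding \<Phi>_Suc by (rule smooth_on_lie[OF open_W smooth_f])
  qed
  then show ?thesis by (cases p) simp
qed

lemma vderiv_\<Phi>: "z \<in> W \<Longrightarrow> vderiv X (\<lambda>z. \<Phi> z p) z = shift_field p (\<Phi> z)"
  using lie_eq_vderiv[OF open_W _ smooth_\<Phi>, of z "open_loop f" p] fun_cong[OF \<Phi>_Suc[of "fst p" "snd p"], of z]
  by (simp add: shift_field_def)

text \<open>The parameterization prolonged to all input derivatives by differentiating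
  \<open>Fu\<close> along the shift. It is a left inverse of \<open>\<Phi>\<close> on
  \<open>W\<close>; a two-sided one only on realizable sets.\<close>

definition \<Xi> :: "('m \<times> nat \<Rightarrow> real) \<Rightarrow> ('n, 'm) jet" where
  "\<Xi> y c = (case c of Xc i \<Rightarrow> Fx y $ i | Uc j k \<Rightarrow> (vderiv shift_field ^^ k) (\<lambda>y. Fu y $ j) y)"

lemma \<Xi>_simps: "\<Xi> y (Xc i) = Fx y $ i" "\<Xi> y (Uc j 0) = Fu y $ j"
  "(\<lambda>y. \<Xi> y (Uc j (Suc k))) = vderiv shift_field (\<lambda>y. \<Xi> y (Uc j k))"
  by (simp_all add: \<Xi>_def)

lemma smooth_\<Xi>: "smooth_on Y (\<lambda>y. \<Xi> y c)"
proof (cases c)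
  case (Xc i)
  then show ?thesis using smooth_Fx by (simp add: \<Xi>_simps)
next
  case (Uc j k)
  have "smooth_on Y (\<lambda>y. \<Xi> y (Uc j k))" for k
  proof (induction k)
    case 0
    then show ?case using smooth_Fu by (simp add: \<Xi>_simps)
  next
    case (Suc k)
    then show ?case unfolding \<Xi>_simps by (rule smooth_on_vderiv[OF open_Y smooth_on_shift_field])
  qed
  then show ?thesis using Uc by simp
qed

lemma depends_Fx_component: "depends_on (order_less R) Y (\<lambda>y. Fx y $ i)"
  by (rule depends_on_apply[OF depends_Fx])

lemma depends_\<Xi>_input: "depends_on (order_le (\<lambda>j. R j + k)) Y (\<lambda>y. \<Xi> y (Uc j k))"
proof (induction k)
  case 0
  show ?case using depends_on_apply[OF depends_Fu] by (simp add: \<Xi>_simps)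
next
  case (Suc k)
  show ?case unfolding \<Xi>_simps
    by (rule depends_on_vderiv[OF open_Y Suc]) (auto simp: depends_on_def shift_field_def)
qed

lemma vderiv_\<Phi>_compose:
  assumes "smooth_on Y h" "z \<in> W"
  shows "vderiv X (\<lambda>z. h (\<Phi> z)) z = vderiv shift_field h (\<Phi> z)"
  by (rule vderiv_compose[where F = \<Phi> and X' = shift_field, OF open_W smooth_\<Phi> open_Y \<Phi>_Y assms
        vderiv_\<Phi>[OF assms(2)]])

lemma \<Xi>_\<Phi>: "z \<in> W \<Longrightarrow> \<Xi> (\<Phi> z) = z"
proof
  fix c
  assume z: "z \<in> W"
  show "\<Xi> (\<Phi> z) c = z c"
  proof (cases c)
    case (Xc i)
    then show ?thesis using z by (simp add: \<Xi>_simps Fx_\<Phi> state_def)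
  next
    case (Uc j k)
    have "\<Xi> (\<Phi> z) (Uc j k) = z (Uc j k)" if "z \<in> W" for z k
      using that
    proof (induction k arbitrary: z)
      case 0
      then show ?case by (simp add: \<Xi>_simps Fu_\<Phi> inp_def)
    next
      case (Suc k)
      have "\<Xi> (\<Phi> z) (Uc j (Suc k)) = vderiv shift_field (\<lambda>y. \<Xi> y (Uc j k)) (\<Phi> z)"
        using fun_cong[OF \<Xi>_simps(3)] by simp
      also have "\<dots> = vderiv X (\<lambda>z. \<Xi> (\<Phi> z) (Uc j k)) z"
        by (rule vderiv_\<Phi>_compose[OF smooth_\<Xi> Suc.prems, symmetric])
      also have "\<dots> = vderiv X (\<lambda>z. z (Uc j k)) z"
        by (rule vderiv_cong[OF open_W Suc.prems Suc.IH])
      finally show ?case by simp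
    qed
    with z Uc show ?thesis by simp
  qed
qed

text \<open>Differentiating \<Xi> after \<Phi> = identity writes each coordinate differential
  through output differentials, those on which that component of \<Xi> depends.\<close>

lemma coordinate_lin_span:
  assumes z: "z \<in> W" and P: "finite P" "depends_on P Y (\<lambda>y. \<Xi> y c)"
  shows "lin_span P (\<lambda>p x. partial x (\<lambda>z. \<Phi> z p) z) (\<lambda>x. if x = c then 1 else 0)"
proof -
  have "(if x = c then 1 else 0) = (\<Sum>p\<in>P. partial p (\<lambda>y. \<Xi> y c) (\<Phi> z) * partial x (\<lambda>z. \<Phi> z p) z)" for x
  proof -
    have "(if x = c then 1 else 0) = partial x (\<lambda>z. z c) z" by (simp add: partial_coordinate)
    also have "\<dots> = partial x (\<lambda>z. \<Xi> (\<Phi> z) c) z"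
      by (rule partial_cong[OF open_W z]) (simp add: \<Xi>_\<Phi>)
    also have "\<dots> = (\<Sum>p\<in>P. partial p (\<lambda>y. \<Xi> y c) (\<Phi> z) * partial x (\<lambda>z. \<Phi> z p) z)"
      by (rule partial_compose[OF open_W smooth_\<Phi> open_Y \<Phi>_Y smooth_\<Xi> P z])
    finally show ?thesis .
  qed
  then show ?thesis unfolding lin_span_def
    by (intro exI[of _ "\<lambda>p. partial p (\<lambda>y. \<Xi> y c) (\<Phi> z)"]) blast
qed

definition outputs_independent :: "('n, 'm) jet \<Rightarrow> bool" where
  "outputs_independent z \<longleftrightarrow> (\<forall>a. (\<forall>x. (\<Sum>p\<in>order_le R. a p * partial x (\<lambda>z. \<Phi> z p) z) = 0) \<longrightarrow>
     (\<forall>p\<in>order_le R. a p = 0))"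

text \<open>No nonzero combination of dx lies in the span of the d\<phi>^j_[\<beta>] with \<kappa>^j
  \<le> \<beta> < r^j. In this form it says that Fx can be solved for the orders below
  \<kappa>.\<close>

definition states_independent :: "('m \<Rightarrow> nat) \<Rightarrow> ('n, 'm) jet \<Rightarrow> bool" where
  "states_independent \<kappa> z \<longleftrightarrow> (\<forall>a b. (\<forall>x. (\<Sum>i\<in>UNIV. a i * (if x = Xc i then 1 else 0))
       + (\<Sum>p\<in>order_less R - order_less \<kappa>. b p * partial x (\<lambda>z. \<Phi> z p) z) = 0) \<longrightarrow> (\<forall>i. a i = 0))"

text \<open>The selection made for the flattened sequence is read back component by component:
  \<open>ix\<close> and \<open>dec\<close> translate between pairs and positions.\<close>

lemma generic_indices:
  assumes U: "open U" "U \<subseteq> W" "U \<noteq> {}"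
  shows "\<exists>z0\<in>U. \<exists>\<kappa>. \<kappa> \<le> R \<and> (\<Sum>j\<in>UNIV. \<kappa> j) = CARD('n) \<and>
    outputs_independent z0 \<and> states_independent \<kappa> z0"
proof -
  define m where "m = CARD('m)"
  have m: "m > 0" by (simp add: m_def)
  obtain e :: "'m \<Rightarrow> nat" where e: "bij_betw e UNIV {0..<m}"
    using ex_bij_betw_finite_nat[of "UNIV :: 'm set"] by (auto simp: m_def)
  have e_less: "e j < m" for j using bij_betwE[OF e] by simp
  have e_inj: "inj e" using e by (simp add: bij_betw_def)
  define ix where "ix p = snd p * m + e (fst p)" for p
  define dec where "dec s = (inv e (s mod m), s div m)" for s
  have dec_ix: "dec (ix p) = p" for p
    using e_less[of "fst p"] by (simp add: dec_def ix_def inv_f_f[OF e_inj])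
  have e_surj: "e (inv e s) = s" if "s < m" for s
    by (rule f_inv_into_f) (use e that in \<open>auto simp: bij_betw_def\<close>)
  have ix_dec: "ix (dec s) = s" for s
    using m by (simp add: dec_def ix_def e_surj)
  have ix_inj: "inj_on ix A" for A using dec_ix by (metis inj_onI)
  define \<psi> where "\<psi> s z = \<Phi> z (dec s)" for s z
  have \<psi>_ix: "\<psi> (ix p) = (\<lambda>z. \<Phi> z p)" for p by (simp add: \<psi>_def[abs_def] dec_ix)
  \<comment> \<open>A common bound of all \<open>R j\<close>, so that the selection can work on the
    full block of orders up to \<open>r\<close>.\<close>
  define r where "r = (\<Sum>j\<in>UNIV. R j)"
  have Rr: "R j \<le> r" for j unfolding r_def by (rule member_le_sum) auto
  have ix_less: "ix (j, \<beta>) < m * (l + 1) \<longleftrightarrow> \<beta> \<le> l" for j \<beta> l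
  proof
    assume "\<beta> \<le> l"
    have "ix (j, \<beta>) < (\<beta> + 1) * m" using e_less[of j] by (simp add: ix_def)
    also have "\<dots> \<le> m * (l + 1)" using \<open>\<beta> \<le> l\<close> by (simp add: mult.commute[of m])
    finally show "ix (j, \<beta>) < m * (l + 1)" .
  next
    assume "ix (j, \<beta>) < m * (l + 1)"
    then have "\<beta> * m < (l + 1) * m" by (simp add: ix_def mult.commute)
    then have "\<beta> < l + 1" by (simp only: mult_less_cancel2)
    then show "\<beta> \<le> l" by simp
  qed
  have lin_span_ix: "lin_span (ix ` P) (\<lambda>t x. partial x (\<psi> t) z) \<eta>"
    if "lin_span P (\<lambda>p x. partial x (\<lambda>z. \<Phi> z p) z) \<eta>" "finite P" for P z \<eta>
    by (rule lin_span_image) (use that in \<open>simp_all add: \<psi>_ix\<close>)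
  interpret seq: flat_output_sequence f W \<psi> m r
  proof
    show "open W" "0 < m" "m = CARD('m)" by (simp_all add: open_W m m_def)
    show "smooth_on W (\<lambda>z. open_loop f z $ i)" for i by (rule smooth_f)
    show "smooth_on W (\<psi> s)" for s unfolding \<psi>_def[abs_def] by (rule smooth_\<Phi>)
    show "lie (open_loop f) (\<psi> s) z = \<psi> (s + m) z" for s z
      using fun_cong[OF \<Phi>_Suc[of "inv e (s mod m)" "s div m"], of z] m by (simp add: \<psi>_def[abs_def] dec_def)
    show "partial (Uc j (Suc k)) (\<psi> s) z = 0" if "s < m" "z \<in> W" for s j k z
    proof (rule partial_zero[OF open_W that(2)])
      show "depends_on (range Xc \<union> range (\<lambda>j. Uc j 0)) W (\<psi> s)"
        using depends_on_state_inp[of W "\<lambda>x u. \<phi> x u $ inv e s"] that(1)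
        by (simp add: \<psi>_def[abs_def] dec_def \<Phi>_0)
    qed auto
    show "lin_span {..<m * (r + l + 1)} (\<lambda>t x. partial x (\<psi> t) z) (\<lambda>x. if x = c then 1 else 0)"
      if z: "z \<in> W" and c: "c \<in> range Xc \<union> {Uc j k | j k. k \<le> l}" for c l z
    proof (rule lin_span_mono)
      have "depends_on (order_le (\<lambda>j. R j + l)) Y (\<lambda>y. \<Xi> y c)"
      proof (cases c)
        case (Xc i)
        then show ?thesis using depends_Fx_component[of i]
          by (auto simp: \<Xi>_simps order_le_def order_less_def elim!: depends_on_mono)
      next
        case (Uc j k)
        then have "k \<le> l" using c by auto
        then show ?thesis using depends_\<Xi>_input[of k j] Uc
          by (auto simp: order_le_def elim!: depends_on_mono)
      qed
      from lin_span_ix[OF coordinate_lin_span[OF z _ this]]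
      show "lin_span (ix ` order_le (\<lambda>j. R j + l)) (\<lambda>t x. partial x (\<psi> t) z) (\<lambda>x. if x = c then 1 else 0)" by simp
      show "ix ` order_le (\<lambda>j. R j + l) \<subseteq> {..<m * (r + l + 1)}"
        using Rr ix_less[of _ _ "r + l"] by (force simp: order_le_def intro: order_trans)
    qed simp
  qed
  define N where "N = m * (r + 1)"
  obtain U' B C v C' v' where U': "open U'" "U' \<noteq> {}" "U' \<subseteq> U" and BN: "B \<subseteq> {..<N}"
    and dual1: "dual_system U' (Inr ` {..<N}) seq.\<omega> C v"
    and dual2: "dual_system U' (range Inl \<union> Inr ` B) seq.\<omega> C' v'"
    and up: "\<And>s. s \<in> B \<Longrightarrow> s + m < N \<Longrightarrow> s + m \<in> B" and card_ge: "N \<le> CARD('n) + card B"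
    using seq.generic_selection[OF U, of N] by blast
  obtain z0 where z0: "z0 \<in> U'" using U'(2) by blast
  have z0W: "z0 \<in> W" using z0 U' U by blast
  \<comment> \<open>The default r + 1 stands for a component with no selected order up to
    \<open>r\<close>; \<kappa> \<le> R excludes it afterwards, since R j \<le> r.\<close>
  define \<kappa> where "\<kappa> j = (LEAST \<beta>. \<beta> = r + 1 \<or> ix (j, \<beta>) \<in> B)" for j
  have \<kappa>_le: "\<kappa> j \<le> r + 1" for j unfolding \<kappa>_def by (rule Least_le) simp
  \<comment> \<open>Closure of \<open>B\<close> under adding \<open>m\<close> makes the selected
    orders of each component an interval that ends at \<open>r\<close>.\<close>
  have B_iff: "ix (j, \<beta>) \<in> B \<longleftrightarrow> \<kappa> j \<le> \<beta> \<and> \<beta> \<le> r" for j \<beta>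
  proof
    assume "ix (j, \<beta>) \<in> B"
    then show "\<kappa> j \<le> \<beta> \<and> \<beta> \<le> r"
      using BN ix_less[of j \<beta> r] unfolding \<kappa>_def N_def by (auto intro: Least_le)
  next
    assume \<beta>: "\<kappa> j \<le> \<beta> \<and> \<beta> \<le> r"
    have "\<kappa> j = r + 1 \<or> ix (j, \<kappa> j) \<in> B"
      unfolding \<kappa>_def by (rule LeastI[of _ "r + 1"]) simp
    with \<beta> have base: "ix (j, \<kappa> j) \<in> B" by auto
    have "\<beta> \<le> r \<Longrightarrow> ix (j, \<beta>) \<in> B" using conjunct1[OF \<beta>]
    proof (induction rule: dec_induct)
      case base
      then show ?case using \<open>ix (j, \<kappa> j) \<in> B\<close> by simp
    next
      case (step \<beta>)
      have "ix (j, Suc \<beta>) = ix (j, \<beta>) + m" by (simp add: ix_def)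
      moreover have "ix (j, Suc \<beta>) < N" using ix_less[of j "Suc \<beta>" r] step.prems by (simp add: N_def)
      ultimately show ?case using up[of "ix (j, \<beta>)"] step by simp
    qed
    with \<beta> show "ix (j, \<beta>) \<in> B" by blast
  qed
  have B_card: "card (B \<inter> ix ` order_less (\<lambda>j. S j)) = (\<Sum>j\<in>UNIV. S j - \<kappa> j)"
    if "\<And>j. S j \<le> r + 1" for S
  proof -
    have "B \<inter> ix ` order_less S = ix ` Sigma UNIV (\<lambda>j. {\<kappa> j..<S j})"
    proof (intro subset_antisym subsetI)
      fix t assume "t \<in> B \<inter> ix ` order_less S"
      then obtain j \<beta> where "t = ix (j, \<beta>)" "\<beta> < S j" "ix (j, \<beta>) \<in> B" by auto
      then show "t \<in> ix ` Sigma UNIV (\<lambda>j. {\<kappa> j..<S j})" using B_iff by auto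
    next
      fix t assume "t \<in> ix ` Sigma UNIV (\<lambda>j. {\<kappa> j..<S j})"
      then obtain j \<beta> where t: "t = ix (j, \<beta>)" "\<kappa> j \<le> \<beta>" "\<beta> < S j" by auto
      then have "\<beta> \<le> r" using that[of j] by linarith
      with t show "t \<in> B \<inter> ix ` order_less S" using B_iff by auto
    qed
    then show ?thesis by (simp add: card_image[OF ix_inj])
  qed
  have all: "ix ` order_less (\<lambda>_. r + 1) = {..<N}"
  proof (intro subset_antisym subsetI)
    fix t assume "t \<in> {..<N}"
    moreover obtain j \<beta> where jb: "dec t = (j, \<beta>)" by (cases "dec t")
    then have "t = ix (j, \<beta>)" using ix_dec[of t] by simp
    ultimately show "t \<in> ix ` order_less (\<lambda>_. r + 1)" using ix_less[of j \<beta> r] by (auto simp: N_def)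
  next
    fix t assume "t \<in> ix ` order_less (\<lambda>_. r + 1)"
    then obtain j \<beta> where "t = ix (j, \<beta>)" "\<beta> < r + 1" by auto
    then show "t \<in> {..<N}" using ix_less[of j \<beta> r] by (simp add: N_def)
  qed
  have cardB: "card B = (\<Sum>j\<in>UNIV. (r + 1) - \<kappa> j)"
    using B_card[of "\<lambda>_. r + 1"] BN unfolding all by (simp add: Int_absorb2)
  have sumN: "(\<Sum>j\<in>UNIV. (r + 1) - \<kappa> j) + (\<Sum>j\<in>UNIV. \<kappa> j) = N"
    unfolding sum.distrib[symmetric] using \<kappa>_le by (simp add: N_def m_def)
  have span: "lin_span (ix ` order_less R) (\<lambda>t x. partial x (\<psi> t) z0) (\<lambda>x. if x = Xc i then 1 else 0)" for i
    by (rule lin_span_ix[OF coordinate_lin_span[OF z0W]]) (simp_all add: \<Xi>_simps depends_Fx_component)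
  have sub: "ix ` order_less R \<subseteq> {..<N}"
    unfolding all[symmetric] using Rr by (auto intro!: imageI simp: order_less_def less_Suc_eq_le intro: order.trans less_imp_le)
  \<comment> \<open>With \<open>card_ge\<close> this gives N = n + card B; as \<open>B\<close> holds
    r + 1 - \<kappa> j orders of component \<open>j\<close>, the sum of \<kappa> is n.\<close>
  have "CARD('n) + card (B \<inter> {..<N}) \<le> card {..<N}"
    by (rule seq.card_selected_le[OF dual2 z0 z0W _ lin_span_mono[OF span sub]]) auto
  moreover have "B \<inter> {..<N} = B" using BN by auto
  ultimately have sum\<kappa>: "(\<Sum>j\<in>UNIV. \<kappa> j) = CARD('n)" using card_ge cardB sumN by simp
  have "CARD('n) + card (B \<inter> ix ` order_less R) \<le> card (ix ` order_less R)"
    by (rule seq.card_selected_le[OF dual2 z0 z0W _ span]) simp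
  \<comment> \<open>Because of truncated subtraction each summand on the left is the maximum of
    \<kappa> j and R j, so one component with \<kappa> j > R j would violate this.\<close>
  then have le: "(\<Sum>j\<in>UNIV. \<kappa> j + (R j - \<kappa> j)) \<le> (\<Sum>j\<in>UNIV. R j)"
    using B_card[of R] Rr sum\<kappa> by (simp add: card_image[OF ix_inj] card_order_less sum.distrib le_SucI)
  have "\<kappa> j \<le> R j" for j
  proof (rule ccontr)
    assume "\<not> \<kappa> j \<le> R j"
    then have "(\<Sum>j\<in>UNIV. R j) < (\<Sum>j\<in>UNIV. \<kappa> j + (R j - \<kappa> j))"
      by (intro sum_strict_mono_ex1 bexI[of _ j]) auto
    with le show False by simp
  qed
  then have \<kappa>R: "\<kappa> \<le> R" by (simp add: le_fun_def)
  have ind1: "outputs_independent z0"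
    unfolding outputs_independent_def
  proof (intro allI impI ballI)
    fix a p assume a: "\<forall>x. (\<Sum>p\<in>order_le R. a p * partial x (\<lambda>z. \<Phi> z p) z0) = 0" and p: "p \<in> order_le R"
    define a' where "a' b = (case b of Inl _ \<Rightarrow> 0 | Inr t \<Rightarrow> a (dec t))" for b :: "'n + nat"
    have "a' (Inr (ix p)) = 0"
    proof (rule dual_system_independent[OF dual1 z0, of "Inr ` ix ` order_le R"])
      show "Inr ` ix ` order_le R \<subseteq> Inr ` {..<N}"
        using ix_less[of _ _ r] Rr by (intro image_mono) (force simp: order_le_def N_def intro: order_trans)
      show "(\<Sum>j\<in>Inr ` ix ` order_le R. a' j * seq.\<omega> j c z0) = 0" for c
        using a by (simp add: sum.reindex ix_inj a'_def dec_ix \<psi>_ix)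
    qed (use p in auto)
    then show "a p = 0" by (simp add: a'_def dec_ix)
  qed
  have ind2: "states_independent \<kappa> z0"
    unfolding states_independent_def
  proof (intro allI impI)
    fix a b i assume ab: "\<forall>x. (\<Sum>i\<in>UNIV. a i * (if x = Xc i then 1 else 0))
        + (\<Sum>p\<in>order_less R - order_less \<kappa>. b p * partial x (\<lambda>z. \<Phi> z p) z0) = 0"
    define a' where "a' k = (case k of Inl i \<Rightarrow> a i | Inr t \<Rightarrow> b (dec t))" for k :: "'n + nat"
    let ?P = "order_less R - order_less \<kappa>"
    have "a' (Inl i) = 0"
    proof (rule dual_system_independent[OF dual2 z0, of "range Inl \<union> Inr ` ix ` ?P"])
      have "ix p \<in> B" if p: "p \<in> ?P" for p
      proof -
        obtain j \<beta> where "p = (j, \<beta>)" by (cases p)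
        with p have "p = (j, \<beta>)" "\<kappa> j \<le> \<beta>" "\<beta> < R j" by auto
        with Rr[of j] B_iff[of j \<beta>] show ?thesis by simp
      qed
      then have "ix ` ?P \<subseteq> B" by blast
      then show "range Inl \<union> Inr ` ix ` ?P \<subseteq> range Inl \<union> Inr ` B" by blast
      show "(\<Sum>j\<in>range Inl \<union> Inr ` ix ` ?P. a' j * seq.\<omega> j c z0) = 0" for c
        using ab by (subst sum.union_disjoint) (auto simp: sum.reindex ix_inj a'_def dec_ix \<psi>_ix)
    qed auto
    then show "a i = 0" by (simp add: a'_def)
  qed
  show ?thesis using z0 U' \<kappa>R sum\<kappa> ind1 ind2 by blast
qed

end

section \<open>The linearizing feedback\<close>

lemma independent_differentialsI:
  assumes "\<And>z J a. z \<in> W \<Longrightarrow> finite J \<Longrightarrow> J \<subseteq> I \<Longrightarrow> \<forall>c. (\<Sum>i\<in>J. a i * partial c (h i) z) = 0 \<Longrightarrow> \<forall>i\<in>J. a i = 0"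
  shows "independent_differentials W I h"
  unfolding independent_differentials_def
proof (intro conjI allI ballI impI)
  show "g i z = 0" if "finite J \<and> J \<subseteq> I \<and> (\<forall>i\<in>J. smooth_on W (g i)) \<and>
      (\<forall>z\<in>W. \<forall>c. (\<Sum>i\<in>J. g i z * partial c (h i) z) = 0)" "i \<in> J" "z \<in> W" for J g i z
    using assms[of z J "\<lambda>i. g i z"] that by blast
qed (use assms in blast)

lemma independent_differentialsD:
  assumes "independent_differentials W I h" "z \<in> W" "finite J" "J \<subseteq> I"
    "\<forall>c. (\<Sum>i\<in>J. a i * partial c (h i) z) = 0"
  shows "\<forall>i\<in>J. a i = 0"
  by (rule assms(1)[unfolded independent_differentials_def, THEN conjunct2, THEN bspec, OF assms(2),
        THEN spec, THEN spec, THEN mp]) (intro conjI assms(3-5))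

lemma independent_differentials_reindex:
  assumes "open W" and ind: "independent_differentials W I h" and g: "inj_on g K" "g ` K \<subseteq> I"
    and eq: "\<And>k z. k \<in> K \<Longrightarrow> z \<in> W \<Longrightarrow> h' k z = h (g k) z"
  shows "independent_differentials W K h'"
proof (rule independent_differentialsI)
  fix z J a
  assume z: "z \<in> W" and J: "finite J" "J \<subseteq> K" and a: "\<forall>c. (\<Sum>i\<in>J. a i * partial c (h' i) z) = 0"
  have inj: "inj_on g J" using g(1) J(2) inj_on_subset by blast
  define b where "b = (\<lambda>i. a (inv_into J g i))"
  have "(\<Sum>i\<in>g ` J. b i * partial c (h i) z) = (\<Sum>i\<in>J. a i * partial c (h' i) z)" for c
    unfolding sum.reindex[OF inj]
  proof (rule sum.cong[OF refl])
    fix k assume k: "k \<in> J"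
    have "partial c (h (g k)) z = partial c (h' k) z"
      by (rule partial_cong[OF assms(1) z], rule eq[symmetric]) (use k J(2) in blast)+
    moreover have "b (g k) = a k" unfolding b_def inv_into_f_f[OF inj k] ..
    ultimately show "((\<lambda>i. b i * partial c (h i) z) \<circ> g) k = a k * partial c (h' k) z"
      unfolding comp_def by (simp only:)
  qed
  with a have "\<forall>c. (\<Sum>i\<in>g ` J. b i * partial c (h i) z) = 0" by simp
  moreover have "finite (g ` J)" "g ` J \<subseteq> I" using J g(2) by auto
  ultimately have "\<forall>i\<in>g ` J. b i = 0"
    using independent_differentialsD[OF ind z] by simp
  then have "b (g k) = 0" if "k \<in> J" for k using that by blast
  then show "\<forall>k\<in>J. a k = 0" unfolding b_def using inv_into_f_f[OF inj] by metis
qed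

text \<open>Differentiating B after A = identity shows that the Jacobian of \<open>A\<close> is
  right inverse to that of \<open>B\<close>. A finite combination meets finitely many coordinates
  \<open>E\<close>, so the matrix products are finite sums.\<close>

lemma independent_differentials_of_diffeomorphism:
  fixes A :: "('c \<Rightarrow> real) \<Rightarrow> 'd \<Rightarrow> real" and B :: "('d \<Rightarrow> real) \<Rightarrow> 'c \<Rightarrow> real"
  assumes W: "open W" "\<And>c. smooth_on W (\<lambda>z. B z c)" "\<And>z. z \<in> W \<Longrightarrow> B z \<in> V \<and> A (B z) = z"
    and V: "open V" "\<And>d. smooth_on V (\<lambda>w. A w d)" "\<And>w. w \<in> V \<Longrightarrow> A w \<in> W \<and> B (A w) = w"
  shows "independent_differentials W UNIV (\<lambda>c z. B z c)"
proof (rule independent_differentialsI, rule ballI)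
  fix z J a e
  assume z: "z \<in> W" and J: "finite J" and a: "\<forall>d. (\<Sum>c\<in>J. a c * partial d (\<lambda>z. B z c) z) = 0" and e: "e \<in> J"
  have Bz: "B z \<in> V" "A (B z) = z" using W(3)[OF z] by auto
  have "\<exists>D. finite D \<and> depends_on D W (\<lambda>z. B z c)" for c
    using smooth_on_depends[OF W(2)] by metis
  then obtain D where D: "\<And>c. finite (D c)" "\<And>c. depends_on (D c) W (\<lambda>z. B z c)" by metis
  define E where "E = (\<Union>c\<in>J. D c)"
  have E: "finite E" using D(1) J by (simp add: E_def)
  have "depends_on E W (\<lambda>z. B z c)" if "c \<in> J" for c
    by (rule depends_on_mono[OF D(2)[of c]]) (use that in \<open>auto simp: E_def\<close>)
  then have chain: "(if e = c then 1 else 0)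
      = (\<Sum>d\<in>E. partial d (\<lambda>z. B z c) z * partial e (\<lambda>w. A w d) (B z))" if "c \<in> J" for c
  proof -
    have "(if e = c then 1 else 0) = partial e (\<lambda>w. w c) (B z)" by (simp add: partial_coordinate)
    also have "\<dots> = partial e (\<lambda>w. B (A w) c) (B z)"
      by (rule partial_cong[OF V(1) Bz(1)]) (use V(3) in auto)
    also have "\<dots> = (\<Sum>d\<in>E. partial d (\<lambda>z. B z c) (A (B z)) * partial e (\<lambda>w. A w d) (B z))"
      by (rule partial_compose[OF V(1,2) W(1) _ W(2) E _ Bz(1)])
        (use V(3) that \<open>\<And>c. c \<in> J \<Longrightarrow> depends_on E W (\<lambda>z. B z c)\<close> in auto)
    finally show ?thesis unfolding Bz(2) .
  qed
  have "a e = (\<Sum>c\<in>J. a c * (if e = c then 1 else 0))" using J e by (simp add: if_distrib cong: if_cong)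
  also have "\<dots> = (\<Sum>c\<in>J. \<Sum>d\<in>E. a c * partial d (\<lambda>z. B z c) z * partial e (\<lambda>w. A w d) (B z))"
    by (intro sum.cong refl) (simp add: chain sum_distrib_left mult.assoc)
  also have "\<dots> = (\<Sum>d\<in>E. (\<Sum>c\<in>J. a c * partial d (\<lambda>z. B z c) z) * partial e (\<lambda>w. A w d) (B z))"
    by (subst sum.swap) (simp add: sum_distrib_right)
  also have "\<dots> = 0" using a by simp
  finally show "a e = 0" .
qed

section \<open>Output jets that come from the system, and the map \<Psi>\<close>

context flat_system
begin

text \<open>The parameterization constrains Fx and Fu only on the image of \<Phi>, while
  \<open>Y\<close> may contain other jets. On a realizable set the parameterized state obeys the
  system equation identically.\<close>

definition realizable :: "('m \<times> nat \<Rightarrow> real) set \<Rightarrow> bool" where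
  "realizable Z \<longleftrightarrow> open Z \<and> Z \<subseteq> Y \<and> (\<forall>y\<in>Z. \<Xi> y \<in> W \<and> \<Phi> (\<Xi> y) = y \<and>
     (\<forall>i. vderiv shift_field (\<lambda>y. Fx y $ i) y = f (Fx y) (Fu y) $ i))"

lemma state_\<Xi>: "state (\<Xi> y) = Fx y" and inp_\<Xi>: "inp (\<Xi> y) = Fu y"
  by (simp_all add: state_def inp_def \<Xi>_simps vec_eq_iff)

lemma open_realizable: "realizable Z \<Longrightarrow> Z' \<subseteq> Z \<Longrightarrow> open Z' \<Longrightarrow> realizable Z'"
  unfolding realizable_def by blast

text \<open>
  The two identities hold on the range of \<open>\<Phi>\<close> and only involve the orders up to \<open>R\<close>.  By the
  independence of the differentials, \<open>\<Phi>\<close> restricted to these orders is an open map near \<open>z0\<close>.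
\<close>

lemma realizable_exists:
  assumes z0: "z0 \<in> W"
    and ind: "outputs_independent z0"
  shows "\<exists>Z. realizable Z \<and> \<Phi> z0 \<in> Z"
proof -
  let ?P = "order_le R"
  have "\<exists>\<sigma> U V \<tau> G. coordinate_chart ?P (\<lambda>p z. \<Phi> z p) \<sigma> U V \<tau> G \<and> \<sigma> ` ?P \<subseteq> UNIV \<and> z0 \<in> U \<and> U \<subseteq> W"
    by (rule coordinate_chart_exists[OF finite_order(1) open_W z0 smooth_\<Phi>])
      (use ind in \<open>simp add: outputs_independent_def\<close>)
  then obtain \<sigma> U V \<tau> G where ch: "coordinate_chart ?P (\<lambda>p z. \<Phi> z p) \<sigma> U V \<tau> G" and U: "z0 \<in> U" "U \<subseteq> W"
    by blast
  have \<sigma>: "inj_on \<sigma> ?P" and V: "open V" and \<tau>: "\<And>z p. p \<in> ?P \<Longrightarrow> \<tau> z (\<sigma> p) = \<Phi> z p"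
    "\<And>z c. c \<notin> \<sigma> ` ?P \<Longrightarrow> \<tau> z c = z c"
    and UV: "\<And>z. z \<in> U \<Longrightarrow> \<tau> z \<in> V" "\<And>z. z \<in> U \<Longrightarrow> G (\<tau> z) = z"
    and VU: "\<And>w. w \<in> V \<Longrightarrow> G w \<in> U" "\<And>w. w \<in> V \<Longrightarrow> \<tau> (G w) = w"
    using ch unfolding coordinate_chart_def by blast+
  \<comment> \<open>Puts the orders up to R of \<open>y\<close> into the exchanged slots and keeps
    \<open>z0\<close> elsewhere; inverting the chart then gives a jet whose outputs agree with
    \<open>y\<close> up to R.\<close>
  define lift where "lift y c = (if c \<in> \<sigma> ` ?P then y (inv_into ?P \<sigma> c) else z0 c)" for y :: "'m \<times> nat \<Rightarrow> real" and c
  have "continuous_on UNIV (\<lambda>y. lift y c)" for c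
    by (cases "c \<in> \<sigma> ` ?P") (auto simp: lift_def)
  then have lift_cont: "continuous_on UNIV lift"
    by (rule continuous_on_coordinatewise_then_product)
  define N where "N = {y \<in> Y. lift y \<in> V}"
  have N: "open N" unfolding N_def
    by (rule open_vimage_on[OF open_Y V continuous_on_subset[OF lift_cont]]) simp
  have "lift (\<Phi> z0) = \<tau> z0"
  proof
    fix c
    show "lift (\<Phi> z0) c = \<tau> z0 c"
    proof (cases "c \<in> \<sigma> ` ?P")
      case True
      then obtain p where "p \<in> ?P" "c = \<sigma> p" by blast
      then show ?thesis using inv_into_f_f[OF \<sigma>] \<tau>(1) by (simp add: lift_def)
    qed (simp add: lift_def \<tau>(2))
  qed
  then have z0N: "\<Phi> z0 \<in> N" using UV(1)[OF U(1)] \<Phi>_Y[OF z0] by (simp add: N_def)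
  have ids: "\<phi> (Fx y) (Fu y) $ j = y (j, 0)" "vderiv shift_field (\<lambda>y. Fx y $ i) y = f (Fx y) (Fu y) $ i"
    if y: "y \<in> N" for y i j
  proof -
    define z where "z = G (lift y)"
    have yV: "lift y \<in> V" and yY: "y \<in> Y" using y by (auto simp: N_def)
    have zW: "z \<in> W" using VU(1)[OF yV] U(2) by (auto simp: z_def)
    have eq: "\<Phi> z p = y p" if p: "p \<in> ?P" for p
    proof -
      have "\<Phi> z p = \<tau> z (\<sigma> p)" using \<tau>(1)[OF p] by simp
      also have "\<dots> = lift y (\<sigma> p)" using VU(2)[OF yV] by (simp add: z_def)
      also have "\<dots> = y p" using p inv_into_f_f[OF \<sigma> p] by (simp add: lift_def)
      finally show ?thesis .
    qed
    have zY: "\<Phi> z \<in> Y" by (rule \<Phi>_Y[OF zW])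
    have "\<forall>p\<in>order_less R. \<Phi> z p = y p" using eq by (auto simp: order_le_def order_less_def)
    then have Fxz: "Fx y = state z" using depends_Fx zY yY Fx_\<Phi>[OF zW] unfolding depends_on_def by metis
    have Fuz: "Fu y = inp z" using depends_Fu zY yY Fu_\<Phi>[OF zW] eq unfolding depends_on_def by metis
    show "\<phi> (Fx y) (Fu y) $ j = y (j, 0)" using eq[of "(j, 0)"] by (simp add: Fxz Fuz \<Phi>_0)
    have "depends_on ?P Y (vderiv shift_field (\<lambda>y. Fx y $ i))"
      by (rule depends_on_vderiv[OF open_Y depends_Fx_component])
        (auto simp: order_le_def order_less_def depends_on_def shift_field_def)
    then have "vderiv shift_field (\<lambda>y. Fx y $ i) y = vderiv shift_field (\<lambda>y. Fx y $ i) (\<Phi> z)"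
      using eq yY zY unfolding depends_on_def by (metis (no_types))
    also have "\<dots> = vderiv X (\<lambda>z. Fx (\<Phi> z) $ i) z"
      by (rule vderiv_\<Phi>_compose[OF smooth_Fx zW, symmetric])
    also have "\<dots> = vderiv X (\<lambda>z. z (Xc i)) z"
      by (rule vderiv_cong[OF open_W zW]) (simp add: Fx_\<Phi> state_def)
    also have "\<dots> = f (Fx y) (Fu y) $ i" by (simp add: Fxz Fuz open_loop_def)
    finally show "vderiv shift_field (\<lambda>y. Fx y $ i) y = f (Fx y) (Fu y) $ i" .
  qed
  have NY: "N \<subseteq> Y" by (auto simp: N_def)
  define Z where "Z = {y \<in> N. \<Xi> y \<in> W}"
  have Z: "open Z" unfolding Z_def
    by (rule open_vimage_on[OF N open_W continuous_on_subset[OF smooth_map_continuous_on[OF smooth_\<Xi>] NY]])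
  have ZY: "Z \<subseteq> Y" using NY by (auto simp: Z_def)
  \<comment> \<open>So \<Xi> carries the shift to the field of the system, and the identity at order
    0 can be differentiated to reach all orders of \<Phi> after \<Xi>.\<close>
  have field: "vderiv shift_field (\<lambda>y. \<Xi> y c) y = X c (\<Xi> y)" if "y \<in> Z" for y c
  proof (cases c)
    case (Xc i)
    then show ?thesis using ids(2)[of y i] that
      by (simp add: \<Xi>_simps open_loop_def state_\<Xi> inp_\<Xi> Z_def)
  next
    case (Uc j k)
    then show ?thesis using fun_cong[OF \<Xi>_simps(3), of y j k] by simp
  qed
  have "\<Phi> (\<Xi> y) (j, \<beta>) = y (j, \<beta>)" if "y \<in> Z" for y j \<beta>
    using that
  proof (induction \<beta> arbitrary: y)
    case 0
    then show ?case using ids(1)[of y j] by (simp add: \<Phi>_0 state_\<Xi> inp_\<Xi> Z_def)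
  next
    case (Suc \<beta>)
    have "\<Phi> (\<Xi> y) (j, Suc \<beta>) = vderiv X (\<lambda>z. \<Phi> z (j, \<beta>)) (\<Xi> y)"
      using vderiv_\<Phi>[of "\<Xi> y" "(j, \<beta>)"] Suc.prems by (simp add: Z_def shift_field_def)
    also have "\<dots> = vderiv shift_field (\<lambda>y. \<Phi> (\<Xi> y) (j, \<beta>)) y"
    proof (rule vderiv_compose[where F = \<Xi> and X' = X, symmetric])
      show "smooth_on Z (\<lambda>y. \<Xi> y d)" for d by (rule smooth_on_subset[OF smooth_\<Xi> ZY])
    qed (use Z open_W smooth_\<Phi> Suc.prems field in \<open>auto simp: Z_def\<close>)
    also have "\<dots> = vderiv shift_field (\<lambda>y. y (j, \<beta>)) y"
      by (rule vderiv_cong[OF Z Suc.prems Suc.IH])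
    finally show ?case by (simp add: shift_field_def)
  qed
  then have "\<Phi> (\<Xi> y) = y" if "y \<in> Z" for y using that by (auto simp: fun_eq_iff)
  then have "realizable Z" unfolding realizable_def using Z ZY ids(2) by (auto simp: Z_def)
  moreover have "\<Phi> z0 \<in> Z" using z0N z0 by (simp add: Z_def \<Xi>_\<Phi>)
  ultimately show ?thesis by blast
qed

abbreviation "S \<kappa> \<equiv> state_v_jet Fx \<kappa>"

lemma smooth_S: "smooth_on Y (\<lambda>y. S \<kappa> y c)"
  using smooth_Fx by (cases c) (auto simp: state_v_jet_def)

text \<open>The equation Fx = x is solved for the coordinates of order below \<kappa>, while the
  others already are the v^j_[l]. As |\<kappa>| = n, there are as many unknowns as
  equations.\<close>

lemma Psi_exists:
  assumes z0: "z0 \<in> W" and Z: "open Z" "Z \<subseteq> Y" "\<Phi> z0 \<in> Z"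
    and \<kappa>: "(\<Sum>j\<in>UNIV. \<kappa> j) = CARD('n)"
    and ind: "states_independent \<kappa> z0"
  shows "\<exists>Y' V \<Psi>. is_Psi Fx R \<kappa> Y' V \<Psi> \<and> Y' \<subseteq> Z \<and> \<Phi> z0 \<in> Y'"
proof -
  let ?Q = "order_less \<kappa>"
  let ?y0 = "\<Phi> z0"
  have rows: "\<forall>i\<in>UNIV. a i = 0"
    if a: "\<forall>q\<in>?Q. (\<Sum>i\<in>UNIV. a i * partial q (\<lambda>y. Fx y $ i) ?y0) = 0" for a
  proof -
    \<comment> \<open>If \<open>a\<close> kills the Jacobian of Fx in the orders below \<kappa>,
      then the combination of dx with coefficients \<open>a\<close> lies in the span of the
      remaining d\<phi>, with coefficients - b.\<close>
    define b where "b p = - (\<Sum>i\<in>UNIV. a i * partial p (\<lambda>y. Fx y $ i) ?y0)" for p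
    have "(\<Sum>i\<in>UNIV. a i * (if x = Xc i then 1 else 0))
        + (\<Sum>p\<in>order_less R - ?Q. b p * partial x (\<lambda>z. \<Phi> z p) z0) = 0" for x
    proof -
      have "(if x = Xc i then 1 else 0)
          = (\<Sum>p\<in>order_less R. partial p (\<lambda>y. Fx y $ i) ?y0 * partial x (\<lambda>z. \<Phi> z p) z0)" for i
      proof -
        have "(if x = Xc i then 1 else 0) = partial x (\<lambda>z. z (Xc i)) z0" by (simp add: partial_coordinate)
        also have "\<dots> = partial x (\<lambda>z. Fx (\<Phi> z) $ i) z0"
          by (rule partial_cong[OF open_W z0]) (simp add: Fx_\<Phi> state_def)
        also have "\<dots> = (\<Sum>p\<in>order_less R. partial p (\<lambda>y. Fx y $ i) ?y0 * partial x (\<lambda>z. \<Phi> z p) z0)"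
          by (rule partial_compose[OF open_W smooth_\<Phi> open_Y \<Phi>_Y smooth_Fx finite_order(2) depends_Fx_component z0])
        finally show ?thesis .
      qed
      then have "(\<Sum>i\<in>UNIV. a i * (if x = Xc i then 1 else 0))
          = (\<Sum>i\<in>UNIV. \<Sum>p\<in>order_less R. a i * partial p (\<lambda>y. Fx y $ i) ?y0 * partial x (\<lambda>z. \<Phi> z p) z0)"
        by (simp add: sum_distrib_left mult.assoc)
      also have "\<dots> = (\<Sum>p\<in>order_less R. - b p * partial x (\<lambda>z. \<Phi> z p) z0)"
        by (subst sum.swap) (simp add: b_def sum_distrib_right)
      also have "\<dots> = (\<Sum>p\<in>order_less R - ?Q. - b p * partial x (\<lambda>z. \<Phi> z p) z0)"
        by (rule sum.mono_neutral_right) (use a in \<open>auto simp: b_def\<close>)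
      finally show ?thesis by (simp add: sum_negf)
    qed
    then show ?thesis
      using ind[unfolded states_independent_def, THEN spec[of _ a], THEN spec[of _ b]] by blast
  qed
  have "\<exists>\<sigma> U V \<tau> G. coordinate_chart UNIV (\<lambda>i y. Fx y $ i) \<sigma> U V \<tau> G \<and> range \<sigma> \<subseteq> ?Q \<and> ?y0 \<in> U \<and> U \<subseteq> Z"
    by (rule coordinate_chart_exists[OF finite Z(1,3) smooth_on_subset[OF smooth_Fx Z(2)]]) (rule rows)
  then obtain \<sigma> U2 V2 \<tau> G where ch: "coordinate_chart UNIV (\<lambda>i y. Fx y $ i) \<sigma> U2 V2 \<tau> G"
    and \<sigma>Q: "range \<sigma> \<subseteq> ?Q" and U2: "?y0 \<in> U2" "U2 \<subseteq> Z"
    by blast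
  have \<sigma>: "inj \<sigma>" and oU2: "open U2" and oV2: "open V2" and \<tau>: "\<And>y i. \<tau> y (\<sigma> i) = Fx y $ i"
    "\<And>y p. p \<notin> range \<sigma> \<Longrightarrow> \<tau> y p = y p" and G: "\<And>p. smooth_on V2 (\<lambda>w. G w p)"
    and UV: "\<And>y. y \<in> U2 \<Longrightarrow> \<tau> y \<in> V2" "\<And>y. y \<in> U2 \<Longrightarrow> G (\<tau> y) = y"
    and VU: "\<And>w. w \<in> V2 \<Longrightarrow> G w \<in> U2" "\<And>w. w \<in> V2 \<Longrightarrow> \<tau> (G w) = w"
    using ch unfolding coordinate_chart_def by blast+
  \<comment> \<open>The n distinct slots fill all n coordinates below \<kappa>, so exactly the
    coordinates from \<kappa> on are left untouched.\<close>
  have range: "range \<sigma> = ?Q"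
    by (rule card_subset_eq[OF finite_order(2) \<sigma>Q]) (simp add: card_image[OF \<sigma>] card_order_less \<kappa>)
  obtain D \<epsilon> where D: "finite D" "\<epsilon> > 0" and box: "\<forall>y. (\<forall>d\<in>D. \<bar>y d - ?y0 d\<bar> < \<epsilon>) \<longrightarrow> y \<in> U2"
    by (rule open_contains_coordinate_box[OF oU2 U2(1)])
  \<comment> \<open>A box, because points that combine coordinates of two members must again be
    members.\<close>
  define Y' where "Y' = {y. \<forall>d\<in>D. \<bar>y d - ?y0 d\<bar> < \<epsilon>}"
  have oY': "open Y'" unfolding Y'_def by (rule open_coordinate_box[OF D(1)])
  have Y'U: "Y' \<subseteq> U2" using box by (auto simp: Y'_def)
  have Y'Y: "Y' \<subseteq> Y" using Y'U U2(2) Z(2) by blast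
  \<comment> \<open>Relabels (x, v, v_[1], ...) as chart coordinates; the components of
    \<open>S \<kappa> y\<close> become those of \<tau> y.\<close>
  define \<rho> where "\<rho> w p = (if p \<in> ?Q then w (Xc (inv \<sigma> p)) else w (Uc (fst p) (snd p - \<kappa> (fst p))))"
    for w :: "('n, 'm) jet" and p
  have \<rho>s: "smooth_on T (\<lambda>w. \<rho> w p)" for T p by (cases "p \<in> ?Q") (simp_all add: \<rho>_def)
  have \<rho>S: "\<rho> (S \<kappa> y) = \<tau> y" for y
  proof
    fix p
    show "\<rho> (S \<kappa> y) p = \<tau> y p"
    proof (cases "p \<in> ?Q")
      case True
      then obtain i where "p = \<sigma> i" using range by auto
      with True show ?thesis by (simp add: \<rho>_def state_v_jet_def inv_f_f[OF \<sigma>] \<tau>(1))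
    next
      case False
      then have "\<kappa> (fst p) \<le> snd p" by (cases p) auto
      with False show ?thesis using \<tau>(2)[of p y] range by (simp add: \<rho>_def state_v_jet_def)
    qed
  qed
  define \<Psi> where "\<Psi> w = G (\<rho> w)" for w
  define V where "V = {w \<in> {w. \<rho> w \<in> V2}. G (\<rho> w) \<in> Y'}"
  have o1: "open {w. \<rho> w \<in> V2}"
    using open_vimage_on[OF open_UNIV oV2 smooth_map_continuous_on[OF \<rho>s]] by simp
  have Gs: "smooth_on {w. \<rho> w \<in> V2} (\<lambda>w. G (\<rho> w) p)" for p
    by (rule smooth_on_compose[OF o1 \<rho>s oV2 _ G]) simp
  have oV: "open V" unfolding V_def
    by (rule open_vimage_on[OF o1 oY' smooth_map_continuous_on[OF Gs]])
  have YV: "S \<kappa> y \<in> V" "\<Psi> (S \<kappa> y) = y" if "y \<in> Y'" for y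
    using that UV[of y] Y'U by (auto simp: V_def \<Psi>_def \<rho>S)
  have VY: "\<Psi> w \<in> Y'" "S \<kappa> (\<Psi> w) = w" if w: "w \<in> V" for w
  proof -
    have \<rho>w: "\<rho> w \<in> V2" using w by (simp add: V_def)
    show "\<Psi> w \<in> Y'" using w by (simp add: V_def \<Psi>_def)
    show "S \<kappa> (\<Psi> w) = w"
    proof
      fix c
      show "S \<kappa> (\<Psi> w) c = w c"
      proof (cases c)
        case (Xc i)
        have "Fx (G (\<rho> w)) $ i = \<rho> w (\<sigma> i)" using VU(2)[OF \<rho>w] \<tau>(1)[of "G (\<rho> w)" i] by simp
        moreover have "\<sigma> i \<in> ?Q" using range by auto
        ultimately have "Fx (G (\<rho> w)) $ i = w (Xc i)" by (simp add: \<rho>_def inv_f_f[OF \<sigma>])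
        then show ?thesis using Xc by (simp add: state_v_jet_def \<Psi>_def)
      next
        case (Uc j l)
        have "G (\<rho> w) (j, \<kappa> j + l) = \<rho> w (j, \<kappa> j + l)"
          using VU(2)[OF \<rho>w] \<tau>(2)[of "(j, \<kappa> j + l)" "G (\<rho> w)"] range by simp
        then show ?thesis using Uc by (simp add: state_v_jet_def \<Psi>_def \<rho>_def)
      qed
    qed
  qed
  have dep: "depends_on (range Xc \<union> {Uc j' l | j' l. \<kappa> j' + l \<le> R j'}) V (\<lambda>w. \<Psi> w (j, \<beta>))"
    if \<beta>: "\<beta> \<le> R j" for j \<beta>
    unfolding depends_on_def
  proof (intro ballI impI)
    fix w w' assume w: "w \<in> V" "w' \<in> V"
      and eq: "\<forall>c\<in>range Xc \<union> {Uc j' l | j' l. \<kappa> j' + l \<le> R j'}. w c = w' c"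
    \<comment> \<open>A hybrid of both images. Fx sees orders below R only and \<open>w\<close>,
      \<open>w'\<close> agree on (x, v) up to R, so \<open>S \<kappa>\<close> sends the hybrid to
      \<open>w'\<close>; by injectivity it is \<Psi> w'.\<close>
    define y where "y p = (if p \<in> order_le R then \<Psi> w p else \<Psi> w' p)" for p
    have y: "y \<in> Y'" using VY(1)[OF w(1)] VY(1)[OF w(2)] by (auto simp: Y'_def y_def)
    have "\<forall>p\<in>order_less R. y p = \<Psi> w p" by (auto simp: y_def)
    then have "Fx y = Fx (\<Psi> w)"
      using depends_Fx y VY(1)[OF w(1)] Y'Y unfolding depends_on_def by blast
    have "S \<kappa> y c = S \<kappa> (\<Psi> w') c" for c
    proof (cases c)
      case (Xc i)
      have "S \<kappa> y c = S \<kappa> (\<Psi> w) c" using Xc \<open>Fx y = Fx (\<Psi> w)\<close> by (simp add: state_v_jet_def)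
      also have "\<dots> = S \<kappa> (\<Psi> w') c" using VY(2)[OF w(1)] VY(2)[OF w(2)] eq Xc by simp
      finally show ?thesis .
    next
      case (Uc j l)
      show ?thesis
      proof (cases "\<kappa> j + l \<le> R j")
        case True
        then have "S \<kappa> y c = S \<kappa> (\<Psi> w) c" using Uc by (simp add: state_v_jet_def y_def)
        also have "\<dots> = S \<kappa> (\<Psi> w') c" using VY(2)[OF w(1)] VY(2)[OF w(2)] eq Uc True by auto
        finally show ?thesis .
      next
        case False
        then show ?thesis using Uc by (simp add: state_v_jet_def y_def)
      qed
    qed
    then have "S \<kappa> y = S \<kappa> (\<Psi> w')" by blast
    then have "y = \<Psi> w'" using YV(2)[OF y] YV(2)[OF VY(1)[OF w(2)]] by metis
    then show "\<Psi> w (j, \<beta>) = \<Psi> w' (j, \<beta>)" using \<beta> by (auto simp: y_def fun_eq_iff split: if_splits)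
  qed
  have "is_Psi Fx R \<kappa> Y' V \<Psi>"
    unfolding is_Psi_def
  proof (intro conjI ballI allI impI)
    show "smooth_on Y' (\<lambda>y. S \<kappa> y c)" for c by (rule smooth_on_subset[OF smooth_S Y'Y])
    show "smooth_on V (\<lambda>w. \<Psi> w p)" for p
      unfolding \<Psi>_def by (rule smooth_on_subset[OF Gs]) (auto simp: V_def)
  qed (use oY' oV YV VY dep in auto)
  moreover have "Y' \<subseteq> Z" using Y'U U2(2) by blast
  moreover have "?y0 \<in> Y'" using D(2) by (simp add: Y'_def)
  ultimately show ?thesis by blast
qed

end

section \<open>The closed loop in output coordinates\<close>

locale linearizing_chart = flat_system f \<phi> W Y R Fx Fu
  for f \<phi> and W :: "('n::finite, 'm::finite) jet set" and Y R Fx Fu +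
  fixes \<kappa> :: "'m \<Rightarrow> nat"
    and Y' :: "('m \<times> nat \<Rightarrow> real) set"
    and V :: "('n, 'm) jet set"
    and \<Psi> :: "('n, 'm) jet \<Rightarrow> 'm \<times> nat \<Rightarrow> real"
  assumes Psi: "is_Psi Fx R \<kappa> Y' V \<Psi>" and real: "realizable Y'"
begin

definition W' :: "('n, 'm) jet set" where
  "W' = {z \<in> W. \<Phi> z \<in> Y'}"

abbreviation feedback :: "('n, 'm) jet \<Rightarrow> real ^ 'm" where
  "feedback w \<equiv> Fu (\<Psi> w)"

abbreviation "Xcl \<equiv> jet_field (closed_loop f feedback)"

lemma open_Y': "open Y'" and open_V: "open V" and Y'_Y: "Y' \<subseteq> Y"
  and S_V: "y \<in> Y' \<Longrightarrow> S \<kappa> y \<in> V" and \<Psi>_S: "y \<in> Y' \<Longrightarrow> \<Psi> (S \<kappa> y) = y"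
  and \<Psi>_Y': "w \<in> V \<Longrightarrow> \<Psi> w \<in> Y'" and S_\<Psi>: "w \<in> V \<Longrightarrow> S \<kappa> (\<Psi> w) = w"
  and smooth_\<Psi>: "smooth_on V (\<lambda>w. \<Psi> w p)"
  using Psi real unfolding is_Psi_def realizable_def by (simp_all del: split_paired_All)

lemma \<Xi>_W: "y \<in> Y' \<Longrightarrow> \<Xi> y \<in> W" and \<Phi>_\<Xi>: "y \<in> Y' \<Longrightarrow> \<Phi> (\<Xi> y) = y"
  and Fx_shift: "y \<in> Y' \<Longrightarrow> vderiv shift_field (\<lambda>y. Fx y $ i) y = f (Fx y) (Fu y) $ i"
  using real unfolding realizable_def by auto

lemma open_W': "open W'"
  unfolding W'_def by (rule open_vimage_on[OF open_W open_Y' smooth_map_continuous_on[OF smooth_\<Phi>]])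

lemma state_\<Psi>: "w \<in> V \<Longrightarrow> Fx (\<Psi> w) = state w"
proof -
  assume "w \<in> V"
  then have "S \<kappa> (\<Psi> w) (Xc i) = w (Xc i)" for i by (simp add: S_\<Psi>)
  then show ?thesis by (simp add: state_v_jet_def state_def vec_eq_iff)
qed

text \<open>Seen through output jets the closed loop is the pure shift: the state components come
  from realizability, the v components are a renaming.\<close>

lemma vderiv_S: "y \<in> Y' \<Longrightarrow> vderiv shift_field (\<lambda>y. S \<kappa> y c) y = Xcl c (S \<kappa> y)"
proof (cases c)
  case (Xc i)
  assume y: "y \<in> Y'"
  have "state (S \<kappa> y) = Fx y" by (simp add: state_def state_v_jet_def vec_eq_iff)
  then show ?thesis using Xc y Fx_shift[OF y, of i] \<Psi>_S[OF y] by (simp add: state_v_jet_def closed_loop_def)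
next
  case (Uc j k)
  then show ?thesis by (simp add: state_v_jet_def shift_field_def)
qed

text \<open>Follows by differentiating \<Psi> after S = identity along the shift, so no formula for
  the derivatives of \<Psi> is needed.\<close>

lemma vderiv_\<Psi>: "w \<in> V \<Longrightarrow> vderiv Xcl (\<lambda>w. \<Psi> w p) w = shift_field p (\<Psi> w)"
proof -
  assume w: "w \<in> V"
  define y where "y = \<Psi> w"
  have y: "y \<in> Y'" "S \<kappa> y = w" using w by (simp_all add: y_def \<Psi>_Y' S_\<Psi>)
  have "vderiv shift_field (\<lambda>y. \<Psi> (S \<kappa> y) p) y = vderiv Xcl (\<lambda>w. \<Psi> w p) (S \<kappa> y)"
    by (rule vderiv_compose[where F = "S \<kappa>" and X' = Xcl, OF open_Y' smooth_on_subset[OF smooth_S Y'_Y] open_V S_V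
          smooth_\<Psi> y(1) vderiv_S[OF y(1)]])
  moreover have "vderiv shift_field (\<lambda>y. \<Psi> (S \<kappa> y) p) y = vderiv shift_field (\<lambda>y. y p) y"
    by (rule vderiv_cong[OF open_Y' y(1)]) (simp add: \<Psi>_S)
  ultimately show ?thesis by (simp add: y(2) y_def[symmetric])
qed

lemma smooth_\<Xi>_\<Psi>: "smooth_on V (\<lambda>w. \<Xi> (\<Psi> w) c)"
  by (rule smooth_on_compose[OF open_V smooth_\<Psi> open_Y' \<Psi>_Y' smooth_on_subset[OF smooth_\<Xi> Y'_Y]])

text \<open>\<Psi> carries the closed loop field to the shift, along which \<Xi> was prolonged; so
  closed-loop derivatives of the feedback are the input components of \<Xi>.\<close>

lemma prolong_feedback: "w \<in> V \<Longrightarrow> prolong (closed_loop f feedback) feedback w = \<Xi> (\<Psi> w)"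
proof
  fix c
  assume w: "w \<in> V"
  show "prolong (closed_loop f feedback) feedback w c = \<Xi> (\<Psi> w) c"
  proof (cases c)
    case (Xc i)
    then show ?thesis using state_\<Psi>[OF w] by (simp add: prolong_def \<Xi>_simps state_def)
  next
    case (Uc j k)
    have "(lie (closed_loop f feedback) ^^ k) (\<lambda>w. feedback w $ j) w = \<Xi> (\<Psi> w) (Uc j k)" if "w \<in> V" for w
      using that
    proof (induction k arbitrary: w)
      case 0
      then show ?case by (simp add: \<Xi>_simps)
    next
      case (Suc k)
      have "(lie (closed_loop f feedback) ^^ Suc k) (\<lambda>w. feedback w $ j) w
          = lie (closed_loop f feedback) (\<lambda>w. \<Xi> (\<Psi> w) (Uc j k)) w"
        using lie_cong[OF open_V Suc.prems Suc.IH] by simp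
      also have "\<dots> = vderiv Xcl (\<lambda>w. \<Xi> (\<Psi> w) (Uc j k)) w"
        by (rule lie_eq_vderiv[OF open_V Suc.prems smooth_\<Xi>_\<Psi>])
      also have "\<dots> = vderiv shift_field (\<lambda>y. \<Xi> y (Uc j k)) (\<Psi> w)"
        by (rule vderiv_compose[where F = \<Psi> and X' = shift_field, OF open_V smooth_\<Psi> open_Y' \<Psi>_Y'
              smooth_on_subset[OF smooth_\<Xi> Y'_Y] Suc.prems vderiv_\<Psi>[OF Suc.prems]])
      finally show ?case using fun_cong[OF \<Xi>_simps(3), of "\<Psi> w" j k] by simp
    qed
    then show ?thesis using Uc w by (simp add: prolong_def)
  qed
qed

abbreviation "new_input z \<equiv> (\<chi> j. \<Phi> z (j, \<kappa> j))"

lemma prolong_new_input: "z \<in> W \<Longrightarrow> prolong (open_loop f) new_input z = S \<kappa> (\<Phi> z)"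
proof
  fix c
  assume z: "z \<in> W"
  show "prolong (open_loop f) new_input z c = S \<kappa> (\<Phi> z) c"
  proof (cases c)
    case (Xc i)
    then show ?thesis using Fx_\<Phi>[OF z] by (simp add: prolong_def state_v_jet_def state_def)
  next
    case (Uc j k)
    have "(lie (open_loop f) ^^ k) (\<lambda>z. \<Phi> z (j, \<beta>)) = (\<lambda>z. \<Phi> z (j, \<beta> + k))" for \<beta>
      by (induction k) (simp_all add: \<Phi>_Suc)
    then show ?thesis using Uc by (simp add: prolong_def state_v_jet_def)
  qed
qed

lemma smooth_S_\<Phi>: "smooth_on W (\<lambda>z. S \<kappa> (\<Phi> z) c)"
  by (rule smooth_on_compose[OF open_W smooth_\<Phi> open_Y \<Phi>_Y smooth_S])

lemma W'_V: "z \<in> W' \<Longrightarrow> S \<kappa> (\<Phi> z) \<in> V \<and> \<Xi> (\<Psi> (S \<kappa> (\<Phi> z))) = z"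
  unfolding W'_def using S_V \<Psi>_S \<Xi>_\<Phi> by simp

lemma V_W': "w \<in> V \<Longrightarrow> \<Xi> (\<Psi> w) \<in> W' \<and> S \<kappa> (\<Phi> (\<Xi> (\<Psi> w))) = w"
  unfolding W'_def using \<Psi>_Y' \<Xi>_W \<Phi>_\<Xi> S_\<Psi> by simp

lemma W'_W: "W' \<subseteq> W"
  by (auto simp: W'_def)

lemma independent_S_\<Phi>: "independent_differentials W' UNIV (\<lambda>c z. S \<kappa> (\<Phi> z) c)"
  by (rule independent_differentials_of_diffeomorphism[OF open_W' smooth_on_subset[OF smooth_S_\<Phi> W'_W] W'_V
        open_V smooth_\<Xi>_\<Psi> V_W'])

lemma quasi_static: "quasi_static_feedback f W' V feedback new_input"
proof -
  have A: "prolong (closed_loop f feedback) feedback w = \<Xi> (\<Psi> w)" if "w \<in> V" for w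
    by (rule prolong_feedback[OF that])
  have B: "prolong (open_loop f) new_input z = S \<kappa> (\<Phi> z)" if "z \<in> W'" for z
    by (rule prolong_new_input) (use that W'_W in blast)
  have "smooth_on V (\<lambda>w. prolong (closed_loop f feedback) feedback w c)" for c
    by (rule smooth_on_cong[OF open_V smooth_\<Xi>_\<Psi>]) (simp add: A)
  moreover have "smooth_on W' (\<lambda>z. prolong (open_loop f) new_input z c)" for c
    by (rule smooth_on_cong[OF open_W' smooth_on_subset[OF smooth_S_\<Phi> W'_W]]) (simp add: B)
  moreover have "independent_differentials W' UNIV (\<lambda>c z. prolong (open_loop f) new_input z c)"
    by (rule independent_differentials_reindex[OF open_W' independent_S_\<Phi>, of id]) (simp_all add: B)
  ultimately show ?thesis
    unfolding quasi_static_feedback_def Let_def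
    using open_W' open_V A B W'_V V_W' by simp
qed

text \<open>These functions are distinct components of the diffeomorphism S after \<Phi>, namely the
  x^i and the v^j_[\<beta> - \<kappa>^j].\<close>

lemma independent_state_outputs:
  "independent_differentials W' (range Inl \<union> Inr ` {(j, \<beta>). \<kappa> j \<le> \<beta> \<and> \<beta> < R j})
     (case_sum (\<lambda>i z. z (Xc i)) (\<lambda>p z. \<Phi> z p))"
proof (rule independent_differentials_reindex[OF open_W' independent_S_\<Phi>,
      of "case_sum Xc (\<lambda>p. Uc (fst p) (snd p - \<kappa> (fst p)))"])
  show "inj_on (case_sum Xc (\<lambda>p. Uc (fst p) (snd p - \<kappa> (fst p))) :: 'n + 'm \<times> nat \<Rightarrow> ('n, 'm) coord)
      (range Inl \<union> Inr ` {(j, \<beta>). \<kappa> j \<le> \<beta> \<and> \<beta> < R j})"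
    by (auto simp: inj_on_def)
  fix k :: "'n + 'm \<times> nat" and z assume k: "k \<in> range Inl \<union> Inr ` {(j, \<beta>). \<kappa> j \<le> \<beta> \<and> \<beta> < R j}" and z: "z \<in> W'"
  then have "z \<in> W" using W'_W by blast
  with k Fx_\<Phi>[OF this] show "case_sum (\<lambda>i z. z (Xc i)) (\<lambda>p z. \<Phi> z p) k z
      = S \<kappa> (\<Phi> z) (case_sum Xc (\<lambda>p. Uc (fst p) (snd p - \<kappa> (fst p))) k)"
    by (auto simp: state_v_jet_def state_def)
qed auto

section \<open>Input-output behavior along trajectories\<close>

lemma trajectory_derivative:
  assumes tr: "closed_loop_trajectory f V feedback T x v" and t: "t \<in> T"
  shows "((\<lambda>t. trajectory_jet x v t c) has_real_derivative Xcl c (trajectory_jet x v t)) (at t)"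
proof (cases c)
  case (Xc i)
  have "(x has_vector_derivative f (x t) (feedback (trajectory_jet x v t))) (at t)"
    using tr t unfolding closed_loop_trajectory_def by blast
  from bounded_linear.has_vector_derivative[OF bounded_linear_vec_nth this, of i]
  have "((\<lambda>t. x t $ i) has_real_derivative f (x t) (feedback (trajectory_jet x v t)) $ i) (at t)"
    by (simp add: has_real_derivative_iff_has_vector_derivative)
  moreover have "state (trajectory_jet x v t) = x t"
    by (simp add: state_def trajectory_jet_def vec_eq_iff)
  ultimately show ?thesis using Xc by (simp add: trajectory_jet_def closed_loop_def)
next
  case (Uc j k)
  have "(deriv ^^ k) (\<lambda>s. v s $ j) field_differentiable at t"
    using tr t unfolding closed_loop_trajectory_def by blast
  then show ?thesis using Uc by (simp add: trajectory_jet_def DERIV_deriv_iff_field_differentiable)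
qed

text \<open>The jet of a closed-loop trajectory is an integral curve of the closed-loop field, on
  which \<Psi> turns the field into the shift.\<close>

lemma output_along_trajectory:
  assumes tr: "closed_loop_trajectory f V feedback T x v" and t: "t \<in> T"
  shows "((\<lambda>t. \<Psi> (trajectory_jet x v t) (j, k)) has_real_derivative \<Psi> (trajectory_jet x v t) (j, Suc k)) (at t)"
proof -
  have T: "open T" and V: "\<And>t. t \<in> T \<Longrightarrow> trajectory_jet x v t \<in> V"
    using tr unfolding closed_loop_trajectory_def by blast+
  have "\<forall>\<^sub>F t in nhds t. trajectory_jet x v t \<in> V"
    using eventually_nhds_in_open[OF T t] by eventually_elim (rule V)
  from vderiv_curve[where \<gamma> = "trajectory_jet x v" and X = Xcl, OF open_V smooth_\<Psi> this
      trajectory_derivative[OF tr t], of "(j, k)"]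
  show ?thesis unfolding vderiv_\<Psi>[OF V[OF t]] by (simp add: shift_field_def)
qed

lemma io: "io_behavior f \<phi> V feedback \<kappa>"
  unfolding io_behavior_def Let_def
proof (intro allI impI ballI)
  fix T x v t j
  assume tr: "closed_loop_trajectory f V feedback T x v" and t: "t \<in> T"
  let ?\<gamma> = "trajectory_jet x v"
  define y where "y s = \<phi> (x s) (feedback (?\<gamma> s)) $ j" for s
  have T: "open T" and V: "\<And>t. t \<in> T \<Longrightarrow> ?\<gamma> t \<in> V"
    using tr unfolding closed_loop_trajectory_def by blast+
  have y0: "y s = \<Psi> (?\<gamma> s) (j, 0)" if "s \<in> T" for s
  proof -
    let ?w = "?\<gamma> s"
    have w: "?w \<in> V" by (rule V[OF that])
    have "\<Psi> ?w (j, 0) = \<phi> (state (\<Xi> (\<Psi> ?w))) (inp (\<Xi> (\<Psi> ?w))) $ j"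
      using \<Phi>_\<Xi>[OF \<Psi>_Y'[OF w]] \<Phi>_0[of "\<Xi> (\<Psi> ?w)" j] by simp
    moreover have "state ?w = x s" by (simp add: state_def trajectory_jet_def vec_eq_iff)
    ultimately show ?thesis by (simp add: y_def state_\<Xi> inp_\<Xi> state_\<Psi>[OF w])
  qed
  \<comment> \<open>Value and derivative are proved together on all of the open set
    \<open>T\<close>, because the next \<open>deriv\<close> needs the equality in a
    neighborhood.\<close>
  have yk: "\<forall>s\<in>T. (deriv ^^ k) y s = \<Psi> (?\<gamma> s) (j, k) \<and>
      ((deriv ^^ k) y has_real_derivative \<Psi> (?\<gamma> s) (j, Suc k)) (at s)" for k
  proof (induction k)
    case 0
    show ?case
    proof
      fix s assume s: "s \<in> T"
      have "(y has_real_derivative \<Psi> (?\<gamma> s) (j, Suc 0)) (at s)"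
        by (rule has_field_derivative_transform_within_open[OF output_along_trajectory[OF tr s] T s])
          (simp add: y0)
      with y0[OF s] show "(deriv ^^ 0) y s = \<Psi> (?\<gamma> s) (j, 0) \<and>
        ((deriv ^^ 0) y has_real_derivative \<Psi> (?\<gamma> s) (j, Suc 0)) (at s)" by simp
    qed
  next
    case (Suc k)
    have eq: "(deriv ^^ Suc k) y s = \<Psi> (?\<gamma> s) (j, Suc k)" if "s \<in> T" for s
      using Suc that by (auto intro: DERIV_imp_deriv)
    show ?case
    proof
      fix s assume s: "s \<in> T"
      have "((deriv ^^ Suc k) y has_real_derivative \<Psi> (?\<gamma> s) (j, Suc (Suc k))) (at s)"
        by (rule has_field_derivative_transform_within_open[OF output_along_trajectory[OF tr s] T s])
          (simp only: eq)
      with eq[OF s] show "(deriv ^^ Suc k) y s = \<Psi> (?\<gamma> s) (j, Suc k) \<and>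
        ((deriv ^^ Suc k) y has_real_derivative \<Psi> (?\<gamma> s) (j, Suc (Suc k))) (at s)" by blast
    qed
  qed
  have "S \<kappa> (\<Psi> (?\<gamma> t)) (Uc j 0) = ?\<gamma> t (Uc j 0)"
    using S_\<Psi>[OF V[OF t]] by simp
  then have "\<Psi> (?\<gamma> t) (j, \<kappa> j) = v t $ j"
    by (simp add: state_v_jet_def trajectory_jet_def)
  with yk t show "(\<forall>k<\<kappa> j. (deriv ^^ k) (\<lambda>s. \<phi> (x s) (feedback (?\<gamma> s)) $ j) field_differentiable at t) \<and>
      (deriv ^^ \<kappa> j) (\<lambda>s. \<phi> (x s) (feedback (?\<gamma> s)) $ j) t = v t $ j"
    unfolding y_def[abs_def, symmetric] field_differentiable_def by auto
qed

end

theorem corollary3p9: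
  fixes f :: "real ^ 'n \<Rightarrow> real ^ 'm \<Rightarrow> real ^ 'n"
    and \<phi> :: "real ^ 'n \<Rightarrow> real ^ 'm \<Rightarrow> real ^ 'm"
    and W :: "('n::finite, 'm::finite) jet set"
    and Y :: "('m \<times> nat \<Rightarrow> real) set"
    and R :: "'m \<Rightarrow> nat"
    and Fx :: "('m \<times> nat \<Rightarrow> real) \<Rightarrow> real ^ 'n"
    and Fu :: "('m \<times> nat \<Rightarrow> real) \<Rightarrow> real ^ 'm"
  assumes "smooth_system f W"
    and "minimal_flat_parameterization f (xu_output \<phi>) W Y R Fx Fu"
  shows "\<exists>D. open D \<and> D \<subseteq> W \<and> W \<subseteq> closure D \<and>
    (\<forall>z\<^sub>0\<in>D. \<exists>\<kappa> :: 'm \<Rightarrow> nat. \<kappa> \<le> R \<and> (\<Sum>j\<in>UNIV. \<kappa> j) = CARD('n) \<and>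
      (\<exists>W' Y' V \<Psi>. open W' \<and> z\<^sub>0 \<in> W' \<and> W' \<subseteq> W \<and>
        Y' \<subseteq> Y \<and> output_jet f (xu_output \<phi>) ` W' \<subseteq> Y' \<and>
        independent_differentials W'
          (range Inl \<union> Inr ` {(j, \<beta>). \<kappa> j \<le> \<beta> \<and> \<beta> < R j})
          (case_sum (\<lambda>i z. z (Xc i)) (\<lambda>p z. output_jet f (xu_output \<phi>) z p)) \<and>
        is_Psi Fx R \<kappa> Y' V \<Psi> \<and>
        quasi_static_feedback f W' V (\<lambda>w. Fu (\<Psi> w))
          (\<lambda>z. \<chi> j. output_jet f (xu_output \<phi>) z (j, \<kappa> j)) \<and>
        io_behavior f \<phi> V (\<lambda>w. Fu (\<Psi> w)) \<kappa>))"
proof -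
  interpret flat_system f \<phi> W Y R Fx Fu
    using assms by unfold_locales (simp_all add: minimal_flat_parameterization_def)
  define good where "good W' \<longleftrightarrow> open W' \<and> W' \<subseteq> W \<and>
      (\<exists>\<kappa>. \<kappa> \<le> R \<and> (\<Sum>j\<in>UNIV. \<kappa> j) = CARD('n) \<and> (\<exists>Y' V \<Psi>. Y' \<subseteq> Y \<and> \<Phi> ` W' \<subseteq> Y' \<and>
        independent_differentials W' (range Inl \<union> Inr ` {(j, \<beta>). \<kappa> j \<le> \<beta> \<and> \<beta> < R j})
          (case_sum (\<lambda>i z. z (Xc i)) (\<lambda>p z. \<Phi> z p)) \<and>
        is_Psi Fx R \<kappa> Y' V \<Psi> \<and>
        quasi_static_feedback f W' V (\<lambda>w. Fu (\<Psi> w)) (\<lambda>z. \<chi> j. \<Phi> z (j, \<kappa> j)) \<and>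
        io_behavior f \<phi> V (\<lambda>w. Fu (\<Psi> w)) \<kappa>))" for W'
  define D where "D = \<Union> {W'. good W'}"
  have "open D" "D \<subseteq> W" unfolding D_def good_def by auto
  \<comment> \<open>Within any such \<open>U\<close> a suitable \<open>z0\<close> exists. The good
    neighborhood built around it need not stay inside \<open>U\<close>, but it contains
    \<open>z0\<close>.\<close>
  have dense: "U \<inter> D \<noteq> {}" if U: "open U" "U \<subseteq> W" "U \<noteq> {}" for U
  proof -
    obtain z0 \<kappa> where z0: "z0 \<in> U" and \<kappa>: "\<kappa> \<le> R" "(\<Sum>j\<in>UNIV. \<kappa> j) = CARD('n)"
      and ind: "outputs_independent z0" "states_independent \<kappa> z0"
      using generic_indices[OF U] by blast
    have z0W: "z0 \<in> W" using z0 U(2) by blast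
    obtain Z where Z: "realizable Z" "\<Phi> z0 \<in> Z" using realizable_exists[OF z0W ind(1)] by blast
    then have "open Z" "Z \<subseteq> Y" by (simp_all add: realizable_def)
    from Psi_exists[OF z0W this Z(2) \<kappa>(2) ind(2)] obtain Y' V \<Psi> where P: "is_Psi Fx R \<kappa> Y' V \<Psi>" "Y' \<subseteq> Z" "\<Phi> z0 \<in> Y'" by blast
    interpret linearizing_chart f \<phi> W Y R Fx Fu \<kappa> Y' V \<Psi>
      by unfold_locales (use P open_realizable[OF Z(1) P(2)] in \<open>auto simp: is_Psi_def\<close>)
    have "\<Phi> ` W' \<subseteq> Y'" by (auto simp: W'_def)
    with \<kappa> have "good W'"
      unfolding good_def using open_W' W'_W Y'_Y independent_state_outputs P(1) quasi_static io by blast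
    then have "z0 \<in> D" using z0W P(3) unfolding D_def by (auto simp: W'_def)
    with z0 show ?thesis by blast
  qed
  have "W \<subseteq> closure D"
  proof (rule ccontr)
    assume "\<not> W \<subseteq> closure D"
    \<comment> \<open>The part of \<open>W\<close> missed by the closure is itself open, so density
      applies to it.\<close>
    then have "(W - closure D) \<inter> D \<noteq> {}" by (intro dense) (auto intro: open_Diff open_W)
    then show False using closure_subset by blast
  qed
  with \<open>open D\<close> \<open>D \<subseteq> W\<close> show ?thesis
    by (intro exI[of _ D] conjI ballI; (assumption | unfold D_def good_def, blast))
qed

end
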